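(* Let $X_\tau$ be a site with a final object $X$, $G$ a finite group, and $A$ an abelian sheaf on $X_\tau$ with a left action of $G$ by automorphisms $\{\phi_g\}_{g\in G}$. Let $i: A^G \to A$ be the inclusion of the sheaf of invariants. If an $A$-torsor $y$ on $X$ is induced from the invariants, then $y$ admits a lift of the given action on $A$ whose obstruction class in $H^2(G,A(X))$ is zero. Similarly, if a gerbe $\mathscr{Y}$ banded by $A$ is induced from the invariants, then $\mathscr{Y}$ admits a lift of the action whose obstruction class in $H^3(G,A(X))$ is zero. More concretely: (a) Let $\overline{y}$ be an $A^G$-torsor with an $i$-equivariant morphism $f:\overline{y}\to y$ to an $A$-torsor $y$. Then there are unique automorphisms $\{\lambda_g\}_{g\in G}$ of $y$ lifting the $G$-action such that $\lambda_g\circ f=f$ for all $g\in G$. The associated $2$-cochain $\chi_\lambda$ is zero. (b) Let $\overline{\mathscr{Y}}$ be an abelian gerbe banded by $A^G$ with an $i$-equivariant morphism $\Theta:\overline{\mathscr{Y}}\to\mathscr{Y}$ to a gerbe $\mathscr{Y}$ banded by $A$. Then there are automorphisms $\{F_g\}_{g\in G}$ of $\mathscr{Y}$, unique up to $2$-isomorphism, that lift the $G$-action and are such that $F_g\circ\Theta$ and $\Theta$ are $2$-isomorphic for all $g\in G$. The associated obstruction class $\kappa_F\in H^3(G,A(X))$ is zero.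
   Context: Abelian sheaves are written additively. A left action of $G$ on $A$ is a family of automorphisms $\phi_g:A\to A$ of abelian sheaves with $\phi_{gh}=\phi_g\circ\phi_h$; write $g\cdot a=\phi_g(a)$. $A^G$ is the sheaf $U\mapsto A(U)^G$. Torsors. An $A$-torsor is a sheaf of sets $y$ on $X_\tau$ with an action $A\times y\to y$ such that $A(U)$ acts simply transitively on $y(U)$ whenever $y(U)\neq\emptyset$, and every object $U$ has a cover $\{U_i\to U\}$ with all $y(U_i)\ne\emptyset$. For a homomorphism $f:A_1\to A_2$ of abelian sheaves, a morphism $\lambda:y_1\to y_2$ from an $A_1$-torsor to an $A_2$-torsor is $f$-equivariant if $\lambda(a\cdot x)=f(a)\cdot\lambda(x)$. A lift of the action $\{\phi_g\}$ to an $A$-torsor $y$ is a family of morphisms $\lambda_g:y\to y$ ($g\in G$), with $\lambda_g$ being $\phi_g$-equivariant (no condition $\lambda_{gh}=\lambda_g\lambda_h$ is imposed). Its $2$-cochain $\chi_\lambda$ is defined by $\lambda_g\circ\lambda_h=\chi_\lambda(g,h)\cdot\lambda_{gh}$ with $\chi_\lambda(g,h)\in A(X)$; it is a $2$-cocycle, and its class in $H^2(G,A(X))$ is the obstruction class. $y$ is induced from the invariants if there are an $A^G$-torsor $\overline y$ and an $i$-equivariant morphism $\overline y\to y$. Gerbes. An abelian gerbe over $X$ is a stack in groupoids over $X_\tau$ in which objects exist locally over every $U$, any two objects over the same $U$ are locally isomorphic, and all automorphism sheaves are abelian. It is banded by $A$ if it is given with isomorphisms $A|_U\cong\mathrm{Aut}(x)$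 for all objects $x$ over $U$, compatible with isomorphisms of objects and with restriction. A morphism of gerbes is a morphism of fibered categories over $X_\tau$; it induces a homomorphism of bands, and is called $f$-equivariant if this homomorphism is $f$. $2$-morphisms are base-preserving natural transformations; two morphisms are $2$-isomorphic if there is a $2$-isomorphism between them. For a morphism $F:\mathscr Y_1\to\mathscr Y_2$ with $\mathscr Y_2$ banded by $A_2$, the group of $2$-automorphisms of $F$ is identified with $A_2(X)$ (a section acts on each $F(x)$ through $A_2|_U\cong\mathrm{Aut}(F(x))$). An action of $G$ on a gerbe $\mathscr Y$ banded by $A$ is a family of morphisms $F_g:\mathscr Y\to\mathscr Y$ such that $F_1$ is $A$-equivariant (i.e. $\mathrm{id}_A$-equivariant) and $F_{gh}$ is $2$-isomorphic to $F_g\circ F_h$ for all $g,h$. It is a lift of the given action on $A$ if $F_g$ is $\phi_g$-equivariant for all $g$. Choosing connecting $2$-morphisms $\alpha_{g,h}:F_{gh}\to F_g\circ F_h$, the $3$-cochain $\kappa_{(F,\alpha)}$ with values in $A(X)$ is defined by letting $\kappa_{(F,\alpha)}(g_1,g_2,g_3)$ be the $2$-automorphism of $F_{g_1g_2g_3}$ with $$(\alpha_{g_1,g_2}\star \mathrm{id}_{F_{g_3}})\circ\alpha_{g_1g_2,g_3}\circ\kappa_{(F,\alpha)}(g_1,g_2,g_3)=(\mathrm{id}_{F_{g_1}}\star\alpha_{g_2,g_3})\circ\alpha_{g_1,g_2g_3}.$$ It is a $3$-cocycle whose class $\kappa_F\in H^3(G,A(X))$ does not depend on $\alpha$; this is the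 obstruction class. $\mathscr Y$ is induced from the invariants if there are a gerbe $\overline{\mathscr Y}$ banded by $A^G$ and an $i$-equivariant morphism $\overline{\mathscr Y}\to\mathscr Y$. *)

theory Defs
  imports "HOL-Algebra.Coset" "HOL-Algebra.FiniteProduct"
begin

section \<open>Group cohomology\<close>

text \<open>
  Inhomogeneous cochains of \<open>G\<close> with values in an abelian group \<open>M\<close>, on which \<open>G\<close> acts
  through \<open>\<psi>\<close>. Abelian groups are of type \<open>monoid\<close>, so the group law and the zero of the
  additive notation are \<open>\<otimes>\<close> and \<open>\<one>\<close> throughout. An \<open>n\<close>-tuple of group elements is
  a list of length \<open>n\<close>.
\<close>

definition tuples :: "('g, 'r) monoid_scheme \<Rightarrow> nat \<Rightarrow> 'g list set" where
  "tuples G n = {l. length l = n \<and> set l \<subseteq> carrier G}"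

definition cochains ::
  "('g, 'r) monoid_scheme \<Rightarrow> ('a, 's) monoid_scheme \<Rightarrow> nat \<Rightarrow> ('g list \<Rightarrow> 'a) monoid" where
  "cochains G M n =
     \<lparr> carrier = tuples G n \<rightarrow>\<^sub>E carrier M,
       mult = (\<lambda>c d. \<lambda>l\<in>tuples G n. c l \<otimes>\<^bsub>M\<^esub> d l),
       one = (\<lambda>l\<in>tuples G n. \<one>\<^bsub>M\<^esub>) \<rparr>"

text \<open>\<open>merge G i (g\<^sub>1, \<dots>, g\<^sub>n) = (g\<^sub>1, \<dots>, g\<^sub>i g\<^sub>i\<^sub>+\<^sub>1, \<dots>, g\<^sub>n)\<close>, where \<open>1 \<le> i < n\<close>; list positions
  are counted from 0.\<close>

definition merge :: "('g, 'r) monoid_scheme \<Rightarrow> nat \<Rightarrow> 'g list \<Rightarrow> 'g list" where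
  "merge G i l = take (i - 1) l @ [l ! (i - 1) \<otimes>\<^bsub>G\<^esub> l ! i] @ drop (i + 1) l"

definition coboundary ::
  "('g, 'r) monoid_scheme \<Rightarrow> ('a, 's) monoid_scheme \<Rightarrow> ('g \<Rightarrow> 'a \<Rightarrow> 'a) \<Rightarrow> nat
     \<Rightarrow> ('g list \<Rightarrow> 'a) \<Rightarrow> 'g list \<Rightarrow> 'a" where
  "coboundary G M \<psi> n c =
     (\<lambda>l\<in>tuples G (Suc n).
        \<psi> (hd l) (c (tl l))
        \<otimes>\<^bsub>M\<^esub> finprod M (\<lambda>i. c (merge G i l) [^]\<^bsub>M\<^esub> ((- 1 :: int) ^ i)) {1..n}
        \<otimes>\<^bsub>M\<^esub> c (butlast l) [^]\<^bsub>M\<^esub> ((- 1 :: int) ^ (n + 1)))"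

definition cocycles ::
  "('g, 'r) monoid_scheme \<Rightarrow> ('a, 's) monoid_scheme \<Rightarrow> ('g \<Rightarrow> 'a \<Rightarrow> 'a) \<Rightarrow> nat
     \<Rightarrow> ('g list \<Rightarrow> 'a) monoid" where
  "cocycles G M \<psi> n =
     (cochains G M n)
       \<lparr> carrier := {c \<in> carrier (cochains G M n).
                       coboundary G M \<psi> n c = \<one>\<^bsub>cochains G M (Suc n)\<^esub>} \<rparr>"

definition coboundaries ::
  "('g, 'r) monoid_scheme \<Rightarrow> ('a, 's) monoid_scheme \<Rightarrow> ('g \<Rightarrow> 'a \<Rightarrow> 'a) \<Rightarrow> nat
     \<Rightarrow> ('g list \<Rightarrow> 'a) set" where
  "coboundaries G M \<psi> n =
     (case n of 0 \<Rightarrow> {\<one>\<^bsub>cochains G M 0\<^esub>}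
      | Suc m \<Rightarrow> coboundary G M \<psi> m ` carrier (cochains G M m))"

definition cohomology ::
  "('g, 'r) monoid_scheme \<Rightarrow> ('a, 's) monoid_scheme \<Rightarrow> ('g \<Rightarrow> 'a \<Rightarrow> 'a) \<Rightarrow> nat
     \<Rightarrow> ('g list \<Rightarrow> 'a) set monoid" where
  "cohomology G M \<psi> n = cocycles G M \<psi> n Mod coboundaries G M \<psi> n"

definition cohomology_class ::
  "('g, 'r) monoid_scheme \<Rightarrow> ('a, 's) monoid_scheme \<Rightarrow> ('g \<Rightarrow> 'a \<Rightarrow> 'a) \<Rightarrow> nat
     \<Rightarrow> ('g list \<Rightarrow> 'a) \<Rightarrow> ('g list \<Rightarrow> 'a) set" where
  "cohomology_class G M \<psi> n c = coboundaries G M \<psi> n #>\<^bsub>cocycles G M \<psi> n\<^esub> c"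


section \<open>Categories and sites\<close>

record ('o, 'm) cat =
  Obj :: "'o set"
  Arr :: "'m set"
  Src :: "'m \<Rightarrow> 'o"
  Tgt :: "'m \<Rightarrow> 'o"
  Idn :: "'o \<Rightarrow> 'm"
  Cmp :: "'m \<Rightarrow> 'm \<Rightarrow> 'm"  (infixr "\<cdot>\<index>" 75)

definition Hom :: "('o, 'm, 'r) cat_scheme \<Rightarrow> 'o \<Rightarrow> 'o \<Rightarrow> 'm set" where
  "Hom C U V = {f \<in> Arr C. Src C f = U \<and> Tgt C f = V}"

locale category =
  fixes C :: "('o, 'm, 'r) cat_scheme" (structure)
  assumes src_obj: "f \<in> Arr C \<Longrightarrow> Src C f \<in> Obj C"
    and tgt_obj: "f \<in> Arr C \<Longrightarrow> Tgt C f \<in> Obj C"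
    and idn_hom: "U \<in> Obj C \<Longrightarrow> Idn C U \<in> Hom C U U"
    and cmp_hom: "\<lbrakk>f \<in> Hom C U V; g \<in> Hom C V W\<rbrakk> \<Longrightarrow> g \<cdot> f \<in> Hom C U W"
    and cmp_idn: "f \<in> Hom C U V \<Longrightarrow> f \<cdot> Idn C U = f"
    and idn_cmp: "f \<in> Hom C U V \<Longrightarrow> Idn C V \<cdot> f = f"
    and cmp_assoc: "\<lbrakk>f \<in> Hom C U V; g \<in> Hom C V W; h \<in> Hom C W Z\<rbrakk>
                      \<Longrightarrow> (h \<cdot> g) \<cdot> f = h \<cdot> (g \<cdot> f)"

definition is_iso :: "('o, 'm, 'r) cat_scheme \<Rightarrow> 'm \<Rightarrow> bool" where
  "is_iso C f \<longleftrightarrow> f \<in> Arr C \<and>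
     (\<exists>g \<in> Hom C (Tgt C f) (Src C f).
        g \<cdot>\<^bsub>C\<^esub> f = Idn C (Src C f) \<and> f \<cdot>\<^bsub>C\<^esub> g = Idn C (Tgt C f))"

definition final_object :: "('o, 'm, 'r) cat_scheme \<Rightarrow> 'o \<Rightarrow> bool" where
  "final_object C X \<longleftrightarrow> X \<in> Obj C \<and> (\<forall>U \<in> Obj C. \<exists>!f. f \<in> Hom C U X)"

definition to_final :: "('o, 'm, 'r) cat_scheme \<Rightarrow> 'o \<Rightarrow> 'o \<Rightarrow> 'm" where
  "to_final C X U = (THE f. f \<in> Hom C U X)"

record ('o, 'm) site = "('o, 'm) cat" +
  Cov :: "'o \<Rightarrow> 'm set set"

text \<open>
  A covering family of \<open>U\<close> is a set of arrows with target \<open>U\<close>. Existence of fibre products is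
  not required: stability under base change asks for a cover that refines the pulled back
  family. Both pretopologies given by fibre products and Grothendieck topologies given by
  covering sieves (with the families generating a covering sieve as covers) are instances.
\<close>

locale site = category C for C :: "('o, 'm, 'r) site_scheme" (structure) +
  assumes cov_arr: "\<lbrakk>U \<in> Obj C; R \<in> Cov C U; f \<in> R\<rbrakk> \<Longrightarrow> f \<in> Arr C \<and> Tgt C f = U"
    and cov_iso: "is_iso C f \<Longrightarrow> {f} \<in> Cov C (Tgt C f)"
    and cov_trans:
      "\<lbrakk>U \<in> Obj C; R \<in> Cov C U; \<And>f. f \<in> R \<Longrightarrow> T f \<in> Cov C (Src C f)\<rbrakk>
         \<Longrightarrow> {f \<cdot> h | f h. f \<in> R \<and> h \<in> T f} \<in> Cov C U"
    and cov_stable: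
      "\<lbrakk>R \<in> Cov C U; k \<in> Hom C V U\<rbrakk>
         \<Longrightarrow> \<exists>T \<in> Cov C V. \<forall>h \<in> T. \<exists>f \<in> R. \<exists>l \<in> Hom C (Src C h) (Src C f). k \<cdot> h = f \<cdot> l"

definition generated_sieve :: "('o, 'm, 'r) cat_scheme \<Rightarrow> 'm set \<Rightarrow> 'm set" where
  "generated_sieve C R = {f \<cdot>\<^bsub>C\<^esub> h | f h. f \<in> R \<and> h \<in> Arr C \<and> Tgt C h = Src C f}"


section \<open>Sheaves\<close>

record ('o, 'm, 'x) presheaf =
  Sec :: "'o \<Rightarrow> 'x set"
  Res :: "'m \<Rightarrow> 'x \<Rightarrow> 'x"

text \<open>
  A family of local sections matches if its members agree over every \<open>W\<close> that maps to two
  members of the cover compatibly (equivalently, over the fibre products where these exist).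
\<close>

locale sheaf =
  fixes C :: "('o, 'm, 'r) site_scheme" (structure) and F :: "('o, 'm, 'x, 's) presheaf_scheme"
  assumes res_closed: "\<lbrakk>f \<in> Hom C V U; x \<in> Sec F U\<rbrakk> \<Longrightarrow> Res F f x \<in> Sec F V"
    and res_idn: "\<lbrakk>U \<in> Obj C; x \<in> Sec F U\<rbrakk> \<Longrightarrow> Res F (Idn C U) x = x"
    and res_cmp: "\<lbrakk>f \<in> Hom C V U; h \<in> Hom C W V; x \<in> Sec F U\<rbrakk>
                    \<Longrightarrow> Res F (f \<cdot> h) x = Res F h (Res F f x)"
    and glue:
      "\<lbrakk>U \<in> Obj C; R \<in> Cov C U; \<And>f. f \<in> R \<Longrightarrow> s f \<in> Sec F (Src C f);
        \<And>f f' W p p'. \<lbrakk>f \<in> R; f' \<in> R; p \<in> Hom C W (Src C f); p' \<in> Hom C W (Src C f');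
                        f \<cdot> p = f' \<cdot> p'\<rbrakk> \<Longrightarrow> Res F p (s f) = Res F p' (s f')\<rbrakk>
         \<Longrightarrow> \<exists>!x. x \<in> Sec F U \<and> (\<forall>f \<in> R. Res F f x = s f)"

definition sheaf_morphism ::
  "('o, 'm, 'r) site_scheme \<Rightarrow> ('o, 'm, 'x, 's) presheaf_scheme
     \<Rightarrow> ('o, 'm, 'y, 't) presheaf_scheme \<Rightarrow> ('o \<Rightarrow> 'x \<Rightarrow> 'y) \<Rightarrow> bool" where
  "sheaf_morphism C F F' \<mu> \<longleftrightarrow>
     (\<forall>U \<in> Obj C. \<forall>x \<in> Sec F U. \<mu> U x \<in> Sec F' U) \<and>
     (\<forall>U \<in> Obj C. \<forall>V \<in> Obj C. \<forall>f \<in> Hom C V U. \<forall>x \<in> Sec F U.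
        \<mu> V (Res F f x) = Res F' f (\<mu> U x))"

record ('o, 'm, 'a) absheaf =
  Grp :: "'o \<Rightarrow> 'a monoid"
  ARes :: "'m \<Rightarrow> 'a \<Rightarrow> 'a"

definition underlying :: "('o, 'm, 'a) absheaf \<Rightarrow> ('o, 'm, 'a) presheaf" where
  "underlying A = \<lparr> Sec = (\<lambda>U. carrier (Grp A U)), Res = ARes A \<rparr>"

definition abelian_sheaf :: "('o, 'm, 'r) site_scheme \<Rightarrow> ('o, 'm, 'a) absheaf \<Rightarrow> bool" where
  "abelian_sheaf C A \<longleftrightarrow>
     (\<forall>U \<in> Obj C. comm_group (Grp A U)) \<and>
     (\<forall>U \<in> Obj C. \<forall>V \<in> Obj C. \<forall>f \<in> Hom C V U. ARes A f \<in> hom (Grp A U) (Grp A V)) \<and>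
     sheaf C (underlying A)"

definition absheaf_automorphism ::
  "('o, 'm, 'r) site_scheme \<Rightarrow> ('o, 'm, 'a) absheaf \<Rightarrow> ('o \<Rightarrow> 'a \<Rightarrow> 'a) \<Rightarrow> bool" where
  "absheaf_automorphism C A \<phi> \<longleftrightarrow>
     sheaf_morphism C (underlying A) (underlying A) \<phi> \<and>
     (\<forall>U \<in> Obj C. \<phi> U \<in> iso (Grp A U) (Grp A U))"

definition sheaf_action ::
  "('o, 'm, 'r) site_scheme \<Rightarrow> ('g, 's) monoid_scheme \<Rightarrow> ('o, 'm, 'a) absheaf
     \<Rightarrow> ('g \<Rightarrow> 'o \<Rightarrow> 'a \<Rightarrow> 'a) \<Rightarrow> bool" where
  "sheaf_action C G A \<phi> \<longleftrightarrow>
     (\<forall>g \<in> carrier G. absheaf_automorphism C A (\<phi> g)) \<and>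
     (\<forall>g \<in> carrier G. \<forall>h \<in> carrier G. \<forall>U \<in> Obj C. \<forall>a \<in> carrier (Grp A U).
        \<phi> (g \<otimes>\<^bsub>G\<^esub> h) U a = \<phi> g U (\<phi> h U a))"

definition invariants ::
  "('g, 's) monoid_scheme \<Rightarrow> ('o, 'm, 'a) absheaf \<Rightarrow> ('g \<Rightarrow> 'o \<Rightarrow> 'a \<Rightarrow> 'a)
     \<Rightarrow> ('o, 'm, 'a) absheaf" where
  "invariants G A \<phi> =
     \<lparr> Grp = (\<lambda>U. (Grp A U)
               \<lparr> carrier := {a \<in> carrier (Grp A U). \<forall>g \<in> carrier G. \<phi> g U a = a} \<rparr>),
       ARes = ARes A \<rparr>"

text \<open>Invariant sections of \<open>A\<close> over \<open>U\<close> form a subset, so the inclusion is the identity.\<close>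

definition incl :: "'o \<Rightarrow> 'a \<Rightarrow> 'a" where
  "incl U a = a"


section \<open>Torsors\<close>

record ('o, 'm, 'a, 'y) torsor = "('o, 'm, 'y) presheaf" +
  Act :: "'o \<Rightarrow> 'a \<Rightarrow> 'y \<Rightarrow> 'y"

locale torsor = sheaf C y
  for C :: "('o, 'm, 'r) site_scheme" (structure)
    and A :: "('o, 'm, 'a) absheaf"
    and y :: "('o, 'm, 'a, 'y, 's) torsor_scheme" +
  assumes act_closed: "\<lbrakk>U \<in> Obj C; a \<in> carrier (Grp A U); x \<in> Sec y U\<rbrakk> \<Longrightarrow> Act y U a x \<in> Sec y U"
    and act_one: "\<lbrakk>U \<in> Obj C; x \<in> Sec y U\<rbrakk> \<Longrightarrow> Act y U \<one>\<^bsub>Grp A U\<^esub> x = x"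
    and act_mult: "\<lbrakk>U \<in> Obj C; a \<in> carrier (Grp A U); b \<in> carrier (Grp A U); x \<in> Sec y U\<rbrakk>
                     \<Longrightarrow> Act y U (a \<otimes>\<^bsub>Grp A U\<^esub> b) x = Act y U a (Act y U b x)"
    and act_res: "\<lbrakk>f \<in> Hom C V U; a \<in> carrier (Grp A U); x \<in> Sec y U\<rbrakk>
                    \<Longrightarrow> Res y f (Act y U a x) = Act y V (ARes A f a) (Res y f x)"
    and simply_transitive:
      "\<lbrakk>U \<in> Obj C; x \<in> Sec y U; x' \<in> Sec y U\<rbrakk> \<Longrightarrow> \<exists>!a. a \<in> carrier (Grp A U) \<and> Act y U a x = x'"
    and locally_nonempty: "U \<in> Obj C \<Longrightarrow> \<exists>R \<in> Cov C U. \<forall>f \<in> R. Sec y (Src C f) \<noteq> {}"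

definition torsor_equivariant ::
  "('o, 'm, 'r) site_scheme \<Rightarrow> ('o, 'm, 'a) absheaf \<Rightarrow> ('o \<Rightarrow> 'a \<Rightarrow> 'b)
     \<Rightarrow> ('o, 'm, 'a, 'y, 's) torsor_scheme \<Rightarrow> ('o, 'm, 'b, 'z, 't) torsor_scheme
     \<Rightarrow> ('o \<Rightarrow> 'y \<Rightarrow> 'z) \<Rightarrow> bool" where
  "torsor_equivariant C A\<^sub>1 f y\<^sub>1 y\<^sub>2 \<mu> \<longleftrightarrow>
     sheaf_morphism C y\<^sub>1 y\<^sub>2 \<mu> \<and>
     (\<forall>U \<in> Obj C. \<forall>a \<in> carrier (Grp A\<^sub>1 U). \<forall>x \<in> Sec y\<^sub>1 U.
        \<mu> U (Act y\<^sub>1 U a x) = Act y\<^sub>2 U (f U a) (\<mu> U x))"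

definition torsor_automorphism ::
  "('o, 'm, 'r) site_scheme \<Rightarrow> ('o, 'm, 'a, 'y, 's) torsor_scheme \<Rightarrow> ('o \<Rightarrow> 'y \<Rightarrow> 'y) \<Rightarrow> bool" where
  "torsor_automorphism C y \<mu> \<longleftrightarrow>
     sheaf_morphism C y y \<mu> \<and> (\<forall>U \<in> Obj C. bij_betw (\<mu> U) (Sec y U) (Sec y U))"

definition torsor_lift ::
  "('o, 'm, 'r) site_scheme \<Rightarrow> ('g, 's) monoid_scheme \<Rightarrow> ('o, 'm, 'a) absheaf
     \<Rightarrow> ('g \<Rightarrow> 'o \<Rightarrow> 'a \<Rightarrow> 'a) \<Rightarrow> ('o, 'm, 'a, 'y, 't) torsor_scheme
     \<Rightarrow> ('g \<Rightarrow> 'o \<Rightarrow> 'y \<Rightarrow> 'y) \<Rightarrow> bool" where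
  "torsor_lift C G A \<phi> y lam \<longleftrightarrow> (\<forall>g \<in> carrier G. torsor_equivariant C A (\<phi> g) y y (lam g))"

text \<open>
  The cochain \<open>\<chi>\<close> with \<open>\<lambda>\<^sub>g \<circ> \<lambda>\<^sub>h = \<chi>(g,h) \<cdot> \<lambda>\<^sub>g\<^sub>h\<close>; a section over the final object \<open>X\<close> acts on
  sections over \<open>U\<close> through its restriction along \<open>U \<rightarrow> X\<close>.
\<close>

definition torsor_cochain ::
  "('o, 'm, 'r) site_scheme \<Rightarrow> 'o \<Rightarrow> ('g, 's) monoid_scheme \<Rightarrow> ('o, 'm, 'a) absheaf
     \<Rightarrow> ('o, 'm, 'a, 'y, 't) torsor_scheme \<Rightarrow> ('g \<Rightarrow> 'o \<Rightarrow> 'y \<Rightarrow> 'y) \<Rightarrow> 'g list \<Rightarrow> 'a" where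
  "torsor_cochain C X G A y lam =
     (\<lambda>l\<in>tuples G 2. THE a. a \<in> carrier (Grp A X) \<and>
        (\<forall>U \<in> Obj C. \<forall>x \<in> Sec y U.
           lam (l ! 0) U (lam (l ! 1) U x) =
           Act y U (ARes A (to_final C X U) a) (lam (l ! 0 \<otimes>\<^bsub>G\<^esub> l ! 1) U x)))"

definition torsor_induced_from_invariants ::
  "'z itself \<Rightarrow> ('o, 'm, 'r) site_scheme \<Rightarrow> ('g, 's) monoid_scheme \<Rightarrow> ('o, 'm, 'a) absheaf
     \<Rightarrow> ('g \<Rightarrow> 'o \<Rightarrow> 'a \<Rightarrow> 'a) \<Rightarrow> ('o, 'm, 'a, 'y, 't) torsor_scheme \<Rightarrow> bool" where
  "torsor_induced_from_invariants T C G A \<phi> y \<longleftrightarrow>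
     (\<exists>(ybar :: ('o, 'm, 'a, 'z) torsor) f.
        torsor C (invariants G A \<phi>) ybar \<and>
        torsor_equivariant C (invariants G A \<phi>) incl ybar y f)"


section \<open>Stacks in groupoids\<close>

record ('e, 't, 'o, 'm) fibred = "('e, 't) cat" +
  POb :: "'e \<Rightarrow> 'o"
  PAr :: "'t \<Rightarrow> 'm"

definition Hom_over :: "('e, 't, 'o, 'm, 'r) fibred_scheme \<Rightarrow> 'm \<Rightarrow> 'e \<Rightarrow> 'e \<Rightarrow> 't set" where
  "Hom_over Y f z x = {u \<in> Hom Y z x. PAr Y u = f}"

text \<open>
  Every arrow of the total category is required to be cartesian (\<open>proj_cartesian\<close>), which
  is what makes all fibres groupoids.
\<close>

locale fibred_in_groupoids = base: category C + total: category Y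
  for C :: "('o, 'm, 'r) site_scheme"
    and Y :: "('e, 't, 'o, 'm, 's) fibred_scheme" +
  assumes proj_obj: "x \<in> Obj Y \<Longrightarrow> POb Y x \<in> Obj C"
    and proj_arr: "u \<in> Hom Y z x \<Longrightarrow> PAr Y u \<in> Hom C (POb Y z) (POb Y x)"
    and proj_idn: "x \<in> Obj Y \<Longrightarrow> PAr Y (Idn Y x) = Idn C (POb Y x)"
    and proj_cmp: "\<lbrakk>v \<in> Hom Y w z; u \<in> Hom Y z x\<rbrakk>
                     \<Longrightarrow> PAr Y (u \<cdot>\<^bsub>Y\<^esub> v) = PAr Y u \<cdot>\<^bsub>C\<^esub> PAr Y v"
    and proj_lift: "\<lbrakk>x \<in> Obj Y; f \<in> Hom C V (POb Y x)\<rbrakk> \<Longrightarrow> \<exists>z u. u \<in> Hom_over Y f z x"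
    and proj_cartesian:
      "\<lbrakk>u \<in> Hom Y z x; v \<in> Hom Y w x; k \<in> Hom C (POb Y w) (POb Y z);
        PAr Y v = PAr Y u \<cdot>\<^bsub>C\<^esub> k\<rbrakk> \<Longrightarrow> \<exists>!l. l \<in> Hom_over Y k w z \<and> u \<cdot>\<^bsub>Y\<^esub> l = v"

text \<open>
  A descent datum relative to a sieve \<open>S\<close> on \<open>U\<close>, seen as a full subcategory of \<open>C/U\<close>, is a
  functor over \<open>C\<close> from \<open>S\<close> to \<open>Y\<close>: \<open>D h\<close> is its value at \<open>h \<in> S\<close>, and \<open>d h k\<close> its value at
  the arrow \<open>k : h \<cdot> k \<rightarrow> h\<close> of \<open>S\<close>.
\<close>

definition descent_datum ::
  "('o, 'm, 'r) site_scheme \<Rightarrow> ('e, 't, 'o, 'm, 's) fibred_scheme \<Rightarrow> 'm set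
     \<Rightarrow> ('m \<Rightarrow> 'e) \<Rightarrow> ('m \<Rightarrow> 'm \<Rightarrow> 't) \<Rightarrow> bool" where
  "descent_datum C Y S D d \<longleftrightarrow>
     (\<forall>h \<in> S. D h \<in> Obj Y \<and> POb Y (D h) = Src C h) \<and>
     (\<forall>h \<in> S. \<forall>k \<in> Arr C. Tgt C k = Src C h \<longrightarrow> d h k \<in> Hom_over Y k (D (h \<cdot>\<^bsub>C\<^esub> k)) (D h)) \<and>
     (\<forall>h \<in> S. d h (Idn C (Src C h)) = Idn Y (D h)) \<and>
     (\<forall>h \<in> S. \<forall>k \<in> Arr C. \<forall>l \<in> Arr C. Tgt C k = Src C h \<and> Tgt C l = Src C k \<longrightarrow>
        d h (k \<cdot>\<^bsub>C\<^esub> l) = d h k \<cdot>\<^bsub>Y\<^esub> d (h \<cdot>\<^bsub>C\<^esub> k) l)"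

text \<open>The object \<open>x\<close> over \<open>U\<close> restricts to the datum \<open>D\<close>, the arrow \<open>a h\<close> exhibiting \<open>D h\<close> as
  the pullback of \<open>x\<close> along \<open>h\<close>.\<close>

definition glues ::
  "('o, 'm, 'r) site_scheme \<Rightarrow> ('e, 't, 'o, 'm, 's) fibred_scheme \<Rightarrow> 'o \<Rightarrow> 'm set
     \<Rightarrow> ('m \<Rightarrow> 'e) \<Rightarrow> ('m \<Rightarrow> 'm \<Rightarrow> 't) \<Rightarrow> 'e \<Rightarrow> ('m \<Rightarrow> 't) \<Rightarrow> bool" where
  "glues C Y U S D d x a \<longleftrightarrow>
     x \<in> Obj Y \<and> POb Y x = U \<and>
     (\<forall>h \<in> S. a h \<in> Hom_over Y h (D h) x) \<and>
     (\<forall>h \<in> S. \<forall>k \<in> Arr C. Tgt C k = Src C h \<longrightarrow> a h \<cdot>\<^bsub>Y\<^esub> d h k = a (h \<cdot>\<^bsub>C\<^esub> k))"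

text \<open>
  For every covering sieve, restriction from the fibre over \<open>U\<close> to descent data is an
  equivalence: it is essentially surjective (\<open>effective\<close>), and fully faithful
  (\<open>glue_arrows\<close>, read with \<open>D\<close> a restriction of \<open>x\<close>, so that \<open>a'\<close> amounts to a
  morphism from the restriction of \<open>x\<close> to that of \<open>x'\<close>).
\<close>

locale stack_in_groupoids = fibred_in_groupoids C Y
  for C :: "('o, 'm, 'r) site_scheme"
    and Y :: "('e, 't, 'o, 'm, 's) fibred_scheme" +
  assumes effective:
      "\<lbrakk>U \<in> Obj C; R \<in> Cov C U; descent_datum C Y (generated_sieve C R) D d\<rbrakk>
         \<Longrightarrow> \<exists>x a. glues C Y U (generated_sieve C R) D d x a"
    and glue_arrows:
      "\<lbrakk>U \<in> Obj C; R \<in> Cov C U; descent_datum C Y (generated_sieve C R) D d;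
        glues C Y U (generated_sieve C R) D d x a; glues C Y U (generated_sieve C R) D d x' a'\<rbrakk>
         \<Longrightarrow> \<exists>!w. w \<in> Hom_over Y (Idn C U) x x' \<and>
                 (\<forall>h \<in> generated_sieve C R. w \<cdot>\<^bsub>Y\<^esub> a h = a' h)"


section \<open>Gerbes\<close>

definition Aut_group ::
  "('o, 'm, 'r) site_scheme \<Rightarrow> ('e, 't, 'o, 'm, 's) fibred_scheme \<Rightarrow> 'e \<Rightarrow> 't monoid" where
  "Aut_group C Y x =
     \<lparr> carrier = Hom_over Y (Idn C (POb Y x)) x x, mult = Cmp Y, one = Idn Y x \<rparr>"

locale abelian_gerbe = stack_in_groupoids C Y
  for C :: "('o, 'm, 'r) site_scheme"
    and Y :: "('e, 't, 'o, 'm, 's) fibred_scheme" +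
  assumes locally_nonempty:
      "U \<in> Obj C \<Longrightarrow> \<exists>R \<in> Cov C U. \<forall>f \<in> R. \<exists>x \<in> Obj Y. POb Y x = Src C f"
    and locally_isomorphic:
      "\<lbrakk>x \<in> Obj Y; x' \<in> Obj Y; POb Y x' = POb Y x\<rbrakk>
         \<Longrightarrow> \<exists>R \<in> Cov C (POb Y x). \<forall>f \<in> R. \<exists>z z'.
               Hom_over Y f z x \<noteq> {} \<and> Hom_over Y f z' x' \<noteq> {} \<and>
               (\<exists>w \<in> Hom_over Y (Idn C (Src C f)) z z'. is_iso Y w)"
    and aut_abelian: "x \<in> Obj Y \<Longrightarrow> comm_group (Aut_group C Y x)"

record ('e, 't, 'o, 'm, 'a) gerbe = "('e, 't, 'o, 'm) fibred" +
  Band :: "'e \<Rightarrow> 'a \<Rightarrow> 't"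

text \<open>
  The isomorphism of sheaves on \<open>C/U\<close> from \<open>A|\<^sub>U\<close> to \<open>Aut(x)\<close> is recorded by its values over
  \<open>U\<close>, for all \<open>x\<close>: its value at \<open>f : V \<rightarrow> U\<close> is that of the isomorphism for a pullback of \<open>x\<close>
  along \<open>f\<close>. As \<open>u\<close> ranges over all arrows, \<open>band_natural\<close> comprises the compatibility
  with restriction and with isomorphisms of objects.
\<close>

locale banded_gerbe = abelian_gerbe C Y
  for C :: "('o, 'm, 'r) site_scheme"
    and A :: "('o, 'm, 'a) absheaf"
    and Y :: "('e, 't, 'o, 'm, 'a, 's) gerbe_scheme" +
  assumes band_iso: "x \<in> Obj Y \<Longrightarrow> Band Y x \<in> iso (Grp A (POb Y x)) (Aut_group C Y x)"
    and band_natural: "\<lbrakk>u \<in> Hom Y z x; a \<in> carrier (Grp A (POb Y x))\<rbrakk>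
                         \<Longrightarrow> u \<cdot>\<^bsub>Y\<^esub> Band Y z (ARes A (PAr Y u) a) = Band Y x a \<cdot>\<^bsub>Y\<^esub> u"

record ('e, 't, 'e2, 't2) fctr =
  FOb :: "'e \<Rightarrow> 'e2"
  FAr :: "'t \<Rightarrow> 't2"

text \<open>Preservation of cartesian arrows is automatic, since all arrows are cartesian.\<close>

definition gerbe_morphism ::
  "('e, 't, 'o, 'm, 'r) fibred_scheme \<Rightarrow> ('e2, 't2, 'o, 'm, 's) fibred_scheme
     \<Rightarrow> ('e, 't, 'e2, 't2) fctr \<Rightarrow> bool" where
  "gerbe_morphism Y\<^sub>1 Y\<^sub>2 F \<longleftrightarrow>
     (\<forall>x \<in> Obj Y\<^sub>1. FOb F x \<in> Obj Y\<^sub>2 \<and> POb Y\<^sub>2 (FOb F x) = POb Y\<^sub>1 x) \<and>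
     (\<forall>z x. \<forall>u \<in> Hom Y\<^sub>1 z x. FAr F u \<in> Hom_over Y\<^sub>2 (PAr Y\<^sub>1 u) (FOb F z) (FOb F x)) \<and>
     (\<forall>x \<in> Obj Y\<^sub>1. FAr F (Idn Y\<^sub>1 x) = Idn Y\<^sub>2 (FOb F x)) \<and>
     (\<forall>w z x. \<forall>v \<in> Hom Y\<^sub>1 w z. \<forall>u \<in> Hom Y\<^sub>1 z x.
        FAr F (u \<cdot>\<^bsub>Y\<^sub>1\<^esub> v) = FAr F u \<cdot>\<^bsub>Y\<^sub>2\<^esub> FAr F v)"

definition fctr_id :: "('e, 't, 'e, 't) fctr" where
  "fctr_id = \<lparr> FOb = (\<lambda>x. x), FAr = (\<lambda>u. u) \<rparr>"

definition fctr_comp ::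
  "('e2, 't2, 'e3, 't3) fctr \<Rightarrow> ('e, 't, 'e2, 't2) fctr \<Rightarrow> ('e, 't, 'e3, 't3) fctr"
  (infixr "\<circ>\<^sub>F" 75) where
  "F' \<circ>\<^sub>F F = \<lparr> FOb = FOb F' \<circ> FOb F, FAr = FAr F' \<circ> FAr F \<rparr>"

definition gerbe_equivariant ::
  "('o, 'm, 'a) absheaf \<Rightarrow> ('o \<Rightarrow> 'a \<Rightarrow> 'b) \<Rightarrow> ('e, 't, 'o, 'm, 'a, 'r) gerbe_scheme
     \<Rightarrow> ('e2, 't2, 'o, 'm, 'b, 's) gerbe_scheme \<Rightarrow> ('e, 't, 'e2, 't2) fctr \<Rightarrow> bool" where
  "gerbe_equivariant A\<^sub>1 f Y\<^sub>1 Y\<^sub>2 F \<longleftrightarrow>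
     gerbe_morphism Y\<^sub>1 Y\<^sub>2 F \<and>
     (\<forall>x \<in> Obj Y\<^sub>1. \<forall>a \<in> carrier (Grp A\<^sub>1 (POb Y\<^sub>1 x)).
        FAr F (Band Y\<^sub>1 x a) = Band Y\<^sub>2 (FOb F x) (f (POb Y\<^sub>1 x) a))"

definition two_morphism ::
  "('o, 'm, 'q) site_scheme \<Rightarrow> ('e, 't, 'o, 'm, 'r) fibred_scheme
     \<Rightarrow> ('e2, 't2, 'o, 'm, 's) fibred_scheme \<Rightarrow> ('e, 't, 'e2, 't2) fctr
     \<Rightarrow> ('e, 't, 'e2, 't2) fctr \<Rightarrow> ('e \<Rightarrow> 't2) \<Rightarrow> bool" where
  "two_morphism C Y\<^sub>1 Y\<^sub>2 F F' \<eta> \<longleftrightarrow>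
     (\<forall>x \<in> Obj Y\<^sub>1. \<eta> x \<in> Hom_over Y\<^sub>2 (Idn C (POb Y\<^sub>1 x)) (FOb F x) (FOb F' x)) \<and>
     (\<forall>z x. \<forall>u \<in> Hom Y\<^sub>1 z x. \<eta> x \<cdot>\<^bsub>Y\<^sub>2\<^esub> FAr F u = FAr F' u \<cdot>\<^bsub>Y\<^sub>2\<^esub> \<eta> z)"

definition two_isomorphic ::
  "('o, 'm, 'q) site_scheme \<Rightarrow> ('e, 't, 'o, 'm, 'r) fibred_scheme
     \<Rightarrow> ('e2, 't2, 'o, 'm, 's) fibred_scheme \<Rightarrow> ('e, 't, 'e2, 't2) fctr
     \<Rightarrow> ('e, 't, 'e2, 't2) fctr \<Rightarrow> bool" where
  "two_isomorphic C Y\<^sub>1 Y\<^sub>2 F F' \<longleftrightarrow>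
     (\<exists>\<eta>. two_morphism C Y\<^sub>1 Y\<^sub>2 F F' \<eta> \<and> (\<forall>x \<in> Obj Y\<^sub>1. is_iso Y\<^sub>2 (\<eta> x)))"

definition gerbe_automorphism ::
  "('o, 'm, 'r) site_scheme \<Rightarrow> ('e, 't, 'o, 'm, 's) fibred_scheme \<Rightarrow> ('e, 't, 'e, 't) fctr
     \<Rightarrow> bool" where
  "gerbe_automorphism C Y F \<longleftrightarrow>
     gerbe_morphism Y Y F \<and>
     (\<exists>F'. gerbe_morphism Y Y F' \<and>
           two_isomorphic C Y Y (F \<circ>\<^sub>F F') fctr_id \<and> two_isomorphic C Y Y (F' \<circ>\<^sub>F F) fctr_id)"

definition gerbe_action ::
  "('o, 'm, 'r) site_scheme \<Rightarrow> ('g, 's) monoid_scheme \<Rightarrow> ('o, 'm, 'a) absheaf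
     \<Rightarrow> ('e, 't, 'o, 'm, 'a, 'q) gerbe_scheme \<Rightarrow> ('g \<Rightarrow> ('e, 't, 'e, 't) fctr) \<Rightarrow> bool" where
  "gerbe_action C G A Y F \<longleftrightarrow>
     (\<forall>g \<in> carrier G. gerbe_morphism Y Y (F g)) \<and>
     gerbe_equivariant A (\<lambda>U a. a) Y Y (F \<one>\<^bsub>G\<^esub>) \<and>
     (\<forall>g \<in> carrier G. \<forall>h \<in> carrier G. two_isomorphic C Y Y (F (g \<otimes>\<^bsub>G\<^esub> h)) (F g \<circ>\<^sub>F F h))"

definition gerbe_lift ::
  "('o, 'm, 'r) site_scheme \<Rightarrow> ('g, 's) monoid_scheme \<Rightarrow> ('o, 'm, 'a) absheaf
     \<Rightarrow> ('g \<Rightarrow> 'o \<Rightarrow> 'a \<Rightarrow> 'a) \<Rightarrow> ('e, 't, 'o, 'm, 'a, 'q) gerbe_scheme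
     \<Rightarrow> ('g \<Rightarrow> ('e, 't, 'e, 't) fctr) \<Rightarrow> bool" where
  "gerbe_lift C G A \<phi> Y F \<longleftrightarrow>
     gerbe_action C G A Y F \<and> (\<forall>g \<in> carrier G. gerbe_equivariant A (\<phi> g) Y Y (F g))"

definition connecting_morphisms ::
  "('o, 'm, 'r) site_scheme \<Rightarrow> ('g, 's) monoid_scheme \<Rightarrow> ('e, 't, 'o, 'm, 'q) fibred_scheme
     \<Rightarrow> ('g \<Rightarrow> ('e, 't, 'e, 't) fctr) \<Rightarrow> ('g \<Rightarrow> 'g \<Rightarrow> 'e \<Rightarrow> 't) \<Rightarrow> bool" where
  "connecting_morphisms C G Y F \<alpha> \<longleftrightarrow>
     (\<forall>g \<in> carrier G. \<forall>h \<in> carrier G.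
        two_morphism C Y Y (F (g \<otimes>\<^bsub>G\<^esub> h)) (F g \<circ>\<^sub>F F h) (\<alpha> g h))"

text \<open>Vertical composition and the two whiskerings \<open>\<eta> \<star> id\<^sub>F\<close> and \<open>id\<^sub>F \<star> \<eta>\<close> of 2-morphisms.\<close>

definition vcomp ::
  "('e, 't, 'r) cat_scheme \<Rightarrow> ('x \<Rightarrow> 't) \<Rightarrow> ('x \<Rightarrow> 't) \<Rightarrow> 'x \<Rightarrow> 't" where
  "vcomp Y \<eta> \<zeta> x = \<eta> x \<cdot>\<^bsub>Y\<^esub> \<zeta> x"

definition whisker_right :: "('e2 \<Rightarrow> 't3) \<Rightarrow> ('e, 't, 'e2, 't2) fctr \<Rightarrow> 'e \<Rightarrow> 't3" where
  "whisker_right \<eta> F x = \<eta> (FOb F x)"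

definition whisker_left :: "('e2, 't2, 'e3, 't3) fctr \<Rightarrow> ('e \<Rightarrow> 't2) \<Rightarrow> 'e \<Rightarrow> 't3" where
  "whisker_left F \<eta> x = FAr F (\<eta> x)"

text \<open>The 2-automorphism of \<open>F\<close> given by the section \<open>a\<close> over the final object \<open>X\<close>.\<close>

definition section_two_aut ::
  "('o, 'm, 'q) site_scheme \<Rightarrow> 'o \<Rightarrow> ('o, 'm, 'a) absheaf
     \<Rightarrow> ('e2, 't2, 'o, 'm, 'a, 's) gerbe_scheme \<Rightarrow> ('e, 't, 'e2, 't2) fctr \<Rightarrow> 'a \<Rightarrow> 'e \<Rightarrow> 't2" where
  "section_two_aut C X A Y F a x =
     Band Y (FOb F x) (ARes A (to_final C X (POb Y (FOb F x))) a)"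

definition gerbe_cochain ::
  "('o, 'm, 'r) site_scheme \<Rightarrow> 'o \<Rightarrow> ('g, 's) monoid_scheme \<Rightarrow> ('o, 'm, 'a) absheaf
     \<Rightarrow> ('e, 't, 'o, 'm, 'a, 'q) gerbe_scheme \<Rightarrow> ('g \<Rightarrow> ('e, 't, 'e, 't) fctr)
     \<Rightarrow> ('g \<Rightarrow> 'g \<Rightarrow> 'e \<Rightarrow> 't) \<Rightarrow> 'g list \<Rightarrow> 'a" where
  "gerbe_cochain C X G A Y F \<alpha> =
     (\<lambda>l\<in>tuples G 3.
        let g\<^sub>1 = l ! 0; g\<^sub>2 = l ! 1; g\<^sub>3 = l ! 2 in
        THE a. a \<in> carrier (Grp A X) \<and>
          (\<forall>x \<in> Obj Y.
             vcomp Y (whisker_right (\<alpha> g\<^sub>1 g\<^sub>2) (F g\<^sub>3))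
               (vcomp Y (\<alpha> (g\<^sub>1 \<otimes>\<^bsub>G\<^esub> g\<^sub>2) g\<^sub>3)
                 (section_two_aut C X A Y (F (g\<^sub>1 \<otimes>\<^bsub>G\<^esub> g\<^sub>2 \<otimes>\<^bsub>G\<^esub> g\<^sub>3)) a)) x =
             vcomp Y (whisker_left (F g\<^sub>1) (\<alpha> g\<^sub>2 g\<^sub>3)) (\<alpha> g\<^sub>1 (g\<^sub>2 \<otimes>\<^bsub>G\<^esub> g\<^sub>3)) x))"

definition gerbe_induced_from_invariants ::
  "'e2 itself \<Rightarrow> 't2 itself \<Rightarrow> ('o, 'm, 'r) site_scheme \<Rightarrow> ('g, 's) monoid_scheme
     \<Rightarrow> ('o, 'm, 'a) absheaf \<Rightarrow> ('g \<Rightarrow> 'o \<Rightarrow> 'a \<Rightarrow> 'a) \<Rightarrow> ('e, 't, 'o, 'm, 'a, 'q) gerbe_scheme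
     \<Rightarrow> bool" where
  "gerbe_induced_from_invariants T\<^sub>1 T\<^sub>2 C G A \<phi> Y \<longleftrightarrow>
     (\<exists>(Ybar :: ('e2, 't2, 'o, 'm, 'a) gerbe) \<Theta>.
        banded_gerbe C (invariants G A \<phi>) Ybar \<and>
        gerbe_equivariant (invariants G A \<phi>) incl Ybar Y \<Theta>)"


section \<open>Vanishing obstruction classes and compatible lifts\<close>

text \<open>The coefficient module is \<open>A(X)\<close> with the given action of \<open>G\<close> on sections over \<open>X\<close>.\<close>

definition zero_class ::
  "'o \<Rightarrow> ('g, 's) monoid_scheme \<Rightarrow> ('o, 'm, 'a) absheaf \<Rightarrow> ('g \<Rightarrow> 'o \<Rightarrow> 'a \<Rightarrow> 'a) \<Rightarrow> nat
     \<Rightarrow> ('g list \<Rightarrow> 'a) \<Rightarrow> bool" where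
  "zero_class X G A \<phi> n c \<longleftrightarrow>
     c \<in> carrier (cocycles G (Grp A X) (\<lambda>g. \<phi> g X) n) \<and>
     cohomology_class G (Grp A X) (\<lambda>g. \<phi> g X) n c = \<one>\<^bsub>cohomology G (Grp A X) (\<lambda>g. \<phi> g X) n\<^esub>"

definition torsor_obstruction_zero ::
  "('o, 'm, 'r) site_scheme \<Rightarrow> 'o \<Rightarrow> ('g, 's) monoid_scheme \<Rightarrow> ('o, 'm, 'a) absheaf
     \<Rightarrow> ('g \<Rightarrow> 'o \<Rightarrow> 'a \<Rightarrow> 'a) \<Rightarrow> ('o, 'm, 'a, 'y, 't) torsor_scheme
     \<Rightarrow> ('g \<Rightarrow> 'o \<Rightarrow> 'y \<Rightarrow> 'y) \<Rightarrow> bool" where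
  "torsor_obstruction_zero C X G A \<phi> y lam \<longleftrightarrow> zero_class X G A \<phi> 2 (torsor_cochain C X G A y lam)"

text \<open>
  The class of the cochain does not depend on \<open>\<alpha>\<close>, so we require it to vanish for every choice
  of \<open>\<alpha>\<close>. A choice exists for every action of \<open>G\<close> on \<open>Y\<close>.
\<close>

definition gerbe_obstruction_zero ::
  "('o, 'm, 'r) site_scheme \<Rightarrow> 'o \<Rightarrow> ('g, 's) monoid_scheme \<Rightarrow> ('o, 'm, 'a) absheaf
     \<Rightarrow> ('g \<Rightarrow> 'o \<Rightarrow> 'a \<Rightarrow> 'a) \<Rightarrow> ('e, 't, 'o, 'm, 'a, 'q) gerbe_scheme
     \<Rightarrow> ('g \<Rightarrow> ('e, 't, 'e, 't) fctr) \<Rightarrow> bool" where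
  "gerbe_obstruction_zero C X G A \<phi> Y F \<longleftrightarrow>
     (\<forall>\<alpha>. connecting_morphisms C G Y F \<alpha> \<longrightarrow> zero_class X G A \<phi> 3 (gerbe_cochain C X G A Y F \<alpha>))"

definition compatible_torsor_lift ::
  "('o, 'm, 'r) site_scheme \<Rightarrow> ('g, 's) monoid_scheme \<Rightarrow> ('o, 'm, 'a) absheaf
     \<Rightarrow> ('g \<Rightarrow> 'o \<Rightarrow> 'a \<Rightarrow> 'a) \<Rightarrow> ('o, 'm, 'a, 'z, 'q) torsor_scheme
     \<Rightarrow> ('o, 'm, 'a, 'y, 't) torsor_scheme \<Rightarrow> ('o \<Rightarrow> 'z \<Rightarrow> 'y) \<Rightarrow> ('g \<Rightarrow> 'o \<Rightarrow> 'y \<Rightarrow> 'y) \<Rightarrow> bool" where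
  "compatible_torsor_lift C G A \<phi> ybar y f lam \<longleftrightarrow>
     (\<forall>g \<in> carrier G. torsor_automorphism C y (lam g)) \<and>
     torsor_lift C G A \<phi> y lam \<and>
     (\<forall>g \<in> carrier G. \<forall>U \<in> Obj C. \<forall>x \<in> Sec ybar U. lam g U (f U x) = f U x)"

definition compatible_gerbe_lift ::
  "('o, 'm, 'r) site_scheme \<Rightarrow> ('g, 's) monoid_scheme \<Rightarrow> ('o, 'm, 'a) absheaf
     \<Rightarrow> ('g \<Rightarrow> 'o \<Rightarrow> 'a \<Rightarrow> 'a) \<Rightarrow> ('e2, 't2, 'o, 'm, 'a, 'p) gerbe_scheme
     \<Rightarrow> ('e, 't, 'o, 'm, 'a, 'q) gerbe_scheme \<Rightarrow> ('e2, 't2, 'e, 't) fctr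
     \<Rightarrow> ('g \<Rightarrow> ('e, 't, 'e, 't) fctr) \<Rightarrow> bool" where
  "compatible_gerbe_lift C G A \<phi> Ybar Y \<Theta> F \<longleftrightarrow>
     (\<forall>g \<in> carrier G. gerbe_automorphism C Y (F g)) \<and>
     gerbe_lift C G A \<phi> Y F \<and>
     (\<forall>g \<in> carrier G. two_isomorphic C Ybar Y (F g \<circ>\<^sub>F \<Theta>) \<Theta>)"

end

theory Submission
  imports Defs
begin

text \<open>
  Sections of a torsor, and objects and arrows of a gerbe, come locally from the given data over
  \<open>A\<^sup>G\<close>. In the torsor case a local section is \<open>a f(t)\<close>, and compatibility with \<open>f\<close> forces
  \<open>\<lambda>\<^sub>g(a f(t)) = \<phi>\<^sub>g(a) f(t)\<close>; this is independent of \<open>t\<close> because two choices of \<open>t\<close> differ by an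
  invariant section. In the gerbe case an arrow \<open>\<Theta> z \<rightarrow> \<Theta> z'\<close> is locally \<open>\<Theta> v\<close> composed with a
  section \<open>c\<close> of \<open>A\<close>; replacing \<open>c\<close> by \<open>\<phi>\<^sub>g(c)\<close> twists the arrow by \<open>g\<close>. Twisting the descent datum
  that presents an object \<open>x\<close> through the \<open>\<Theta> z\<close> yields the datum that glues to \<open>F\<^sub>g x\<close>.

  Let \<open>\<eta>\<^sub>g\<close> be 2-isomorphisms from \<open>F\<^sub>g \<circ> \<Theta>\<close> to \<open>\<Theta>\<close>. Comparing \<open>\<eta>\<^sub>g \<circ> F\<^sub>g(\<eta>\<^sub>h) \<circ> \<alpha>\<^sub>g\<^sub>,\<^sub>h\<close> with
  \<open>\<eta>\<^sub>g\<^sub>h\<close> gives a 2-automorphism of \<open>\<Theta>\<close>, that is a section \<open>b(g,h)\<close> in \<open>A(X)\<close>, and the cochain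
  \<open>\<kappa>\<close> is the coboundary of \<open>b\<close>.
\<close>

section \<open>Categories fibred in groupoids\<close>

text \<open>Two features shape the proof. Fibre products need not exist, so agreement of local data
  is tested on pairs of arrows with equal composites, after refining covers with
  \<open>cov_stable\<close>. And an object of \<open>Y\<close> is only locally isomorphic to some
  \<open>\<Theta> z\<close>, with no canonical choice, so that \<open>F\<^sub>g x\<close> is merely
  a chosen gluing. The choices become coherent because each gluing is remembered together with its
  effect on all arrows from objects \<open>\<Theta> z\<close> into \<open>x\<close>. This effect
  determines arrows out of \<open>F\<^sub>g x\<close>, which gives functoriality, equivariance and
  uniqueness up to 2-isomorphism. Uniqueness in turn gives the group law, since the composite of
  \<open>F\<^sub>g\<close> and \<open>F\<^sub>h\<close> meets the conditions imposed on the functor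
  of the product. For torsors the same argument gives an equality, so the cochain itself is trivial;
  for gerbes the connecting 2-morphisms remain arbitrary, and only the class vanishes.\<close>

context category
begin

lemma arr_cmp [simp]: "\<lbrakk>f \<in> Arr C; g \<in> Arr C; Tgt C f = Src C g\<rbrakk> \<Longrightarrow> g \<cdot> f \<in> Arr C"
  and src_cmp [simp]: "\<lbrakk>f \<in> Arr C; g \<in> Arr C; Tgt C f = Src C g\<rbrakk> \<Longrightarrow> Src C (g \<cdot> f) = Src C f"
  and tgt_cmp [simp]: "\<lbrakk>f \<in> Arr C; g \<in> Arr C; Tgt C f = Src C g\<rbrakk> \<Longrightarrow> Tgt C (g \<cdot> f) = Tgt C g"
  using cmp_hom[of f "Src C f" "Tgt C f" g "Tgt C g"] by (auto simp: Hom_def)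

lemma assoc [simp]:
  "\<lbrakk>f \<in> Arr C; g \<in> Arr C; h \<in> Arr C; Tgt C f = Src C g; Tgt C g = Src C h\<rbrakk>
     \<Longrightarrow> (h \<cdot> g) \<cdot> f = h \<cdot> (g \<cdot> f)"
  using cmp_assoc[of f "Src C f" "Tgt C f" g "Tgt C g" h "Tgt C h"] by (auto simp: Hom_def)

text \<open>Composites are normalized to the right, so an equation between two-fold composites no
  longer matches inside a longer chain. Instances of this rule restore the rewriting.\<close>

lemma reassoc:
  "\<lbrakk>h \<cdot> g = k; f \<in> Arr C; g \<in> Arr C; h \<in> Arr C; Tgt C f = Src C g; Tgt C g = Src C h\<rbrakk>
     \<Longrightarrow> h \<cdot> (g \<cdot> f) = k \<cdot> f"
  using assoc[of f g h] by simp

lemma idn_arr [simp]: "U \<in> Obj C \<Longrightarrow> Idn C U \<in> Arr C"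
  and src_idn [simp]: "U \<in> Obj C \<Longrightarrow> Src C (Idn C U) = U"
  and tgt_idn [simp]: "U \<in> Obj C \<Longrightarrow> Tgt C (Idn C U) = U"
  using idn_hom[of U] by (auto simp: Hom_def)

lemma idn_right [simp]: "\<lbrakk>f \<in> Arr C; Src C f = U\<rbrakk> \<Longrightarrow> f \<cdot> Idn C U = f"
  and idn_left [simp]: "\<lbrakk>f \<in> Arr C; Tgt C f = U\<rbrakk> \<Longrightarrow> Idn C U \<cdot> f = f"
  using cmp_idn[of f "Src C f" "Tgt C f"] idn_cmp[of f "Src C f" "Tgt C f"]
  by (auto simp: Hom_def)

lemmas [simp] = src_obj tgt_obj

end

section \<open>Factorization and cancellation of cartesian arrows\<close>

context fibred_in_groupoids
begin

lemma par_arr [simp]: "u \<in> Arr Y \<Longrightarrow> PAr Y u \<in> Arr C"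
  and src_par [simp]: "u \<in> Arr Y \<Longrightarrow> Src C (PAr Y u) = POb Y (Src Y u)"
  and tgt_par [simp]: "u \<in> Arr Y \<Longrightarrow> Tgt C (PAr Y u) = POb Y (Tgt Y u)"
  using proj_arr[of u "Src Y u" "Tgt Y u"] by (auto simp: Hom_def)

lemma par_cmp [simp]:
  "\<lbrakk>v \<in> Arr Y; u \<in> Arr Y; Tgt Y v = Src Y u\<rbrakk> \<Longrightarrow> PAr Y (u \<cdot>\<^bsub>Y\<^esub> v) = PAr Y u \<cdot>\<^bsub>C\<^esub> PAr Y v"
  using proj_cmp[of v "Src Y v" "Tgt Y v" u "Tgt Y u"] by (auto simp: Hom_def)

lemmas [simp] = proj_obj proj_idn

lemma pullback:
  assumes "x \<in> Obj Y" "f \<in> Arr C" "Tgt C f = POb Y x"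
  obtains u where "u \<in> Arr Y" "Tgt Y u = x" "PAr Y u = f" "POb Y (Src Y u) = Src C f"
proof -
  from proj_lift[of x f "Src C f"] assms obtain z u where "u \<in> Hom_over Y f z x"
    by (auto simp: Hom_def)
  then show thesis
    using that[of u] src_par[of u] by (auto simp: Hom_over_def Hom_def)
qed

lemma factor:
  assumes "u \<in> Arr Y" "v \<in> Arr Y" "Tgt Y u = Tgt Y v" "k \<in> Arr C"
    "Src C k = POb Y (Src Y v)" "Tgt C k = POb Y (Src Y u)" "PAr Y v = PAr Y u \<cdot>\<^bsub>C\<^esub> k"
  obtains l where "l \<in> Arr Y" "Src Y l = Src Y v" "Tgt Y l = Src Y u" "PAr Y l = k" "u \<cdot>\<^bsub>Y\<^esub> l = v"
  using proj_cartesian[of u "Src Y u" "Tgt Y u" v "Src Y v" k] assms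
  by (auto simp: Hom_over_def Hom_def)

text \<open>An arrow of \<open>Y\<close> need not be monic. Equality of the projections makes
  \<open>l\<close> and \<open>l'\<close> two factorizations of one arrow through the cartesian arrow
  \<open>u\<close> over the same base arrow.\<close>

lemma cancel:
  assumes "u \<cdot>\<^bsub>Y\<^esub> l = u \<cdot>\<^bsub>Y\<^esub> l'" "u \<in> Arr Y" "l \<in> Arr Y" "l' \<in> Arr Y" "Src Y l = Src Y l'"
    "Tgt Y l = Src Y u" "Tgt Y l' = Src Y u" "PAr Y l = PAr Y l'"
  shows "l = l'"
proof -
  have "\<exists>!k. k \<in> Hom_over Y (PAr Y l) (Src Y l) (Src Y u) \<and> u \<cdot>\<^bsub>Y\<^esub> k = u \<cdot>\<^bsub>Y\<^esub> l"
    using proj_cartesian[of u "Src Y u" "Tgt Y u" "u \<cdot>\<^bsub>Y\<^esub> l" "Src Y l" "PAr Y l"] assms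
    by (auto simp: Hom_def)
  then show ?thesis
    using assms by (auto simp: Hom_over_def Hom_def)
qed

text \<open>The inverse arises by factoring the identity through the cartesian arrow
  \<open>w\<close>; cancelling \<open>w\<close> shows that it is a left inverse too.\<close>

lemma vertical_inverse:
  assumes "w \<in> Arr Y" "PAr Y w = Idn C (POb Y (Src Y w))"
  obtains w' where "w' \<in> Arr Y" "Src Y w' = Tgt Y w" "Tgt Y w' = Src Y w"
    "PAr Y w' = PAr Y w" "POb Y (Tgt Y w) = POb Y (Src Y w)"
    "w \<cdot>\<^bsub>Y\<^esub> w' = Idn Y (Tgt Y w)" "w' \<cdot>\<^bsub>Y\<^esub> w = Idn Y (Src Y w)"
proof -
  have eq: "POb Y (Tgt Y w) = POb Y (Src Y w)"
    using tgt_par[of w] assms by auto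
  obtain w' where w': "w' \<in> Arr Y" "Src Y w' = Tgt Y w" "Tgt Y w' = Src Y w"
      "PAr Y w' = PAr Y w" "w \<cdot>\<^bsub>Y\<^esub> w' = Idn Y (Tgt Y w)"
    using factor[of w "Idn Y (Tgt Y w)" "PAr Y w"] assms eq by auto
  have "w \<cdot>\<^bsub>Y\<^esub> (w' \<cdot>\<^bsub>Y\<^esub> w) = (w \<cdot>\<^bsub>Y\<^esub> w') \<cdot>\<^bsub>Y\<^esub> w"
    by (rule total.assoc[symmetric]) (use w' assms in auto)
  then have "w' \<cdot>\<^bsub>Y\<^esub> w = Idn Y (Src Y w)"
    using w' assms eq by - (rule cancel[of w]; auto)
  with w' eq show thesis
    using that by blast
qed

lemma vertical_is_iso:
  assumes "w \<in> Arr Y" "PAr Y w = Idn C (POb Y (Src Y w))"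
  shows "is_iso Y w"
  by (rule vertical_inverse[OF assms]) (use assms in \<open>auto simp: is_iso_def Hom_def\<close>)

text \<open>In contrast to \<open>cancel\<close>, nothing is asked of the projections of
  \<open>u\<close> and \<open>v\<close>, because \<open>w\<close> is invertible.\<close>

lemma vertical_monic:
  assumes "w \<cdot>\<^bsub>Y\<^esub> u = w \<cdot>\<^bsub>Y\<^esub> v" "PAr Y w = Idn C (POb Y (Src Y w))" "w \<in> Arr Y" "u \<in> Arr Y" "v \<in> Arr Y"
    "Tgt Y u = Src Y w" "Tgt Y v = Src Y w"
  shows "u = v"
proof -
  obtain w' where "w' \<in> Arr Y" "Src Y w' = Tgt Y w" "Tgt Y w' = Src Y w"
    and i: "w' \<cdot>\<^bsub>Y\<^esub> w = Idn Y (Src Y w)"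
    using vertical_inverse[of w] assms by metis
  moreover have "w' \<cdot>\<^bsub>Y\<^esub> (w \<cdot>\<^bsub>Y\<^esub> u) = w' \<cdot>\<^bsub>Y\<^esub> (w \<cdot>\<^bsub>Y\<^esub> v)"
    using assms by simp
  ultimately show ?thesis
    using assms(2-) by (simp add: total.reassoc[OF i])
qed

end

context site
begin

lemma sieve_arr:
  assumes "U \<in> Obj C" "R \<in> Cov C U" "h \<in> generated_sieve C R"
  shows "h \<in> Arr C \<and> Tgt C h = U"
  using assms cov_arr[OF assms(1,2)] by (auto simp: generated_sieve_def)

lemma sieve_cmp:
  assumes U: "U \<in> Obj C" and R: "R \<in> Cov C U" and h: "h \<in> generated_sieve C R"
    and k: "k \<in> Arr C" "Tgt C k = Src C h"
  shows "h \<cdot> k \<in> generated_sieve C R"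
proof -
  obtain f l where "f \<in> R" "l \<in> Arr C" "Tgt C l = Src C f" "h = f \<cdot> l"
    using h by (auto simp: generated_sieve_def)
  then show ?thesis
    using k cov_arr[OF U R] unfolding generated_sieve_def
    by (intro CollectI exI[of _ f] exI[of _ "l \<cdot> k"]) auto
qed

end

section \<open>Determining and gluing arrows of a stack on a cover\<close>

locale stack_on_site = site C + stack_in_groupoids C Y
  for C :: "('o, 'm, 'r) site_scheme"
    and Y :: "('e, 't, 'o, 'm, 's) fibred_scheme" (structure)
begin

text \<open>Pullbacks may be chosen independently of each other: the transition arrows are
  factorizations through cartesian arrows, and their functoriality is the uniqueness of such
  factorizations. This makes \<open>glue_arrows\<close> applicable to any choice.\<close>

lemma restriction_datum:
  assumes U: "U \<in> Obj C" and R: "R \<in> Cov C U" and x: "x \<in> Obj Y" "POb Y x = U"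
    and a: "\<And>h. h \<in> generated_sieve C R \<Longrightarrow> a h \<in> Arr Y \<and> Tgt Y (a h) = x \<and> PAr Y (a h) = h"
  obtains d where "descent_datum C Y (generated_sieve C R) (\<lambda>h. Src Y (a h)) d"
    "glues C Y U (generated_sieve C R) (\<lambda>h. Src Y (a h)) d x a"
    "\<And>h k. \<lbrakk>h \<in> generated_sieve C R; k \<in> Arr C; Tgt C k = Src C h\<rbrakk> \<Longrightarrow>
       d h k \<in> Arr Y \<and> Src Y (d h k) = Src Y (a (h \<cdot>\<^bsub>C\<^esub> k)) \<and> Tgt Y (d h k) = Src Y (a h) \<and>
       PAr Y (d h k) = k \<and> a h \<cdot> d h k = a (h \<cdot>\<^bsub>C\<^esub> k)"
proof -
  let ?S = "generated_sieve C R"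
  have sa: "POb Y (Src Y (a h)) = Src C h" if "h \<in> ?S" for h
    using a[OF that] src_par[of "a h"] by auto
  define P where "P h k l \<longleftrightarrow> l \<in> Arr Y \<and> Src Y l = Src Y (a (h \<cdot>\<^bsub>C\<^esub> k)) \<and> Tgt Y l = Src Y (a h) \<and>
       PAr Y l = k \<and> a h \<cdot> l = a (h \<cdot>\<^bsub>C\<^esub> k)" for h k l
  define d where "d h k = (SOME l. P h k l)" for h k
  have d: "d h k \<in> Arr Y \<and> Src Y (d h k) = Src Y (a (h \<cdot>\<^bsub>C\<^esub> k)) \<and> Tgt Y (d h k) = Src Y (a h) \<and>
       PAr Y (d h k) = k \<and> a h \<cdot> d h k = a (h \<cdot>\<^bsub>C\<^esub> k)"
    if hk: "h \<in> ?S" "k \<in> Arr C" "Tgt C k = Src C h" for h k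
  proof -
    note 1 = a[OF hk(1)] and 2 = a[OF sieve_cmp[OF U R, OF hk]]
    obtain l where "l \<in> Arr Y" "Src Y l = Src Y (a (h \<cdot>\<^bsub>C\<^esub> k))" "Tgt Y l = Src Y (a h)"
       "PAr Y l = k" "a h \<cdot> l = a (h \<cdot>\<^bsub>C\<^esub> k)"
      using factor[of "a h" "a (h \<cdot>\<^bsub>C\<^esub> k)" k] 1 2 hk sieve_arr[OF U R, OF hk(1)] sa[OF sieve_cmp[OF U R, OF hk]] sa[OF hk(1)] by auto
    then have "P h k l"
      by (simp add: P_def)
    then have "P h k (d h k)"
      unfolding d_def by (rule someI)
    then show ?thesis
      by (simp add: P_def)
  qed
  have id: "d h (Idn C (Src C h)) = Idn Y (Src Y (a h))" if h: "h \<in> ?S" for h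
    using d[OF h, of "Idn C (Src C h)"] a[OF h] sieve_arr[OF U R, OF h] sa[OF h]
    by - (rule cancel[of "a h"]; auto)
  have comp: "d h (k \<cdot>\<^bsub>C\<^esub> l) = d h k \<cdot> d (h \<cdot>\<^bsub>C\<^esub> k) l"
    if h: "h \<in> ?S" and k: "k \<in> Arr C" "Tgt C k = Src C h" and l: "l \<in> Arr C" "Tgt C l = Src C k" for h k l
  proof (rule cancel[of "a h"])
    have 1: "a (h \<cdot>\<^bsub>C\<^esub> k) \<cdot> d (h \<cdot>\<^bsub>C\<^esub> k) l = a (h \<cdot>\<^bsub>C\<^esub> (k \<cdot>\<^bsub>C\<^esub> l))"
      using d[of "h \<cdot>\<^bsub>C\<^esub> k" l] sieve_cmp[OF U R h k] h sieve_arr[OF U R h] k l by auto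
    have 2: "d (h \<cdot>\<^bsub>C\<^esub> k) l \<in> Arr Y" "Tgt Y (d (h \<cdot>\<^bsub>C\<^esub> k) l) = Src Y (a (h \<cdot>\<^bsub>C\<^esub> k))"
      using d[of "h \<cdot>\<^bsub>C\<^esub> k" l] sieve_cmp[OF U R h k] h sieve_arr[OF U R h] k l by auto
    have 3: "a h \<cdot> d h k = a (h \<cdot>\<^bsub>C\<^esub> k)"
      using d[OF h k] by auto
    show "a h \<cdot> d h (k \<cdot>\<^bsub>C\<^esub> l) = a h \<cdot> (d h k \<cdot> d (h \<cdot>\<^bsub>C\<^esub> k) l)"
      using d[OF h k] d[of h "k \<cdot>\<^bsub>C\<^esub> l"] a[OF h] h k l 1 2 by (simp add: total.reassoc[OF 3])
  qed (use d[OF h k] d[of "h \<cdot>\<^bsub>C\<^esub> k" l] d[of h "k \<cdot>\<^bsub>C\<^esub> l"] sieve_cmp[OF U R, OF h k] a[OF h] h sieve_arr[OF U R, OF h] k l in auto)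
  show thesis
  proof (rule that)
    show "descent_datum C Y ?S (\<lambda>h. Src Y (a h)) d"
      unfolding descent_datum_def using a sa d id comp by (auto simp: Hom_over_def Hom_def)
    show "glues C Y U ?S (\<lambda>h. Src Y (a h)) d x a"
      unfolding glues_def using a d x by (auto simp: Hom_over_def Hom_def)
  qed (rule d)
qed

text \<open>The arrows \<open>u\<close> and \<open>v\<close> differ by a vertical endomorphism
  \<open>l\<close> of their source. It fixes a family of pullbacks along the sieve, as does the
  identity, so uniqueness in \<open>glue_arrows\<close> gives that \<open>l\<close> is the
  identity.\<close>

lemma arrow_eq_local:
  assumes uv: "u \<in> Arr Y" "v \<in> Arr Y" "Src Y u = Src Y v" "Tgt Y u = Tgt Y v" "PAr Y u = PAr Y v"
    and R: "R \<in> Cov C (POb Y (Src Y u))"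
    and loc: "\<And>h. h \<in> R \<Longrightarrow> \<exists>p \<in> Arr Y. Tgt Y p = Src Y u \<and> PAr Y p = h \<and> u \<cdot> p = v \<cdot> p"
  shows "u = v"
proof -
  let ?x = "Src Y u" and ?U = "POb Y (Src Y u)" and ?S = "generated_sieve C R"
  have U: "?U \<in> Obj C" using uv by simp
  obtain l where l: "l \<in> Arr Y" "Src Y l = ?x" "Tgt Y l = ?x" "PAr Y l = Idn C ?U" "u \<cdot> l = v"
    using factor[of u v "Idn C ?U"] uv by auto
  have "\<exists>a. \<forall>h\<in>?S. a h \<in> Arr Y \<and> Tgt Y (a h) = ?x \<and> PAr Y (a h) = h \<and> l \<cdot> a h = a h"
  proof (rule bchoice, rule ballI)
    fix h assume "h \<in> ?S"
    then obtain f k where f: "f \<in> R" and k: "k \<in> Arr C" "Tgt C k = Src C f" "h = f \<cdot>\<^bsub>C\<^esub> k"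
      by (auto simp: generated_sieve_def)
    obtain p where p: "p \<in> Arr Y" "Tgt Y p = ?x" "PAr Y p = f" "u \<cdot> p = v \<cdot> p"
      using loc[OF f] by auto
    obtain q where q: "q \<in> Arr Y" "Tgt Y q = Src Y p" "PAr Y q = k"
      using pullback[of "Src Y p" k] p k src_par[of p] by auto
    have "u \<cdot> p = u \<cdot> (l \<cdot> p)"
      using p l uv by (simp add: total.reassoc[OF l(5)])
    then have lp: "l \<cdot> p = p"
      using p l uv cov_arr[OF U R f] by - (rule cancel[of u]; auto)
    have "l \<cdot> (p \<cdot> q) = p \<cdot> q"
      using p q l by (simp add: total.reassoc[OF lp])
    then show "\<exists>a. a \<in> Arr Y \<and> Tgt Y a = ?x \<and> PAr Y a = h \<and> l \<cdot> a = a"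
      using p q k by (intro exI[of _ "p \<cdot> q"]) auto
  qed
  then obtain a where a: "\<And>h. h \<in> ?S \<Longrightarrow> a h \<in> Arr Y \<and> Tgt Y (a h) = ?x \<and> PAr Y (a h) = h"
    and la: "\<And>h. h \<in> ?S \<Longrightarrow> l \<cdot> a h = a h" by blast
  obtain d where dd: "descent_datum C Y ?S (\<lambda>h. Src Y (a h)) d"
    and g: "glues C Y ?U ?S (\<lambda>h. Src Y (a h)) d ?x a"
    using restriction_datum[OF U R _ _ a] uv by (metis total.src_obj)
  have "l \<in> Hom_over Y (Idn C ?U) ?x ?x \<and> (\<forall>h \<in> ?S. l \<cdot> a h = a h)"
    using l la by (simp add: Hom_over_def Hom_def)
  moreover have "Idn Y ?x \<in> Hom_over Y (Idn C ?U) ?x ?x \<and> (\<forall>h \<in> ?S. Idn Y ?x \<cdot> a h = a h)"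
    using a uv by (simp add: Hom_over_def Hom_def)
  ultimately have "l = Idn Y ?x"
    using glue_arrows[OF U R dd g g] by blast
  then show ?thesis
    using l uv by auto
qed

text \<open>The index \<open>i\<close> runs over probes \<open>s i\<close> of the source; the arrow sought is prescribed to be
  \<open>t i\<close> on each of them.\<close>

lemma glue_from_probes:
  assumes x: "x \<in> Obj Y" and x': "x' \<in> Obj Y" and f: "f \<in> Arr C" "Src C f = POb Y x" "Tgt C f = POb Y x'"
    and s: "\<And>i. i \<in> I \<Longrightarrow> s i \<in> Arr Y \<and> Tgt Y (s i) = x"
    and t: "\<And>i. i \<in> I \<Longrightarrow> t i \<in> Arr Y \<and> Tgt Y (t i) = x' \<and> Src Y (t i) = Src Y (s i) \<and>
              PAr Y (t i) = f \<cdot>\<^bsub>C\<^esub> PAr Y (s i)"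
    and R: "R \<in> Cov C (POb Y x)" and cov: "\<And>h. h \<in> R \<Longrightarrow> \<exists>i \<in> I. PAr Y (s i) = h"
    and compat: "\<And>i j v w. \<lbrakk>i \<in> I; j \<in> I; v \<in> Arr Y; w \<in> Arr Y; Src Y v = Src Y w;
          Tgt Y v = Src Y (s i); Tgt Y w = Src Y (s j); s i \<cdot> v = s j \<cdot> w\<rbrakk>
             \<Longrightarrow> t i \<cdot> v = t j \<cdot> w"
  shows "\<exists>!m. m \<in> Hom_over Y f x x' \<and> (\<forall>i \<in> I. m \<cdot> s i = t i)"
proof -
  let ?U = "POb Y x" and ?S = "generated_sieve C R"
  have U: "?U \<in> Obj C" using x by simp
  have "\<exists>iv. \<forall>h\<in>?S. fst (iv h) \<in> I \<and> snd (iv h) \<in> Arr Y \<and> Tgt Y (snd (iv h)) = Src Y (s (fst (iv h))) \<and>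
          PAr Y (s (fst (iv h)) \<cdot> snd (iv h)) = h"
  proof (rule bchoice, rule ballI)
    fix h assume "h \<in> ?S"
    then obtain r k where r: "r \<in> R" and k: "k \<in> Arr C" "Tgt C k = Src C r" "h = r \<cdot>\<^bsub>C\<^esub> k"
      by (auto simp: generated_sieve_def)
    obtain i where i: "i \<in> I" "PAr Y (s i) = r" using cov[OF r] by auto
    obtain q where "q \<in> Arr Y" "Tgt Y q = Src Y (s i)" "PAr Y q = k"
      using pullback[of "Src Y (s i)" k] s[OF i(1)] i k src_par[of "s i"] by auto
    then show "\<exists>iv. fst iv \<in> I \<and> snd iv \<in> Arr Y \<and> Tgt Y (snd iv) = Src Y (s (fst iv)) \<and>
          PAr Y (s (fst iv) \<cdot> snd iv) = h"
      using s[OF i(1)] i k by (intro exI[of _ "(i, q)"]) auto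
  qed
  then obtain iv where iv: "\<And>h. h \<in> ?S \<Longrightarrow> fst (iv h) \<in> I \<and> snd (iv h) \<in> Arr Y \<and>
      Tgt Y (snd (iv h)) = Src Y (s (fst (iv h))) \<and> PAr Y (s (fst (iv h)) \<cdot> snd (iv h)) = h"
    by blast
  define a where "a h = s (fst (iv h)) \<cdot> snd (iv h)" for h
  define b where "b h = t (fst (iv h)) \<cdot> snd (iv h)" for h
  have a: "a h \<in> Arr Y \<and> Tgt Y (a h) = x \<and> PAr Y (a h) = h" if "h \<in> ?S" for h
    using iv[OF that] s by (auto simp: a_def)
  have b: "b h \<in> Arr Y \<and> Tgt Y (b h) = x' \<and> Src Y (b h) = Src Y (a h) \<and> PAr Y (b h) = f \<cdot>\<^bsub>C\<^esub> h"
    if "h \<in> ?S" for h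
    using iv[OF that] s[of "fst (iv h)"] t[of "fst (iv h)"] f by (auto simp: a_def b_def)
  obtain d where dd: "descent_datum C Y ?S (\<lambda>h. Src Y (a h)) d"
    and g: "glues C Y ?U ?S (\<lambda>h. Src Y (a h)) d x a"
    and d: "\<And>h k. \<lbrakk>h \<in> ?S; k \<in> Arr C; Tgt C k = Src C h\<rbrakk> \<Longrightarrow>
       d h k \<in> Arr Y \<and> Src Y (d h k) = Src Y (a (h \<cdot>\<^bsub>C\<^esub> k)) \<and> Tgt Y (d h k) = Src Y (a h) \<and>
       PAr Y (d h k) = k \<and> a h \<cdot> d h k = a (h \<cdot>\<^bsub>C\<^esub> k)"
    using restriction_datum[OF U R x refl a] by metis
  \<comment> \<open>The probes chosen for \<open>h\<close> and for its composite with
    \<open>k\<close> are unrelated; \<open>compat\<close> is what relates their prescribed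
    values.\<close>
  have b_d: "b h \<cdot> d h k = b (h \<cdot>\<^bsub>C\<^esub> k)" if h: "h \<in> ?S" and k: "k \<in> Arr C" "Tgt C k = Src C h" for h k
  proof -
    note 1 = iv[OF h] and 2 = iv[OF sieve_cmp[OF U R, OF h k]] and 3 = d[OF h k]
    have "t (fst (iv h)) \<cdot> (snd (iv h) \<cdot> d h k) = b (h \<cdot>\<^bsub>C\<^esub> k)"
      unfolding b_def
    proof (rule compat)
      show "s (fst (iv h)) \<cdot> (snd (iv h) \<cdot> d h k) =
          s (fst (iv (h \<cdot>\<^bsub>C\<^esub> k))) \<cdot> snd (iv (h \<cdot>\<^bsub>C\<^esub> k))"
        using 1 2 3 s[of "fst (iv h)"] s[of "fst (iv (h \<cdot>\<^bsub>C\<^esub> k))"] by (clarsimp simp: a_def)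
    qed (use 1 2 3 s in \<open>auto simp: a_def\<close>)
    then show ?thesis
      using 1 3 s[of "fst (iv h)"] t[of "fst (iv h)"]
      by (clarsimp simp: b_def a_def)
  qed
  \<comment> \<open>\<open>glue_arrows\<close> only produces vertical arrows. The prescribed values
    are therefore factored through a pullback \<open>q\<close> of \<open>x'\<close> along
    \<open>f\<close> and glued with target \<open>Src Y q\<close>.\<close>
  obtain q where q: "q \<in> Arr Y" "Tgt Y q = x'" "PAr Y q = f" "POb Y (Src Y q) = ?U"
    using pullback[OF x' f(1) f(3)] f(2) by metis
  have "\<exists>c. \<forall>h\<in>?S. c h \<in> Arr Y \<and> Src Y (c h) = Src Y (a h) \<and> Tgt Y (c h) = Src Y q \<and>
      PAr Y (c h) = h \<and> q \<cdot> c h = b h"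
  proof (rule bchoice, rule ballI)
    fix h assume h: "h \<in> ?S"
    show "\<exists>c. c \<in> Arr Y \<and> Src Y c = Src Y (a h) \<and> Tgt Y c = Src Y q \<and> PAr Y c = h \<and> q \<cdot> c = b h"
      using factor[of q "b h" h] q b[OF h] a[OF h] sieve_arr[OF U R, OF h] src_par[of "a h"] by metis
  qed
  then obtain c where c: "\<And>h. h \<in> ?S \<Longrightarrow> c h \<in> Arr Y \<and> Src Y (c h) = Src Y (a h) \<and>
      Tgt Y (c h) = Src Y q \<and> PAr Y (c h) = h \<and> q \<cdot> c h = b h" by blast
  have c_d: "c h \<cdot> d h k = c (h \<cdot>\<^bsub>C\<^esub> k)" if h: "h \<in> ?S" and k: "k \<in> Arr C" "Tgt C k = Src C h" for h k
  proof (rule cancel[of q])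
    have 1: "q \<cdot> c h = b h" using c[OF h] by simp
    show "q \<cdot> (c h \<cdot> d h k) = q \<cdot> c (h \<cdot>\<^bsub>C\<^esub> k)"
      using c[OF h] c[OF sieve_cmp[OF U R h k]] d[OF h k] b_d[OF h k] q
      by (simp add: total.reassoc[OF 1])
  qed (use c[OF h] c[OF sieve_cmp[OF U R h k]] d[OF h k] q in auto)
  have g': "glues C Y ?U ?S (\<lambda>h. Src Y (a h)) d (Src Y q) c"
    unfolding glues_def using q c c_d by (auto simp: Hom_over_def Hom_def)
  obtain w where w: "w \<in> Arr Y" "Src Y w = x" "Tgt Y w = Src Y q" "PAr Y w = Idn C ?U"
    "\<And>h. h \<in> ?S \<Longrightarrow> w \<cdot> a h = c h"
    using ex1_implies_ex[OF glue_arrows[OF U R dd g g']] by (auto simp: Hom_over_def Hom_def)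
  define m where "m = q \<cdot> w"
  have m: "m \<in> Arr Y" "Src Y m = x" "Tgt Y m = x'" "PAr Y m = f"
    using w q f by (auto simp: m_def)
  have ma: "m \<cdot> a h = b h" if "h \<in> ?S" for h
    using w q a[OF that] c[OF that] that by (auto simp: m_def)
  \<comment> \<open>So far \<open>m\<close> is known on the pullbacks \<open>a h\<close> only. An
    arbitrary probe is compared with them on a cover of its source that maps into the sieve, where
    \<open>compat\<close> identifies the two prescriptions.\<close>
  have ms: "m \<cdot> s i = t i" if i: "i \<in> I" for i
  proof -
    note si = s[OF i] and ti = t[OF i]
    let ?W = "POb Y (Src Y (s i))"
    obtain T where T: "T \<in> Cov C ?W"
      "\<forall>h \<in> T. \<exists>r \<in> R. \<exists>l \<in> Hom C (Src C h) (Src C r). PAr Y (s i) \<cdot>\<^bsub>C\<^esub> h = r \<cdot>\<^bsub>C\<^esub> l"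
      using cov_stable[OF R, of "PAr Y (s i)" ?W] si by (auto simp: Hom_def)
    show ?thesis
    proof (rule arrow_eq_local)
      fix h assume h: "h \<in> T"
      then obtain r l where r: "r \<in> R" and l: "l \<in> Arr C" "Src C l = Src C h" "Tgt C l = Src C r"
          "PAr Y (s i) \<cdot>\<^bsub>C\<^esub> h = r \<cdot>\<^bsub>C\<^esub> l" using T by (auto simp: Hom_def)
      have rl: "r \<cdot>\<^bsub>C\<^esub> l \<in> ?S" using r l by (auto simp: generated_sieve_def)
      have harr: "h \<in> Arr C" "Tgt C h = ?W" using cov_arr[OF _ T(1) h] si by auto
      obtain v where v: "v \<in> Arr Y" "Tgt Y v = Src Y (s i)" "PAr Y v = h" "POb Y (Src Y v) = Src C h"
        using pullback[of "Src Y (s i)" h] si harr by auto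
      let ?h = "r \<cdot>\<^bsub>C\<^esub> l"
      note 1 = iv[OF rl] and 2 = a[OF rl] and 3 = cov_arr[OF U R r]
      have "POb Y (Src Y (a ?h)) = Src C ?h" using src_par[of "a ?h"] 2 by simp
      then obtain n where n: "n \<in> Arr Y" "Src Y n = Src Y v" "Tgt Y n = Src Y (a ?h)"
          "a ?h \<cdot> n = s i \<cdot> v"
        using factor[of "a ?h" "s i \<cdot> v" "Idn C (Src C h)"] 2 3 si v harr l by auto
      note s1 = s[of "fst (iv ?h)"] and t1 = t[of "fst (iv ?h)"]
      have "t i \<cdot> v = t (fst (iv ?h)) \<cdot> (snd (iv ?h) \<cdot> n)"
        using i 1 si s1 v n by - (rule compat; clarsimp simp: a_def)
      also have "\<dots> = b ?h \<cdot> n"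
        using 1 s1 t1 n by (auto simp: b_def a_def)
      also have "\<dots> = m \<cdot> (a ?h \<cdot> n)"
        using m n 2 by (simp flip: ma[OF rl])
      also have "\<dots> = (m \<cdot> s i) \<cdot> v"
        using n m si v by auto
      finally show "\<exists>p \<in> Arr Y. Tgt Y p = Src Y (m \<cdot> s i) \<and> PAr Y p = h \<and>
          (m \<cdot> s i) \<cdot> p = t i \<cdot> p"
        using v m si by (intro bexI[of _ v]) auto
    qed (use m si ti T in auto)
  qed
  show ?thesis
  proof (rule ex1I[of _ m])
    show "m \<in> Hom_over Y f x x' \<and> (\<forall>i \<in> I. m \<cdot> s i = t i)"
      using m ms by (auto simp: Hom_over_def Hom_def)
    fix n assume n: "n \<in> Hom_over Y f x x' \<and> (\<forall>i \<in> I. n \<cdot> s i = t i)"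
    show "n = m"
    proof (rule arrow_eq_local)
      fix h assume "h \<in> R"
      then obtain i where i: "i \<in> I" "PAr Y (s i) = h" using cov by blast
      show "\<exists>p \<in> Arr Y. Tgt Y p = Src Y n \<and> PAr Y p = h \<and> n \<cdot> p = m \<cdot> p"
        using s[OF i(1)] i n ms by (intro bexI[of _ "s i"]) (auto simp: Hom_over_def Hom_def)
    qed (use n m R in \<open>auto simp: Hom_over_def Hom_def\<close>)
  qed
qed

end

section \<open>Sheaves with an action\<close>

text \<open>Both sections glue the matching family of restrictions of \<open>x\<close>, and a gluing
  is unique.\<close>

lemma (in sheaf) separated:
  assumes "site C" and U: "U \<in> Obj C" and R: "R \<in> Cov C U" and x: "x \<in> Sec F U" "x' \<in> Sec F U"
    and eq: "\<And>f. f \<in> R \<Longrightarrow> Res F f x = Res F f x'"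
  shows "x = x'"
proof -
  interpret site C by fact
  have R': "f \<in> Hom C (Src C f) U" if "f \<in> R" for f
    using cov_arr[OF U R that] by (auto simp: Hom_def)
  have "\<exists>!y. y \<in> Sec F U \<and> (\<forall>f \<in> R. Res F f y = Res F f x)"
  proof (rule glue[OF U R])
    show "Res F f x \<in> Sec F (Src C f)" if "f \<in> R" for f
      by (rule res_closed[OF R'[OF that] x(1)])
    show "Res F p (Res F f x) = Res F p' (Res F f' x)"
      if "f \<in> R" "f' \<in> R" "p \<in> Hom C W (Src C f)" "p' \<in> Hom C W (Src C f')" "f \<cdot> p = f' \<cdot> p'" for f f' W p p'
      using res_cmp[OF R'[OF that(1)] that(3) x(1)] res_cmp[OF R'[OF that(2)] that(4) x(1)] that(5) by simp
  qed
  then show ?thesis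
    using x eq by (metis (no_types, lifting))
qed

locale equivariant_sheaf = site C + G: group G
  for C :: "('o, 'm, 'r) site_scheme"
    and G :: "('g, 'p) monoid_scheme"
    and A :: "('o, 'm, 'a) absheaf"
    and \<phi> :: "'g \<Rightarrow> 'o \<Rightarrow> 'a \<Rightarrow> 'a" +
  assumes absheaf: "abelian_sheaf C A" and action: "sheaf_action C G A \<phi>"
begin

abbreviation sec :: "'o \<Rightarrow> 'a set" where
  "sec U \<equiv> carrier (Grp A U)"

lemma comm [simp]: "U \<in> Obj C \<Longrightarrow> comm_group (Grp A U)"
  using absheaf by (simp add: abelian_sheaf_def)

lemma grp [simp]: "U \<in> Obj C \<Longrightarrow> group (Grp A U)"
  using comm by (simp add: comm_group_def)

lemma mon [simp]: "U \<in> Obj C \<Longrightarrow> monoid (Grp A U)"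
  using grp by (simp add: group_def)

lemma sheaf_A: "sheaf C (underlying A)"
  using absheaf by (simp add: abelian_sheaf_def)

lemma ares_hom: "\<lbrakk>f \<in> Arr C; Src C f = V; Tgt C f = U\<rbrakk> \<Longrightarrow> ARes A f \<in> hom (Grp A U) (Grp A V)"
  using absheaf src_obj[of f] tgt_obj[of f] unfolding abelian_sheaf_def Hom_def by auto

lemma ares_closed [simp]:
  "\<lbrakk>f \<in> Arr C; Src C f = V; a \<in> sec (Tgt C f)\<rbrakk> \<Longrightarrow> ARes A f a \<in> sec V"
  using ares_hom[of f V] by (auto simp: hom_def)

lemma ares_mult:
  "\<lbrakk>f \<in> Arr C; a \<in> sec (Tgt C f); b \<in> sec (Tgt C f)\<rbrakk>
     \<Longrightarrow> ARes A f (a \<otimes>\<^bsub>Grp A (Tgt C f)\<^esub> b) = ARes A f a \<otimes>\<^bsub>Grp A (Src C f)\<^esub> ARes A f b"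
  using ares_hom[of f] by (auto simp: hom_def)

lemma ares_idn [simp]: "\<lbrakk>U \<in> Obj C; a \<in> sec U\<rbrakk> \<Longrightarrow> ARes A (Idn C U) a = a"
  using sheaf.res_idn[OF sheaf_A] by (simp add: underlying_def)

lemma ares_cmp:
  "\<lbrakk>f \<in> Arr C; h \<in> Arr C; Tgt C h = Src C f; a \<in> sec (Tgt C f)\<rbrakk>
     \<Longrightarrow> ARes A (f \<cdot>\<^bsub>C\<^esub> h) a = ARes A h (ARes A f a)"
  using sheaf.res_cmp[OF sheaf_A, of f "Src C f" "Tgt C f" h "Src C h" a]
  by (simp add: underlying_def Hom_def)

lemma ares_separated:
  assumes "U \<in> Obj C" "R \<in> Cov C U" "a \<in> sec U" "b \<in> sec U"
    "\<And>f. f \<in> R \<Longrightarrow> ARes A f a = ARes A f b"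
  shows "a = b"
  using sheaf.separated[OF sheaf_A _ assms(1,2), of a b] assms site_axioms by (simp add: underlying_def)

lemma phi_hom: "\<lbrakk>g \<in> carrier G; U \<in> Obj C\<rbrakk> \<Longrightarrow> \<phi> g U \<in> hom (Grp A U) (Grp A U)"
  and phi_bij: "\<lbrakk>g \<in> carrier G; U \<in> Obj C\<rbrakk> \<Longrightarrow> bij_betw (\<phi> g U) (sec U) (sec U)"
  using action by (auto simp: sheaf_action_def absheaf_automorphism_def iso_def)

lemma phi_closed [simp]:
  "\<lbrakk>g \<in> carrier G; U \<in> Obj C; a \<in> sec U\<rbrakk> \<Longrightarrow> \<phi> g U a \<in> sec U"
  using phi_hom by (auto simp: hom_def)

lemma phi_mult:
  "\<lbrakk>g \<in> carrier G; U \<in> Obj C; a \<in> sec U; b \<in> sec U\<rbrakk>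
     \<Longrightarrow> \<phi> g U (a \<otimes>\<^bsub>Grp A U\<^esub> b) = \<phi> g U a \<otimes>\<^bsub>Grp A U\<^esub> \<phi> g U b"
  using phi_hom by (auto simp: hom_def)

lemma phi_ares:
  "\<lbrakk>g \<in> carrier G; f \<in> Arr C; Src C f = V; Tgt C f = U; a \<in> sec U\<rbrakk>
     \<Longrightarrow> \<phi> g V (ARes A f a) = ARes A f (\<phi> g U a)"
  using action src_obj[of f] tgt_obj[of f]
  by (auto simp: sheaf_action_def absheaf_automorphism_def sheaf_morphism_def underlying_def Hom_def)

lemma phi_cmp:
  "\<lbrakk>g \<in> carrier G; h \<in> carrier G; U \<in> Obj C; a \<in> sec U\<rbrakk>
     \<Longrightarrow> \<phi> (g \<otimes>\<^bsub>G\<^esub> h) U a = \<phi> g U (\<phi> h U a)"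
  using action by (auto simp: sheaf_action_def)

text \<open>\<open>sheaf_action\<close> does not state that the unit acts trivially. It does, being
  idempotent and injective.\<close>

lemma phi_one [simp]:
  assumes "U \<in> Obj C" "a \<in> sec U"
  shows "\<phi> \<one>\<^bsub>G\<^esub> U a = a"
proof -
  have "\<phi> \<one>\<^bsub>G\<^esub> U (\<phi> \<one>\<^bsub>G\<^esub> U a) = \<phi> \<one>\<^bsub>G\<^esub> U a"
    using phi_cmp[of "\<one>\<^bsub>G\<^esub>" "\<one>\<^bsub>G\<^esub>" U a] assms by simp
  moreover have "inj_on (\<phi> \<one>\<^bsub>G\<^esub> U) (sec U)"
    using phi_bij[of "\<one>\<^bsub>G\<^esub>" U] assms by (simp add: bij_betw_def)
  ultimately show ?thesis
    using assms by (auto dest: inj_onD)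
qed

lemma invariant_iff: "c \<in> carrier (Grp (invariants G A \<phi>) U) \<longleftrightarrow>
    c \<in> sec U \<and> (\<forall>g \<in> carrier G. \<phi> g U c = c)"
  by (simp add: invariants_def)

end


section \<open>Coboundaries\<close>

lemma (in comm_group) mult_quotient:
  assumes "x \<in> carrier G" "y \<in> carrier G" "p \<in> carrier G"
  shows "x \<otimes> (y \<otimes> (p \<otimes> inv (y \<otimes> x))) = p"
proof -
  \<comment> \<open>An arbitrary \<open>i\<close> stands for the inverse of the product, which
    simplification would otherwise split into two inverses.\<close>
  have "x \<otimes> (y \<otimes> (p \<otimes> i)) = p \<otimes> ((y \<otimes> x) \<otimes> i)" if "i \<in> carrier G" for i
    using assms that by (simp add: m_ac)
  from this[of "inv (y \<otimes> x)"] show ?thesis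
    using assms by (simp del: inv_mult_group)
qed

locale group_module = G: group G + M: comm_group M
  for G :: "('g, 'r) monoid_scheme" and M :: "('a, 's) monoid_scheme" (structure) +
  fixes \<psi> :: "'g \<Rightarrow> 'a \<Rightarrow> 'a"
  assumes psi_hom: "g \<in> carrier G \<Longrightarrow> \<psi> g \<in> hom M M"
    and psi_cmp: "\<lbrakk>g \<in> carrier G; h \<in> carrier G; a \<in> carrier M\<rbrakk> \<Longrightarrow> \<psi> (g \<otimes>\<^bsub>G\<^esub> h) a = \<psi> g (\<psi> h a)"
begin

lemma psi_closed [simp]: "\<lbrakk>g \<in> carrier G; a \<in> carrier M\<rbrakk> \<Longrightarrow> \<psi> g a \<in> carrier M"
  using psi_hom by (auto simp: hom_def)

lemma psi_mult: "\<lbrakk>g \<in> carrier G; a \<in> carrier M; b \<in> carrier M\<rbrakk> \<Longrightarrow> \<psi> g (a \<otimes> b) = \<psi> g a \<otimes> \<psi> g b"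
  using psi_hom by (auto simp: hom_def)

lemma psi_inv: "\<lbrakk>g \<in> carrier G; a \<in> carrier M\<rbrakk> \<Longrightarrow> \<psi> g (inv a) = inv (\<psi> g a)"
  using group_hom.hom_inv[of M M "\<psi> g" a] psi_hom
  by (simp add: group_hom_def group_hom_axioms_def M.is_group)

lemma cochain_closed: "\<lbrakk>c \<in> carrier (cochains G M n); l \<in> tuples G n\<rbrakk> \<Longrightarrow> c l \<in> carrier M"
  by (auto simp: cochains_def)

lemma tuples_face:
  assumes "l \<in> tuples G (Suc n)"
  shows "hd l \<in> carrier G" "tl l \<in> tuples G n" "butlast l \<in> tuples G n"
    "i \<in> {1..n} \<Longrightarrow> merge G i l \<in> tuples G n"
proof -
  have l: "length l = Suc n" "set l \<subseteq> carrier G" using assms by (auto simp: tuples_def)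
  then have ne: "l \<noteq> []" by auto
  show "hd l \<in> carrier G" "tl l \<in> tuples G n" "butlast l \<in> tuples G n"
    using l ne by (auto simp: tuples_def dest: in_set_butlastD list.set_sel(2))
  assume i: "i \<in> {1..n}"
  then have "l ! (i - 1) \<in> carrier G" "l ! i \<in> carrier G"
    using l nth_mem[of "i - 1" l] nth_mem[of i l] by auto
  then show "merge G i l \<in> tuples G n"
    using l i by (auto simp: tuples_def merge_def dest!: in_set_takeD in_set_dropD)
qed

lemma coboundary_closed:
  assumes "c \<in> carrier (cochains G M n)"
  shows "coboundary G M \<psi> n c \<in> carrier (cochains G M (Suc n))"
  using cochain_closed[OF assms] tuples_face
  by (auto simp: coboundary_def cochains_def intro!: M.m_closed M.int_pow_closed M.finprod_closed)

lemma coboundary_mult: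
  assumes c: "c \<in> carrier (cochains G M n)" and d: "d \<in> carrier (cochains G M n)"
  shows "coboundary G M \<psi> n (c \<otimes>\<^bsub>cochains G M n\<^esub> d) =
    coboundary G M \<psi> n c \<otimes>\<^bsub>cochains G M (Suc n)\<^esub> coboundary G M \<psi> n d"
proof -
  have "coboundary G M \<psi> n (c \<otimes>\<^bsub>cochains G M n\<^esub> d) l =
      coboundary G M \<psi> n c l \<otimes> coboundary G M \<psi> n d l" if l: "l \<in> tuples G (Suc n)" for l
  proof -
    note f = tuples_face[OF l]
    let ?p = "\<lambda>c i. c (merge G i l) [^]\<^bsub>M\<^esub> ((- 1 :: int) ^ i)"
    have fin: "finprod M (?p (c \<otimes>\<^bsub>cochains G M n\<^esub> d)) {1..n} = finprod M (?p c) {1..n} \<otimes> finprod M (?p d) {1..n}"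
    proof -
      have "finprod M (?p (c \<otimes>\<^bsub>cochains G M n\<^esub> d)) {1..n} = finprod M (\<lambda>i. ?p c i \<otimes> ?p d i) {1..n}"
        using f cochain_closed[OF c] cochain_closed[OF d]
        by (intro M.finprod_cong') (auto simp: cochains_def M.int_pow_mult_distrib M.m_comm)
      then show ?thesis
        using f cochain_closed[OF c] cochain_closed[OF d] by (simp add: Pi_def)
    qed
    have cl: "finprod M (?p c) {1..n} \<in> carrier M" "finprod M (?p d) {1..n} \<in> carrier M"
      using f cochain_closed[OF c] cochain_closed[OF d] by (auto intro!: M.finprod_closed)
    show ?thesis
      using l f fin cl cochain_closed[OF c f(2)] cochain_closed[OF d f(2)]
        cochain_closed[OF c f(3)] cochain_closed[OF d f(3)]
      by (simp add: coboundary_def) (simp add: cochains_def psi_mult M.int_pow_mult_distrib M.m_comm M.m_ac)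
  qed
  then show ?thesis
    by (auto simp: coboundary_def cochains_def restrict_def fun_eq_iff)
qed

lemma coboundary_one:
  "coboundary G M \<psi> n \<one>\<^bsub>cochains G M n\<^esub> = \<one>\<^bsub>cochains G M (Suc n)\<^esub>"
proof -
  have "\<psi> g \<one> = \<one>" if "g \<in> carrier G" for g
    using hom_one[OF psi_hom[OF that]] M.is_group by simp
  moreover have "finprod M (\<lambda>i. \<one>\<^bsub>cochains G M n\<^esub> (merge G i l) [^]\<^bsub>M\<^esub> ((- 1 :: int) ^ i)) {1..n} = \<one>"
    if "l \<in> tuples G (Suc n)" for l
    using tuples_face(4)[OF that] by (intro M.finprod_one_eqI) (simp add: cochains_def)
  ultimately show ?thesis
    using tuples_face by (auto simp: coboundary_def cochains_def restrict_def fun_eq_iff)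
qed

text \<open>The class is the coset of the coboundaries through
  \<open>coboundary G M \<psi> n b\<close>, and translation by this element maps the image of the
  coboundary homomorphism onto itself. Closedness is a hypothesis, to be discharged in the cases
  that occur.\<close>

lemma coboundary_class_trivial:
  assumes b: "b \<in> carrier (cochains G M n)"
    and closed: "coboundary G M \<psi> (Suc n) (coboundary G M \<psi> n b) = \<one>\<^bsub>cochains G M (Suc (Suc n))\<^esub>"
  shows "coboundary G M \<psi> n b \<in> carrier (cocycles G M \<psi> (Suc n))"
    and "cohomology_class G M \<psi> (Suc n) (coboundary G M \<psi> n b) = \<one>\<^bsub>cohomology G M \<psi> (Suc n)\<^esub>"
proof -
  let ?d = "coboundary G M \<psi> n" and ?C = "cochains G M n" and ?D = "cochains G M (Suc n)"
  show "?d b \<in> carrier (cocycles G M \<psi> (Suc n))"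
    using coboundary_closed[OF b] closed by (simp add: cocycles_def)
  have "(\<Union>h \<in> ?d ` carrier ?C. {h \<otimes>\<^bsub>?D\<^esub> ?d b}) = ?d ` carrier ?C"
  proof (intro equalityI subsetI)
    fix e assume "e \<in> (\<Union>h \<in> ?d ` carrier ?C. {h \<otimes>\<^bsub>?D\<^esub> ?d b})"
    then obtain c where c: "c \<in> carrier ?C" "e = ?d (c \<otimes>\<^bsub>?C\<^esub> b)"
      using coboundary_mult[OF _ b] by auto
    moreover have "c \<otimes>\<^bsub>?C\<^esub> b \<in> carrier ?C"
      using cochain_closed[OF c(1)] cochain_closed[OF b] by (auto simp: cochains_def)
    ultimately show "e \<in> ?d ` carrier ?C" by blast
  next
    fix e assume "e \<in> ?d ` carrier ?C"
    then obtain c where c: "c \<in> carrier ?C" "e = ?d c" by blast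
    \<comment> \<open>The quotient of \<open>c\<close> by \<open>b\<close> provides the preimage
      under translation; the restriction to tuples keeps it extensional, as cochains are.\<close>
    define q where "q = (\<lambda>l \<in> tuples G n. c l \<otimes> inv b l)"
    have q: "q \<in> carrier ?C"
      using cochain_closed[OF c(1)] cochain_closed[OF b] by (auto simp: cochains_def q_def)
    have "c l = (q \<otimes>\<^bsub>?C\<^esub> b) l" for l
      using c(1) cochain_closed[OF c(1), of l] cochain_closed[OF b, of l]
      by (cases "l \<in> tuples G n") (auto simp: cochains_def q_def M.m_assoc PiE_def extensional_def)
    then have "c = q \<otimes>\<^bsub>?C\<^esub> b" by blast
    then have "e = ?d q \<otimes>\<^bsub>?D\<^esub> ?d b"
      using coboundary_mult[OF q b] c by simp
    then show "e \<in> (\<Union>h \<in> ?d ` carrier ?C. {h \<otimes>\<^bsub>?D\<^esub> ?d b})" using q by blast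
  qed
  then show "cohomology_class G M \<psi> (Suc n) (?d b) = \<one>\<^bsub>cohomology G M \<psi> (Suc n)\<^esub>"
    by (simp add: cohomology_class_def cohomology_def FactGroup_def r_coset_def coboundaries_def cocycles_def)
qed

text \<open>The alternating product is sorted into a single quotient, positive terms over negative
  ones. Identities between coboundaries then become identities between products without
  inverses.\<close>

lemma coboundary_2:
  assumes c: "c \<in> carrier (cochains G M 2)" and g: "g1 \<in> carrier G" "g2 \<in> carrier G" "g3 \<in> carrier G"
  shows "coboundary G M \<psi> 2 c [g1, g2, g3] = (\<psi> g1 (c [g2, g3]) \<otimes> c [g1, g2 \<otimes>\<^bsub>G\<^esub> g3]) \<otimes>
    inv (c [g1 \<otimes>\<^bsub>G\<^esub> g2, g3] \<otimes> c [g1, g2])"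
proof -
  have l: "[g1, g2, g3] \<in> tuples G 3" using g by (simp add: tuples_def)
  have cl: "c [a, b] \<in> carrier M" if "a \<in> carrier G" "b \<in> carrier G" for a b
    using cochain_closed[OF c] that by (simp add: tuples_def)
  have s: "{1..2::nat} = {1, 2}" by auto
  have m: "merge G 1 [g1, g2, g3] = [g1 \<otimes>\<^bsub>G\<^esub> g2, g3]" "merge G 2 [g1, g2, g3] = [g1, g2 \<otimes>\<^bsub>G\<^esub> g3]"
    by (simp_all add: merge_def)
  show ?thesis
    using l g cl by (simp add: coboundary_def s m M.int_pow_neg M.inv_mult M.m_ac del: One_nat_def)
qed

lemma coboundary_3:
  assumes c: "c \<in> carrier (cochains G M 3)"
    and g: "g1 \<in> carrier G" "g2 \<in> carrier G" "g3 \<in> carrier G" "g4 \<in> carrier G"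
  shows "coboundary G M \<psi> 3 c [g1, g2, g3, g4] =
    (\<psi> g1 (c [g2, g3, g4]) \<otimes> (c [g1, g2 \<otimes>\<^bsub>G\<^esub> g3, g4] \<otimes> c [g1, g2, g3])) \<otimes>
    inv (c [g1 \<otimes>\<^bsub>G\<^esub> g2, g3, g4] \<otimes> c [g1, g2, g3 \<otimes>\<^bsub>G\<^esub> g4])"
proof -
  have l: "[g1, g2, g3, g4] \<in> tuples G 4" using g by (simp add: tuples_def)
  have cl: "c [a, b, d] \<in> carrier M" if "a \<in> carrier G" "b \<in> carrier G" "d \<in> carrier G" for a b d
    using cochain_closed[OF c] that by (simp add: tuples_def)
  have s: "{1..3::nat} = {1, 2, 3}" by auto
  have m: "merge G 1 [g1, g2, g3, g4] = [g1 \<otimes>\<^bsub>G\<^esub> g2, g3, g4]"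
      "merge G 2 [g1, g2, g3, g4] = [g1, g2 \<otimes>\<^bsub>G\<^esub> g3, g4]"
      "merge G 3 [g1, g2, g3, g4] = [g1, g2, g3 \<otimes>\<^bsub>G\<^esub> g4]"
    by (simp_all add: merge_def eval_nat_numeral)
  show ?thesis
    using l g cl by (simp add: coboundary_def s m M.int_pow_neg M.inv_mult M.m_ac del: One_nat_def)
qed

text \<open>This is the shape of \<open>coboundary_3\<close> when every entry is itself a quotient,
  as for the coboundary of a 2-cochain: the subtracted entries exchange numerator and
  denominator.\<close>

lemma quotient_mult:
  assumes "p1 \<in> carrier M" "p2 \<in> carrier M" "p3 \<in> carrier M" "p4 \<in> carrier M" "p5 \<in> carrier M"
    "n1 \<in> carrier M" "n2 \<in> carrier M" "n3 \<in> carrier M" "n4 \<in> carrier M" "n5 \<in> carrier M"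
  shows "((p1 \<otimes> inv n1) \<otimes> ((p2 \<otimes> inv n2) \<otimes> (p3 \<otimes> inv n3))) \<otimes>
      inv ((p4 \<otimes> inv n4) \<otimes> (p5 \<otimes> inv n5)) =
    (p1 \<otimes> (p2 \<otimes> p3) \<otimes> (n4 \<otimes> n5)) \<otimes> inv (n1 \<otimes> (n2 \<otimes> n3) \<otimes> (p4 \<otimes> p5))"
  using assms by (simp add: M.inv_mult M.m_ac)

text \<open>Once everything is written as one quotient, numerator and denominator have the same ten
  factors: associativity in \<open>G\<close> matches the arguments, and \<open>psi_cmp\<close>
  matches the factor on which \<open>g1\<close> and \<open>g2\<close> both act.\<close>

lemma coboundary_coboundary_2:
  assumes c: "c \<in> carrier (cochains G M 2)"
  shows "coboundary G M \<psi> 3 (coboundary G M \<psi> 2 c) = \<one>\<^bsub>cochains G M 4\<^esub>"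
proof
  fix l
  show "coboundary G M \<psi> 3 (coboundary G M \<psi> 2 c) l = \<one>\<^bsub>cochains G M 4\<^esub> l"
  proof (cases "l \<in> tuples G 4")
    case False
    then show ?thesis by (simp add: coboundary_def cochains_def)
  next
    case True
    then obtain g1 g2 g3 g4 where l: "l = [g1, g2, g3, g4]"
      and g: "g1 \<in> carrier G" "g2 \<in> carrier G" "g3 \<in> carrier G" "g4 \<in> carrier G"
      by (auto simp: tuples_def eval_nat_numeral length_Suc_conv)
    have dc: "coboundary G M \<psi> 2 c \<in> carrier (cochains G M 3)"
      using coboundary_closed[OF c] by (simp add: eval_nat_numeral)
    have cl: "c [a, b] \<in> carrier M" if "a \<in> carrier G" "b \<in> carrier G" for a b
      using cochain_closed[OF c] that by (simp add: tuples_def)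
    let ?P = "\<lambda>a b d. \<psi> a (c [b, d]) \<otimes> c [a, b \<otimes>\<^bsub>G\<^esub> d]"
    let ?N = "\<lambda>a b d. c [a \<otimes>\<^bsub>G\<^esub> b, d] \<otimes> c [a, b]"
    have PN: "?P a b d \<in> carrier M" "?N a b d \<in> carrier M"
      if "a \<in> carrier G" "b \<in> carrier G" "d \<in> carrier G" for a b d
      using that cl by auto
    note two = coboundary_2[OF c]
    have "coboundary G M \<psi> 3 (coboundary G M \<psi> 2 c) l =
      (\<psi> g1 (?P g2 g3 g4) \<otimes> (?P g1 (g2 \<otimes>\<^bsub>G\<^esub> g3) g4 \<otimes> ?P g1 g2 g3) \<otimes>
         (?N (g1 \<otimes>\<^bsub>G\<^esub> g2) g3 g4 \<otimes> ?N g1 g2 (g3 \<otimes>\<^bsub>G\<^esub> g4))) \<otimes>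
      inv (\<psi> g1 (?N g2 g3 g4) \<otimes> (?N g1 (g2 \<otimes>\<^bsub>G\<^esub> g3) g4 \<otimes> ?N g1 g2 g3) \<otimes>
         (?P (g1 \<otimes>\<^bsub>G\<^esub> g2) g3 g4 \<otimes> ?P g1 g2 (g3 \<otimes>\<^bsub>G\<^esub> g4)))"
    proof -
      have psi: "\<psi> g1 (?P g2 g3 g4 \<otimes> inv (?N g2 g3 g4)) = \<psi> g1 (?P g2 g3 g4) \<otimes> inv (\<psi> g1 (?N g2 g3 g4))"
        using psi_mult[of g1 "?P g2 g3 g4" "inv (?N g2 g3 g4)"] psi_inv[of g1 "?N g2 g3 g4"] g PN by simp
      have gg: "g1 \<otimes>\<^bsub>G\<^esub> g2 \<in> carrier G" "g2 \<otimes>\<^bsub>G\<^esub> g3 \<in> carrier G" "g3 \<otimes>\<^bsub>G\<^esub> g4 \<in> carrier G" using g by auto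
      show ?thesis
        unfolding l coboundary_3[OF dc g] two[OF g(2,3,4)] two[OF g(1) gg(2) g(4)] two[OF g(1,2,3)]
          two[OF gg(1) g(3,4)] two[OF g(1,2) gg(3)] psi
        by (intro quotient_mult PN psi_closed g gg)
    qed
    also have "\<psi> g1 (?P g2 g3 g4) \<otimes> (?P g1 (g2 \<otimes>\<^bsub>G\<^esub> g3) g4 \<otimes> ?P g1 g2 g3) \<otimes>
         (?N (g1 \<otimes>\<^bsub>G\<^esub> g2) g3 g4 \<otimes> ?N g1 g2 (g3 \<otimes>\<^bsub>G\<^esub> g4)) =
      \<psi> g1 (?N g2 g3 g4) \<otimes> (?N g1 (g2 \<otimes>\<^bsub>G\<^esub> g3) g4 \<otimes> ?N g1 g2 g3) \<otimes>
         (?P (g1 \<otimes>\<^bsub>G\<^esub> g2) g3 g4 \<otimes> ?P g1 g2 (g3 \<otimes>\<^bsub>G\<^esub> g4))"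
      using g cl by (simp add: psi_mult psi_cmp G.m_assoc M.m_ac)
    finally show ?thesis
      using True g PN by (simp add: cochains_def)
  qed
qed

end

section \<open>Sections over an object as a module, and arrows to the final object\<close>

context equivariant_sheaf
begin

lemma sections_module: "U \<in> Obj C \<Longrightarrow> group_module G (Grp A U) (\<lambda>g. \<phi> g U)"
  using comm[of U] phi_hom phi_cmp G.is_group
  by (simp add: group_module_def group_module_axioms_def)

lemma zero_class_one:
  assumes "X \<in> Obj C"
  shows "zero_class X G A \<phi> (Suc n) \<one>\<^bsub>cochains G (Grp A X) (Suc n)\<^esub>"
proof -
  interpret M: group_module G "Grp A X" "\<lambda>g. \<phi> g X"
    by (rule sections_module[OF assms])
  have "\<one>\<^bsub>cochains G (Grp A X) n\<^esub> \<in> carrier (cochains G (Grp A X) n)"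
    by (auto simp: cochains_def)
  then show ?thesis
    using M.coboundary_class_trivial[of "\<one>\<^bsub>cochains G (Grp A X) n\<^esub>" n]
    by (simp add: M.coboundary_one zero_class_def)
qed

lemma zero_class_coboundary_2:
  assumes "X \<in> Obj C" and c: "c \<in> carrier (cochains G (Grp A X) 2)"
  shows "zero_class X G A \<phi> 3 (coboundary G (Grp A X) (\<lambda>g. \<phi> g X) 2 c)"
proof -
  interpret M: group_module G "Grp A X" "\<lambda>g. \<phi> g X"
    by (rule sections_module[OF assms(1)])
  show ?thesis
    using M.coboundary_class_trivial[OF c] M.coboundary_coboundary_2[OF c] by (simp add: zero_class_def)
qed

lemma to_final_arr:
  assumes "final_object C X" "U \<in> Obj C"
  shows "to_final C X U \<in> Arr C" "Src C (to_final C X U) = U" "Tgt C (to_final C X U) = X"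
proof -
  have "\<exists>!f. f \<in> Hom C U X" using assms by (auto simp: final_object_def)
  from theI'[OF this] have "to_final C X U \<in> Hom C U X" by (simp add: to_final_def)
  then show "to_final C X U \<in> Arr C" "Src C (to_final C X U) = U" "Tgt C (to_final C X U) = X"
    by (auto simp: Hom_def)
qed

lemma to_final_unique:
  assumes "final_object C X" "f \<in> Arr C" "Tgt C f = X"
  shows "f = to_final C X (Src C f)"
proof -
  have "\<exists>!f'. f' \<in> Hom C (Src C f) X" using assms by (auto simp: final_object_def)
  then show ?thesis
    using assms to_final_arr[of X "Src C f"] by (auto simp: Hom_def)
qed

end


section \<open>Torsors induced from the invariants\<close>

lemma (in site) sheaf_morphism_res:
  assumes "sheaf_morphism C F F' \<mu>" "h \<in> Arr C" "x \<in> Sec F (Tgt C h)"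
  shows "Res F' h (\<mu> (Tgt C h) x) = \<mu> (Src C h) (Res F h x)"
proof -
  have "h \<in> Hom C (Src C h) (Tgt C h)" "Src C h \<in> Obj C" "Tgt C h \<in> Obj C"
    using assms by (auto simp: Hom_def)
  then show ?thesis
    using assms unfolding sheaf_morphism_def by metis
qed

locale induced_torsor = equivariant_sheaf C G A \<phi> +
    Tb: torsor C "invariants G A \<phi>" ybar + T: torsor C A y
  for C :: "('o, 'm, 'r) site_scheme"
    and G :: "('g, 'p) monoid_scheme"
    and A :: "('o, 'm, 'a) absheaf"
    and \<phi> :: "'g \<Rightarrow> 'o \<Rightarrow> 'a \<Rightarrow> 'a"
    and ybar :: "('o, 'm, 'a, 'z, 'q) torsor_scheme"
    and y :: "('o, 'm, 'a, 'y, 'v) torsor_scheme"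
    and f :: "'o \<Rightarrow> 'z \<Rightarrow> 'y" +
  assumes f: "torsor_equivariant C (invariants G A \<phi>) incl ybar y f"
begin

lemma f_closed [simp]: "\<lbrakk>U \<in> Obj C; t \<in> Sec ybar U\<rbrakk> \<Longrightarrow> f U t \<in> Sec y U"
  using f by (auto simp: torsor_equivariant_def sheaf_morphism_def)

lemma f_res: "\<lbrakk>h \<in> Arr C; t \<in> Sec ybar (Tgt C h)\<rbrakk> \<Longrightarrow> Res y h (f (Tgt C h) t) = f (Src C h) (Res ybar h t)"
  using f sheaf_morphism_res[of ybar y f] by (simp add: torsor_equivariant_def)

lemma f_act: "\<lbrakk>U \<in> Obj C; c \<in> carrier (Grp (invariants G A \<phi>) U); t \<in> Sec ybar U\<rbrakk>
    \<Longrightarrow> f U (Act ybar U c t) = Act y U c (f U t)"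
  using f by (auto simp: torsor_equivariant_def incl_def)

lemma res_closed' [simp]:
  "\<lbrakk>h \<in> Arr C; t \<in> Sec ybar (Tgt C h)\<rbrakk> \<Longrightarrow> Res ybar h t \<in> Sec ybar (Src C h)"
  "\<lbrakk>h \<in> Arr C; x \<in> Sec y (Tgt C h)\<rbrakk> \<Longrightarrow> Res y h x \<in> Sec y (Src C h)"
  using Tb.res_closed[of h "Src C h" "Tgt C h" t] T.res_closed[of h "Src C h" "Tgt C h" x]
  by (auto simp: Hom_def)

lemma act_cancel:
  assumes "U \<in> Obj C" "x \<in> Sec y U" "a \<in> sec U" "b \<in> sec U"
    "Act y U a x = Act y U b x"
  shows "a = b"
  using T.simply_transitive[OF assms(1,2) T.act_closed[OF assms(1,4,2)]] assms by blast

text \<open>The section \<open>t\<close> trivializes both torsors over \<open>U\<close>, and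
  \<open>a\<close> is the coordinate of \<open>x\<close> in this trivialization.\<close>

definition frame :: "'o \<Rightarrow> 'y \<Rightarrow> 'z \<Rightarrow> 'a \<Rightarrow> bool" where
  "frame U x t a \<longleftrightarrow> U \<in> Obj C \<and> t \<in> Sec ybar U \<and> a \<in> sec U \<and> x = Act y U a (f U t)"

lemma frame_res:
  assumes "frame (Tgt C h) x t a" "h \<in> Arr C"
  shows "frame (Src C h) (Res y h x) (Res ybar h t) (ARes A h a)"
  using assms T.act_res[of h "Src C h" "Tgt C h" a "f (Tgt C h) t"] f_res[of h t]
  by (auto simp: frame_def Hom_def)

lemma frame_phi:
  "\<lbrakk>frame U x t a; g \<in> carrier G\<rbrakk> \<Longrightarrow> frame U (Act y U (\<phi> g U a) (f U t)) t (\<phi> g U a)"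
  by (auto simp: frame_def)

lemma frame_sec: "frame U x t a \<Longrightarrow> x \<in> Sec y U"
  by (auto simp: frame_def intro: T.act_closed)

lemma frame_unique:
  assumes 1: "frame U x t a" and 2: "frame U x t' a'" and g: "g \<in> carrier G"
  shows "Act y U (\<phi> g U a) (f U t) = Act y U (\<phi> g U a') (f U t')"
proof -
  note 1 = 1[unfolded frame_def] and 2 = 2[unfolded frame_def]
  have U: "U \<in> Obj C" using 1 by simp
  interpret M: comm_group "Grp A U" using U by simp
  obtain c where c: "c \<in> carrier (Grp (invariants G A \<phi>) U)" "Act ybar U c t = t'"
    using Tb.simply_transitive[of U t t'] 1 2 by blast
  have cA: "c \<in> sec U" "\<phi> g U c = c" using c g by (auto simp: invariant_iff)
  \<comment> \<open>Changing the base point from \<open>t\<close> to its translate \<open>t'\<close>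
    by \<open>c\<close> multiplies coordinates by \<open>c\<close>. Hence \<open>a\<close> is the
    product of \<open>a'\<close> and \<open>c\<close>, and applying \<open>\<phi> g\<close> leaves
    \<open>c\<close> in place.\<close>
  have act: "Act y U b (f U t') = Act y U (b \<otimes>\<^bsub>Grp A U\<^esub> c) (f U t)" if "b \<in> sec U" for b
    using f_act[OF U c(1), of t] T.act_mult[OF U that cA(1), of "f U t"] c 1 U by simp
  have "a = a' \<otimes>\<^bsub>Grp A U\<^esub> c"
    using act[of a'] 1 2 cA U by (intro act_cancel[of U "f U t"]) auto
  then have "\<phi> g U a = \<phi> g U a' \<otimes>\<^bsub>Grp A U\<^esub> c"
    using phi_mult[OF g U, of a' c] 2 cA by simp
  then show ?thesis
    using act[of "\<phi> g U a'"] 2 g by simp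
qed

lemma local_frame:
  assumes U: "U \<in> Obj C" and x: "x \<in> Sec y U"
  obtains R where "R \<in> Cov C U" "\<And>h. h \<in> R \<Longrightarrow> \<exists>t a. frame (Src C h) (Res y h x) t a"
proof -
  obtain R where R: "R \<in> Cov C U" "\<forall>h \<in> R. Sec ybar (Src C h) \<noteq> {}"
    using Tb.locally_nonempty[OF U] by blast
  have "\<exists>t a. frame (Src C h) (Res y h x) t a" if h: "h \<in> R" for h
  proof -
    have harr: "h \<in> Arr C" "Tgt C h = U" using cov_arr[OF U R(1) h] by auto
    obtain t where t: "t \<in> Sec ybar (Src C h)" using R h by blast
    then show ?thesis
      using T.simply_transitive[of "Src C h" "f (Src C h) t" "Res y h x"] harr x
      unfolding frame_def by (metis f_closed res_closed'(2) src_obj)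
  qed
  then show thesis using that R by blast
qed

text \<open>In a local frame, \<open>x = a f(t)\<close> is moved to \<open>\<phi>\<^sub>g(a) f(t)\<close>.\<close>

definition moved :: "'g \<Rightarrow> 'o \<Rightarrow> 'y \<Rightarrow> 'y \<Rightarrow> bool" where
  "moved g U x x' \<longleftrightarrow> x' \<in> Sec y U \<and> (\<forall>h t a. h \<in> Arr C \<and> Tgt C h = U \<and> frame (Src C h) (Res y h x) t a \<longrightarrow>
     Res y h x' = Act y (Src C h) (\<phi> g (Src C h) a) (f (Src C h) t))"

lemma moved_unique:
  assumes U: "U \<in> Obj C" and x: "x \<in> Sec y U" and "moved g U x x1" "moved g U x x2"
  shows "x1 = x2"
proof -
  obtain R where R: "R \<in> Cov C U" "\<And>h. h \<in> R \<Longrightarrow> \<exists>t a. frame (Src C h) (Res y h x) t a"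
    using local_frame[OF U x] by blast
  have "Res y h x1 = Res y h x2" if "h \<in> R" for h
    using R(2)[OF that] cov_arr[OF U R(1) that] assms(3,4) by (metis moved_def)
  then show ?thesis
    using T.separated[OF site_axioms U R(1)] assms(3,4) by (simp add: moved_def)
qed

lemma moved_exists:
  assumes U: "U \<in> Obj C" and x: "x \<in> Sec y U" and g: "g \<in> carrier G"
  obtains x' where "moved g U x x'"
proof -
  obtain R where R: "R \<in> Cov C U" "\<And>h. h \<in> R \<Longrightarrow> \<exists>t a. frame (Src C h) (Res y h x) t a"
    using local_frame[OF U x] by blast
  then obtain t a where ta: "\<And>h. h \<in> R \<Longrightarrow> frame (Src C h) (Res y h x) (t h) (a h)"
    by metis
  have Rarr: "h \<in> Arr C" "Tgt C h = U" if "h \<in> R" for h using cov_arr[OF U R(1) that] by auto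
  define s where "s h = Act y (Src C h) (\<phi> g (Src C h) (a h)) (f (Src C h) (t h))" for h
  have res_frame: "frame (Src C p) (Res y (h \<cdot>\<^bsub>C\<^esub> p) x) (Res ybar p (t h)) (ARes A p (a h))"
    if "h \<in> R" "p \<in> Arr C" "Tgt C p = Src C h" for h p
    using frame_res[of p "Res y h x" "t h" "a h"] ta[OF that(1)] Rarr[OF that(1)] that(2,3)
      T.res_cmp[of h "Src C h" U p "Src C p" x] x by (simp add: Hom_def)
  have res_s: "Res y p (s h) = Act y (Src C p) (\<phi> g (Src C p) (ARes A p (a h))) (f (Src C p) (Res ybar p (t h)))"
    if "h \<in> R" "p \<in> Arr C" "Tgt C p = Src C h" for h p
    using frame_res[of p "s h" "t h" "\<phi> g (Src C h) (a h)"] frame_phi[OF ta[OF that(1)] g] that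
      phi_ares[OF g that(2) refl that(3), of "a h"] ta[OF that(1)]
    by (simp add: s_def frame_def)
  have "\<exists>!x'. x' \<in> Sec y U \<and> (\<forall>h \<in> R. Res y h x' = s h)"
  proof (rule T.glue[OF U R(1)])
    fix h assume "h \<in> R"
    then show "s h \<in> Sec y (Src C h)"
      using frame_sec[OF frame_phi[OF ta g]] by (simp add: s_def)
  next
    fix h h' W p p'
    assume h: "h \<in> R" "h' \<in> R" and "p \<in> Hom C W (Src C h)" "p' \<in> Hom C W (Src C h')" and eq: "h \<cdot>\<^bsub>C\<^esub> p = h' \<cdot>\<^bsub>C\<^esub> p'"
    then have p: "p \<in> Arr C" "Tgt C p = Src C h" "Src C p = W" "p' \<in> Arr C" "Tgt C p' = Src C h'" "Src C p' = W"
      by (auto simp: Hom_def)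
    show "Res y p (s h) = Res y p' (s h')"
      using frame_unique[OF res_frame[OF h(1) p(1,2), unfolded p(3)] res_frame[OF h(2) p(4,5), folded eq, unfolded p(6)] g]
        res_s[OF h(1) p(1,2)] res_s[OF h(2) p(4,5)] p by simp
  qed
  then obtain x' where x': "x' \<in> Sec y U" "\<And>h. h \<in> R \<Longrightarrow> Res y h x' = s h" by blast
  have "moved g U x x'"
    unfolding moved_def
  proof (intro conjI allI impI)
    fix q t0 a0 assume *: "q \<in> Arr C \<and> Tgt C q = U \<and> frame (Src C q) (Res y q x) t0 a0"
    then have q: "q \<in> Hom C (Src C q) U" and V: "Src C q \<in> Obj C" by (auto simp: Hom_def)
    \<comment> \<open>The arrow \<open>q\<close> need not factor through the cover used for gluing.
      The formula is checked on a cover of its source whose composites with \<open>q\<close> do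
      factor.\<close>
    obtain T where T: "T \<in> Cov C (Src C q)"
      "\<forall>k \<in> T. \<exists>h \<in> R. \<exists>l \<in> Hom C (Src C k) (Src C h). q \<cdot>\<^bsub>C\<^esub> k = h \<cdot>\<^bsub>C\<^esub> l"
      using cov_stable[OF R(1) q] by blast
    note fr = frame_phi[of "Src C q" "Res y q x" t0 a0 g]
    show "Res y q x' = Act y (Src C q) (\<phi> g (Src C q) a0) (f (Src C q) t0)"
    proof (rule T.separated[OF site_axioms V T(1)])
      fix k assume k: "k \<in> T"
      then obtain h l where h: "h \<in> R" and l: "l \<in> Arr C" "Src C l = Src C k" "Tgt C l = Src C h"
          and eq: "q \<cdot>\<^bsub>C\<^esub> k = h \<cdot>\<^bsub>C\<^esub> l" using T by (auto simp: Hom_def)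
      have karr: "k \<in> Arr C" "Tgt C k = Src C q" using cov_arr[OF V T(1) k] by auto
      have "Res y k (Res y q x') = Res y (h \<cdot>\<^bsub>C\<^esub> l) x'"
        using T.res_cmp[OF q, of k "Src C k" x'] karr x' eq by (simp add: Hom_def)
      also have "\<dots> = Res y l (s h)"
        using T.res_cmp[of h "Src C h" U l "Src C l" x'] Rarr[OF h] l x' h by (simp add: Hom_def)
      finally have 1: "Res y k (Res y q x') = Res y l (s h)" .
      have fk: "frame (Src C k) (Res y (h \<cdot>\<^bsub>C\<^esub> l) x) (Res ybar k t0) (ARes A k a0)"
        using frame_res[of k "Res y q x" t0 a0] * karr T.res_cmp[OF q, of k "Src C k" x] x eq by (simp add: Hom_def)
      have "Res y k (Act y (Src C q) (\<phi> g (Src C q) a0) (f (Src C q) t0)) =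
          Act y (Src C k) (\<phi> g (Src C k) (ARes A k a0)) (f (Src C k) (Res ybar k t0))"
        using frame_res[of k _ t0 "\<phi> g (Src C q) a0"] fr * g karr
          phi_ares[OF g karr(1) refl karr(2), of a0] by (simp add: frame_def)
      then show "Res y k (Res y q x') = Res y k (Act y (Src C q) (\<phi> g (Src C q) a0) (f (Src C q) t0))"
        using 1 res_s[OF h l(1,3)] frame_unique[OF fk res_frame[OF h l(1,3), unfolded l(2)] g] l by simp
    qed (use * x' g frame_sec[OF fr] in auto)
  qed (rule x'(1))
  then show thesis by (rule that)
qed

section \<open>The action on a torsor and its algebraic laws\<close>

definition lift :: "'g \<Rightarrow> 'o \<Rightarrow> 'y \<Rightarrow> 'y" where
  "lift g U x = (THE x'. moved g U x x')"

lemma lift_moved: "\<lbrakk>U \<in> Obj C; x \<in> Sec y U; g \<in> carrier G\<rbrakk> \<Longrightarrow> moved g U x (lift g U x)"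
  unfolding lift_def by (rule theI') (use moved_exists moved_unique in metis)

text \<open>The group law, restriction, equivariance and uniqueness all come from this rule, by
  exhibiting a section with the property \<open>moved\<close>.\<close>

lemma lift_eqI: "\<lbrakk>U \<in> Obj C; x \<in> Sec y U; g \<in> carrier G; moved g U x x'\<rbrakk> \<Longrightarrow> lift g U x = x'"
  using lift_moved moved_unique by metis

lemma lift_closed [simp]: "\<lbrakk>U \<in> Obj C; x \<in> Sec y U; g \<in> carrier G\<rbrakk> \<Longrightarrow> lift g U x \<in> Sec y U"
  using lift_moved by (simp add: moved_def)

lemma lift_frame:
  assumes "h \<in> Arr C" "x \<in> Sec y (Tgt C h)" "g \<in> carrier G" "frame (Src C h) (Res y h x) t a"
  shows "Res y h (lift g (Tgt C h) x) = Act y (Src C h) (\<phi> g (Src C h) a) (f (Src C h) t)"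
  using lift_moved[of "Tgt C h" x g] assms by (simp add: moved_def)

lemma lift_comp:
  assumes U: "U \<in> Obj C" and x: "x \<in> Sec y U" and g: "g \<in> carrier G" "h \<in> carrier G"
  shows "lift (g \<otimes>\<^bsub>G\<^esub> h) U x = lift g U (lift h U x)"
proof (rule lift_eqI[OF U x])
  show "moved (g \<otimes>\<^bsub>G\<^esub> h) U x (lift g U (lift h U x))"
    unfolding moved_def
  proof (intro conjI allI impI)
    fix k t a assume *: "k \<in> Arr C \<and> Tgt C k = U \<and> frame (Src C k) (Res y k x) t a"
    then have fr: "frame (Src C k) (Res y k (lift h U x)) t (\<phi> h (Src C k) a)"
      using lift_frame[of k x h t a] frame_phi[of "Src C k" "Res y k x" t a h] x g by auto
    show "Res y k (lift g U (lift h U x)) = Act y (Src C k) (\<phi> (g \<otimes>\<^bsub>G\<^esub> h) (Src C k) a) (f (Src C k) t)"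
      using lift_frame[of k "lift h U x" g t "\<phi> h (Src C k) a"] fr * U x g
      by (auto simp: phi_cmp frame_def)
  qed (use U x g in auto)
qed (use g in auto)

lemma lift_one:
  assumes U: "U \<in> Obj C" and x: "x \<in> Sec y U"
  shows "lift \<one>\<^bsub>G\<^esub> U x = x"
  by (rule lift_eqI[OF U x]) (use x in \<open>auto simp: moved_def frame_def\<close>)

lemma lift_res:
  assumes k: "k \<in> Arr C" and x: "x \<in> Sec y (Tgt C k)" and g: "g \<in> carrier G"
  shows "lift g (Src C k) (Res y k x) = Res y k (lift g (Tgt C k) x)"
proof (rule lift_eqI)
  show "moved g (Src C k) (Res y k x) (Res y k (lift g (Tgt C k) x))"
    unfolding moved_def
  proof (intro conjI allI impI)
    fix h t a assume *: "h \<in> Arr C \<and> Tgt C h = Src C k \<and> frame (Src C h) (Res y h (Res y k x)) t a"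
    have cmp: "Res y h (Res y k w) = Res y (k \<cdot>\<^bsub>C\<^esub> h) w" if "w \<in> Sec y (Tgt C k)" for w
      using T.res_cmp[of k "Src C k" "Tgt C k" h "Src C h" w] k * that by (simp add: Hom_def)
    show "Res y h (Res y k (lift g (Tgt C k) x)) = Act y (Src C h) (\<phi> g (Src C h) a) (f (Src C h) t)"
      using lift_frame[of "k \<cdot>\<^bsub>C\<^esub> h" x g t a] * k x g cmp[OF x] cmp[of "lift g (Tgt C k) x"] by auto
  qed (use k x g in auto)
qed (use k x g in auto)

lemma lift_act:
  assumes U: "U \<in> Obj C" and x: "x \<in> Sec y U" and g: "g \<in> carrier G" and b: "b \<in> sec U"
  shows "lift g U (Act y U b x) = Act y U (\<phi> g U b) (lift g U x)"
proof (rule lift_eqI[OF U _ g])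
  show bx: "Act y U b x \<in> Sec y U" by (rule T.act_closed[OF U b x])
  have pb: "\<phi> g U b \<in> sec U" using b U g by simp
  show "moved g U (Act y U b x) (Act y U (\<phi> g U b) (lift g U x))"
    unfolding moved_def
  proof (intro conjI allI impI)
    show "Act y U (\<phi> g U b) (lift g U x) \<in> Sec y U"
      using T.act_closed[OF U pb] U x g by simp
    fix h t a assume "h \<in> Arr C \<and> Tgt C h = U \<and> frame (Src C h) (Res y h (Act y U b x)) t a"
    then have h: "h \<in> Arr C" "Tgt C h = U" and fr: "frame (Src C h) (Res y h (Act y U b x)) t a" by auto
    let ?V = "Src C h" and ?b = "ARes A h b"
    note fr' = fr[unfolded frame_def]
    have V: "?V \<in> Obj C" and bV: "?b \<in> sec ?V" using h b by auto
    interpret M: comm_group "Grp A ?V" using V by simp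
    have xV: "Res y h x \<in> Sec y ?V" using h x by simp
    have ft: "f ?V t \<in> Sec y ?V" using fr' by simp
    have res: "Res y h (Act y U c z) = Act y ?V (ARes A h c) (Res y h z)"
      if "c \<in> sec U" "z \<in> Sec y U" for c z
      using T.act_res[of h ?V U c z] h that by (simp add: Hom_def)
    \<comment> \<open>If the translate of \<open>x\<close> by \<open>b\<close> has coordinate
      \<open>a\<close>, then \<open>x\<close> has this coordinate in the same frame.\<close>
    let ?a = "inv\<^bsub>Grp A ?V\<^esub> ?b \<otimes>\<^bsub>Grp A ?V\<^esub> a"
    have a: "?a \<in> sec ?V" using bV fr' by simp
    have "Act y ?V ?a (f ?V t) = Act y ?V (inv\<^bsub>Grp A ?V\<^esub> ?b) (Act y ?V ?b (Res y h x))"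
      using T.act_mult[OF V _ _ ft, of "inv\<^bsub>Grp A ?V\<^esub> ?b" a] bV fr' res[OF b x] by simp
    also have "\<dots> = Res y h x"
      using T.act_mult[OF V _ bV xV, of "inv\<^bsub>Grp A ?V\<^esub> ?b"] bV T.act_one[OF V xV] by simp
    finally have "frame ?V (Res y h x) t ?a"
      using fr' a by (simp add: frame_def)
    then have "Res y h (lift g U x) = Act y ?V (\<phi> g ?V ?a) (f ?V t)"
      using lift_frame[of h x g t ?a] h x g by simp
    then have "Res y h (Act y U (\<phi> g U b) (lift g U x)) = Act y ?V (\<phi> g ?V ?b \<otimes>\<^bsub>Grp A ?V\<^esub> \<phi> g ?V ?a) (f ?V t)"
      using res[OF pb, of "lift g U x"] phi_ares[OF g h(1) refl h(2) b] U x g bV a V ft phi_closed[OF g V bV]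
        T.act_mult[OF V _ _ ft, of "\<phi> g ?V ?b" "\<phi> g ?V ?a"] by simp
    also have "\<phi> g ?V ?b \<otimes>\<^bsub>Grp A ?V\<^esub> \<phi> g ?V ?a = \<phi> g ?V (?b \<otimes>\<^bsub>Grp A ?V\<^esub> ?a)"
      using phi_mult[OF g V bV a] by simp
    also have "?b \<otimes>\<^bsub>Grp A ?V\<^esub> ?a = a"
      using bV fr' by (simp add: M.m_assoc[symmetric])
    finally show "Res y h (Act y U (\<phi> g U b) (lift g U x)) = Act y ?V (\<phi> g ?V a) (f ?V t)" .
  qed
qed

lemma frame_base: "\<lbrakk>U \<in> Obj C; t \<in> Sec ybar U\<rbrakk> \<Longrightarrow> frame U (f U t) t \<one>\<^bsub>Grp A U\<^esub>"
  using T.act_one[of U "f U t"] monoid.one_closed[OF mon] by (simp add: frame_def)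

text \<open>In the frame given by \<open>t\<close> the coordinate of \<open>f U t\<close> is the
  unit, which \<open>\<phi> g\<close> fixes; \<open>frame_unique\<close> transfers this to all other
  frames.\<close>

lemma lift_base:
  assumes U: "U \<in> Obj C" and t: "t \<in> Sec ybar U" and g: "g \<in> carrier G"
  shows "lift g U (f U t) = f U t"
proof (rule lift_eqI[OF U _ g])
  show "moved g U (f U t) (f U t)"
    unfolding moved_def
  proof (intro conjI allI impI)
    fix h t' a assume *: "h \<in> Arr C \<and> Tgt C h = U \<and> frame (Src C h) (Res y h (f U t)) t' a"
    then have V: "Src C h \<in> Obj C" and t2: "Res ybar h t \<in> Sec ybar (Src C h)" using t by auto
    interpret M: comm_group "Grp A (Src C h)" using V by simp
    have "frame (Src C h) (Res y h (f U t)) (Res ybar h t) \<one>\<^bsub>Grp A (Src C h)\<^esub>"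
      using frame_base[OF V t2] f_res[of h t] * t by auto
    from frame_unique[OF this _ g, of t' a] show "Res y h (f U t) = Act y (Src C h) (\<phi> g (Src C h) a) (f (Src C h) t')"
      using * hom_one[OF phi_hom[OF g V]] V t t2 f_res[of h t] T.act_one[OF V, of "f (Src C h) (Res ybar h t)"] by auto
  qed (use U t in auto)
qed (use U t in auto)

lemma compatible_torsor_lift_lift: "compatible_torsor_lift C G A \<phi> ybar y f lift"
proof -
  have morph: "sheaf_morphism C y y (lift g)" if "g \<in> carrier G" for g
    using that lift_res by (auto simp: sheaf_morphism_def Hom_def)
  have inv: "lift (inv\<^bsub>G\<^esub> g) U (lift g U x) = x" "lift g U (lift (inv\<^bsub>G\<^esub> g) U x) = x"
    if "g \<in> carrier G" "U \<in> Obj C" "x \<in> Sec y U" for g U x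
    using lift_comp[of U x "inv\<^bsub>G\<^esub> g" g] lift_comp[of U x g "inv\<^bsub>G\<^esub> g"] lift_one that by simp_all
  have bij: "bij_betw (lift g U) (Sec y U) (Sec y U)" if "g \<in> carrier G" "U \<in> Obj C" for g U
    by (rule bij_betw_byWitness[where f' = "lift (inv\<^bsub>G\<^esub> g) U"]) (use that inv in auto)
  show ?thesis
    using morph bij lift_act lift_base
    by (auto simp: compatible_torsor_lift_def torsor_automorphism_def torsor_lift_def torsor_equivariant_def)
qed

text \<open>Equivariance and fixing the image of \<open>f\<close> imply the property
  \<open>moved\<close>. An arbitrary compatible lift thus inherits the group law of
  \<open>lift\<close>.\<close>

lemma compatible_torsor_lift_eq_lift:
  assumes L: "compatible_torsor_lift C G A \<phi> ybar y f lam" and g: "g \<in> carrier G"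
    and U: "U \<in> Obj C" and x: "x \<in> Sec y U"
  shows "lam g U x = lift g U x"
proof (rule lift_eqI[OF U x g, symmetric])
  have eq: "torsor_equivariant C A (\<phi> g) y y (lam g)"
    and fixed: "\<And>U t. \<lbrakk>U \<in> Obj C; t \<in> Sec ybar U\<rbrakk> \<Longrightarrow> lam g U (f U t) = f U t"
    using L g by (auto simp: compatible_torsor_lift_def torsor_lift_def)
  have "Res y h (lam g U x) = lam g (Src C h) (Res y h x)" if "h \<in> Arr C" "Tgt C h = U" for h
    using eq that x sheaf_morphism_res[of y y "lam g" h x] by (auto simp: torsor_equivariant_def)
  then show "moved g U x (lam g U x)"
    using eq fixed U x by (auto simp: moved_def frame_def torsor_equivariant_def sheaf_morphism_def)
qed

lemma compatible_torsor_lift_unique: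
  assumes "compatible_torsor_lift C G A \<phi> ybar y f lam" "compatible_torsor_lift C G A \<phi> ybar y f lam'"
    and "g \<in> carrier G" "U \<in> Obj C" "x \<in> Sec y U"
  shows "lam g U x = lam' g U x"
  using compatible_torsor_lift_eq_lift[OF assms(1,3-)] compatible_torsor_lift_eq_lift[OF assms(2-)] by simp

text \<open>The group law makes the unit a solution. The definite description also needs uniqueness:
  as \<open>y\<close> may have no section over \<open>X\<close>, this is tested on a cover where it
  has sections and \<open>A\<close> acts freely on them.\<close>

lemma torsor_cochain_trivial:
  assumes X: "final_object C X" and L: "compatible_torsor_lift C G A \<phi> ybar y f lam"
  shows "torsor_cochain C X G A y lam = \<one>\<^bsub>cochains G (Grp A X) 2\<^esub>"
proof -
  have XC: "X \<in> Obj C" using X by (simp add: final_object_def)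
  interpret M: comm_group "Grp A X" using XC by simp
  note fin = to_final_arr[OF X]
  have one: "ARes A (to_final C X U) \<one>\<^bsub>Grp A X\<^esub> = \<one>\<^bsub>Grp A U\<^esub>" if "U \<in> Obj C" for U
    using hom_one[OF ares_hom[OF fin[OF that]]] that XC by simp
  have "(THE a. a \<in> sec X \<and> (\<forall>U \<in> Obj C. \<forall>x \<in> Sec y U.
           lam (l ! 0) U (lam (l ! 1) U x) = Act y U (ARes A (to_final C X U) a) (lam (l ! 0 \<otimes>\<^bsub>G\<^esub> l ! 1) U x))) =
      \<one>\<^bsub>Grp A X\<^esub>" (is "(THE a. ?P a) = _") if l: "l \<in> tuples G 2" for l
  proof (rule the_equality)
    have g: "l ! 0 \<in> carrier G" "l ! 1 \<in> carrier G"
      using l nth_mem[of 0 l] nth_mem[of 1 l] by (auto simp: tuples_def)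
    have lam: "lam (l ! 0) U (lam (l ! 1) U x) = lam (l ! 0 \<otimes>\<^bsub>G\<^esub> l ! 1) U x"
      "lam (l ! 0 \<otimes>\<^bsub>G\<^esub> l ! 1) U x \<in> Sec y U"
      if "U \<in> Obj C" "x \<in> Sec y U" for U x
      using compatible_torsor_lift_eq_lift[OF L _ that(1)] lift_comp[OF that g] g that by simp_all
    show "?P \<one>\<^bsub>Grp A X\<^esub>"
      using lam T.act_one one by simp
    fix a assume a: "?P a"
    obtain R where R: "R \<in> Cov C X" "\<forall>h \<in> R. Sec y (Src C h) \<noteq> {}"
      using T.locally_nonempty[OF XC] by blast
    show "a = \<one>\<^bsub>Grp A X\<^esub>"
    proof (rule ares_separated[OF XC R(1)])
      fix h assume h: "h \<in> R"
      have harr: "h \<in> Arr C" "Tgt C h = X" using cov_arr[OF XC R(1) h] by auto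
      have V: "Src C h \<in> Obj C" using harr by simp
      have hf: "to_final C X (Src C h) = h" using to_final_unique[OF X harr] by simp
      obtain x where x: "x \<in> Sec y (Src C h)" using R h by blast
      let ?x = "lam (l ! 0 \<otimes>\<^bsub>G\<^esub> l ! 1) (Src C h) x"
      show "ARes A h a = ARes A h \<one>\<^bsub>Grp A X\<^esub>"
      proof (rule act_cancel[OF V lam(2)[OF V x]])
        show "Act y (Src C h) (ARes A h a) ?x = Act y (Src C h) (ARes A h \<one>\<^bsub>Grp A X\<^esub>) ?x"
          using a V x lam[OF V x] hf one[OF V] T.act_one[OF V lam(2)[OF V x]] by simp
      qed (use a harr in auto)
    qed (use a in auto)
  qed
  then show ?thesis
    by (auto simp: torsor_cochain_def cochains_def intro!: restrict_ext)
qed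

end

section \<open>Banded gerbes\<close>

lemma gerbe_morphism_simps:
  assumes "gerbe_morphism Y\<^sub>1 Y\<^sub>2 F"
  shows "x \<in> Obj Y\<^sub>1 \<Longrightarrow> FOb F x \<in> Obj Y\<^sub>2"
    and "x \<in> Obj Y\<^sub>1 \<Longrightarrow> POb Y\<^sub>2 (FOb F x) = POb Y\<^sub>1 x"
    and "u \<in> Arr Y\<^sub>1 \<Longrightarrow> FAr F u \<in> Arr Y\<^sub>2"
    and "u \<in> Arr Y\<^sub>1 \<Longrightarrow> Src Y\<^sub>2 (FAr F u) = FOb F (Src Y\<^sub>1 u)"
    and "u \<in> Arr Y\<^sub>1 \<Longrightarrow> Tgt Y\<^sub>2 (FAr F u) = FOb F (Tgt Y\<^sub>1 u)"
    and "u \<in> Arr Y\<^sub>1 \<Longrightarrow> PAr Y\<^sub>2 (FAr F u) = PAr Y\<^sub>1 u"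
    and "x \<in> Obj Y\<^sub>1 \<Longrightarrow> FAr F (Idn Y\<^sub>1 x) = Idn Y\<^sub>2 (FOb F x)"
    and "\<lbrakk>u \<in> Arr Y\<^sub>1; v \<in> Arr Y\<^sub>1; Tgt Y\<^sub>1 v = Src Y\<^sub>1 u\<rbrakk>
           \<Longrightarrow> FAr F (u \<cdot>\<^bsub>Y\<^sub>1\<^esub> v) = FAr F u \<cdot>\<^bsub>Y\<^sub>2\<^esub> FAr F v"
  using assms by (auto simp: gerbe_morphism_def Hom_over_def Hom_def)

locale gerbe_on_site = stack_on_site C Y + banded_gerbe C A Y
  for C :: "('o, 'm, 'r) site_scheme"
    and A :: "('o, 'm, 'a) absheaf"
    and Y :: "('e, 't, 'o, 'm, 'a, 's) gerbe_scheme" (structure)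
begin

lemma band_arr:
  assumes "x \<in> Obj Y" "a \<in> carrier (Grp A (POb Y x))"
  shows "Band Y x a \<in> Arr Y" "Src Y (Band Y x a) = x" "Tgt Y (Band Y x a) = x"
    "PAr Y (Band Y x a) = Idn C (POb Y x)"
proof -
  have "Band Y x a \<in> Hom_over Y (Idn C (POb Y x)) x x"
    using band_iso[of x] assms by (auto simp: iso_def bij_betw_def Aut_group_def)
  then show "Band Y x a \<in> Arr Y" "Src Y (Band Y x a) = x" "Tgt Y (Band Y x a) = x"
    "PAr Y (Band Y x a) = Idn C (POb Y x)"
    by (auto simp: Hom_over_def Hom_def)
qed

lemma band_mult:
  assumes "x \<in> Obj Y" "a \<in> carrier (Grp A (POb Y x))" "b \<in> carrier (Grp A (POb Y x))"
  shows "Band Y x (a \<otimes>\<^bsub>Grp A (POb Y x)\<^esub> b) = Band Y x a \<cdot> Band Y x b"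
  using band_iso[of x] assms by (auto simp: iso_def hom_def Aut_group_def)

lemma band_inj:
  assumes "x \<in> Obj Y" "a \<in> carrier (Grp A (POb Y x))" "b \<in> carrier (Grp A (POb Y x))"
    "Band Y x a = Band Y x b"
  shows "a = b"
  using band_iso[of x] assms by (auto simp: iso_def bij_betw_def dest: inj_onD)

lemma band_surj:
  assumes "l \<in> Arr Y" "Src Y l = x" "Tgt Y l = x" "PAr Y l = Idn C (POb Y x)"
  obtains a where "a \<in> carrier (Grp A (POb Y x))" "l = Band Y x a"
proof -
  have "x \<in> Obj Y" using assms by auto
  then have "l \<in> Band Y x ` carrier (Grp A (POb Y x))"
    using band_iso[of x] assms by (auto simp: iso_def bij_betw_def Aut_group_def Hom_over_def Hom_def)
  then show thesis using that by auto
qed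

lemma band_slide:
  assumes "u \<in> Arr Y" "Tgt Y u = x" "Src Y u = z" "a \<in> carrier (Grp A (POb Y x))"
  shows "Band Y x a \<cdot> u = u \<cdot> Band Y z (ARes A (PAr Y u) a)"
  using band_natural[of u z x a] assms by (simp add: Hom_def)

text \<open>Since \<open>u\<close> is cartesian, parallel arrows with equal projections differ by a
  vertical endomorphism of the source, which the band identifies with a section.\<close>

lemma band_torsor:
  assumes "u \<in> Arr Y" "v \<in> Arr Y" "Src Y u = Src Y v" "Tgt Y u = Tgt Y v" "PAr Y u = PAr Y v"
  obtains a where "a \<in> carrier (Grp A (POb Y (Src Y u)))" "v = u \<cdot> Band Y (Src Y u) a"
proof -
  obtain l where l: "l \<in> Arr Y" "Src Y l = Src Y u" "Tgt Y l = Src Y u"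
      "PAr Y l = Idn C (POb Y (Src Y u))" "u \<cdot> l = v"
    using factor[of u v "Idn C (POb Y (Src Y u))"] assms by auto
  then show thesis
    using band_surj[OF l(1-4)] that by metis
qed

lemma band_cancel:
  assumes "u \<cdot> Band Y x a = u \<cdot> Band Y x b" "u \<in> Arr Y" "Src Y u = x"
    "a \<in> carrier (Grp A (POb Y x))" "b \<in> carrier (Grp A (POb Y x))"
  shows "a = b"
proof (rule band_inj[of x])
  show "Band Y x a = Band Y x b"
    using assms band_arr[of x a] band_arr[of x b] by (intro cancel[OF assms(1)]) auto
qed (use assms in auto)

text \<open>The image of the unit is idempotent and can be cancelled. This locale does not provide
  that \<open>A\<close> is an abelian sheaf, which is why the group property is an explicit
  hypothesis here and triviality of the identity restriction is one in
  \<open>band_vertical\<close>.\<close>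

lemma band_one:
  assumes x: "x \<in> Obj Y" and A: "comm_group (Grp A (POb Y x))"
  shows "Band Y x \<one>\<^bsub>Grp A (POb Y x)\<^esub> = Idn Y x"
proof -
  interpret A: comm_group "Grp A (POb Y x)" by fact
  note b = band_arr[OF x A.one_closed]
  have "Band Y x \<one>\<^bsub>Grp A (POb Y x)\<^esub> \<cdot> Band Y x \<one>\<^bsub>Grp A (POb Y x)\<^esub> =
      Band Y x \<one>\<^bsub>Grp A (POb Y x)\<^esub> \<cdot> Idn Y x"
    using band_mult[OF x A.one_closed A.one_closed] b by simp
  then show ?thesis
    by (rule cancel) (use b x in auto)
qed

lemma band_vertical:
  assumes "u \<in> Arr Y" "Src Y u = x" "Tgt Y u = x'" "PAr Y u = Idn C (POb Y x)" "POb Y x' = POb Y x"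
    and "a \<in> carrier (Grp A (POb Y x))" and "ARes A (Idn C (POb Y x)) a = a"
  shows "Band Y x' a \<cdot> u = u \<cdot> Band Y x a"
  using band_slide[of u x' x a] assms by simp

end

text \<open>The local isomorphism between the two pullbacks is absorbed into one leg, so that both
  legs start at the same object.\<close>

lemma (in abelian_gerbe) local_span:
  assumes x: "x \<in> Obj Y" "x' \<in> Obj Y" "POb Y x' = POb Y x"
  obtains R where "R \<in> Cov C (POb Y x)" "\<And>h. h \<in> R \<Longrightarrow>
    \<exists>u v. u \<in> Arr Y \<and> Tgt Y u = x \<and> PAr Y u = h \<and> v \<in> Arr Y \<and> Src Y v = Src Y u \<and> Tgt Y v = x' \<and> PAr Y v = h"
proof -
  obtain R where R: "R \<in> Cov C (POb Y x)" and *: "\<forall>h \<in> R. \<exists>a b.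
             Hom_over Y h a x \<noteq> {} \<and> Hom_over Y h b x' \<noteq> {} \<and>
             (\<exists>w \<in> Hom_over Y (Idn C (Src C h)) a b. Defs.is_iso Y w)"
    using locally_isomorphic[OF x] by blast
  have "\<exists>u v. u \<in> Arr Y \<and> Tgt Y u = x \<and> PAr Y u = h \<and> v \<in> Arr Y \<and> Src Y v = Src Y u \<and> Tgt Y v = x' \<and> PAr Y v = h"
    if h: "h \<in> R" for h
  proof -
    obtain a b u v w where u: "u \<in> Arr Y" "Src Y u = a" "Tgt Y u = x" "PAr Y u = h"
      and v: "v \<in> Arr Y" "Src Y v = b" "Tgt Y v = x'" "PAr Y v = h"
      and w: "w \<in> Arr Y" "Src Y w = a" "Tgt Y w = b" "PAr Y w = Idn C (Src C h)"
      using * h by (fastforce simp: Hom_over_def Hom_def)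
    moreover have "h \<in> Arr C" using par_arr[OF u(1)] u by simp
    ultimately show ?thesis
      by (intro exI[of _ u] exI[of _ "v \<cdot>\<^bsub>Y\<^esub> w"]) auto
  qed
  with R show thesis using that by blast
qed

section \<open>Presenting objects and arrows of the gerbe through \<Theta>\<close>

locale induced_gerbe = equivariant_sheaf C G A \<phi> +
    Yb: gerbe_on_site C "invariants G A \<phi>" Ybar + Y: gerbe_on_site C A Y
  for C :: "('o, 'm, 'r) site_scheme"
    and G :: "('g, 'p) monoid_scheme"
    and A :: "('o, 'm, 'a) absheaf"
    and \<phi> :: "'g \<Rightarrow> 'o \<Rightarrow> 'a \<Rightarrow> 'a"
    and Ybar :: "('d, 's, 'o, 'm, 'a, 'q) gerbe_scheme"
    and Y :: "('e, 't, 'o, 'm, 'a, 'v) gerbe_scheme" (structure)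
    and \<Theta> :: "('d, 's, 'e, 't) fctr" +
  assumes theta: "gerbe_equivariant (invariants G A \<phi>) incl Ybar Y \<Theta>"
begin

abbreviation band :: "'d \<Rightarrow> 'a \<Rightarrow> 't" where
  "band z \<equiv> Band Y (FOb \<Theta> z)"

lemma theta_morphism: "gerbe_morphism Ybar Y \<Theta>"
  using theta by (simp add: gerbe_equivariant_def)

lemmas theta_simps [simp] = gerbe_morphism_simps[OF theta_morphism]

lemma theta_band:
  assumes "z \<in> Obj Ybar" "c \<in> carrier (Grp (invariants G A \<phi>) (POb Ybar z))"
  shows "FAr \<Theta> (Band Ybar z c) = band z c"
  using theta assms by (simp add: gerbe_equivariant_def incl_def)

text \<open>All arrows being cartesian, a probe identifies \<open>\<Theta> z\<close> with a pullback
  of \<open>x\<close>. The object \<open>z\<close> is part of the data because it cannot be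
  recovered from \<open>FOb \<Theta> z\<close>.\<close>

definition probe :: "'d \<Rightarrow> 't \<Rightarrow> 'e \<Rightarrow> bool" where
  "probe z p x \<longleftrightarrow> z \<in> Obj Ybar \<and> p \<in> Arr Y \<and> Src Y p = FOb \<Theta> z \<and> Tgt Y p = x"

text \<open>Two refinements are composed by \<open>cov_trans\<close>: over the first,
  \<open>Ybar\<close> has objects; over the second, \<open>\<Theta> z\<close> and the pullback of
  \<open>x\<close> become isomorphic.\<close>

lemma local_probe:
  assumes x: "x \<in> Obj Y"
  obtains R where "R \<in> Cov C (POb Y x)" "\<And>h. h \<in> R \<Longrightarrow> \<exists>z p. probe z p x \<and> PAr Y p = h"
proof -
  let ?U = "POb Y x"
  have U: "?U \<in> Obj C" using x by simp
  obtain R where R: "R \<in> Cov C ?U" and z: "\<forall>f \<in> R. \<exists>z \<in> Obj Ybar. POb Ybar z = Src C f"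
    using Yb.locally_nonempty[OF U] by auto
  define P where "P f h \<longleftrightarrow> (\<exists>z p. probe z p x \<and> PAr Y p = f \<cdot>\<^bsub>C\<^esub> h)" for f h
  have "\<forall>f \<in> R. \<exists>T. T \<in> Cov C (Src C f) \<and> (\<forall>h \<in> T. P f h)"
  proof
    fix f assume f: "f \<in> R"
    note farr = cov_arr[OF U R f]
    obtain z where z: "z \<in> Obj Ybar" "POb Ybar z = Src C f" using z f by auto
    obtain q where q: "q \<in> Arr Y" "Tgt Y q = x" "PAr Y q = f" "POb Y (Src Y q) = Src C f"
      using Y.pullback[OF x, of f] farr by auto
    obtain T where T: "T \<in> Cov C (Src C f)" and *: "\<And>h. h \<in> T \<Longrightarrow> \<exists>u v. u \<in> Arr Y \<and> Tgt Y u = FOb \<Theta> z \<and>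
        PAr Y u = h \<and> v \<in> Arr Y \<and> Src Y v = Src Y u \<and> Tgt Y v = Src Y q \<and> PAr Y v = h"
      using Y.local_span[of "FOb \<Theta> z" "Src Y q"] z q by auto
    have "P f h" if h: "h \<in> T" for h
    proof -
      have harr: "h \<in> Arr C" "Tgt C h = Src C f" using cov_arr[OF _ T h] farr by auto
      obtain u v where u: "u \<in> Arr Y" "Tgt Y u = FOb \<Theta> z" "PAr Y u = h"
        and v: "v \<in> Arr Y" "Src Y v = Src Y u" "Tgt Y v = Src Y q" "PAr Y v = h"
        using *[OF h] by blast
      obtain n where n: "n \<in> Arr Ybar" "Tgt Ybar n = z" "PAr Ybar n = h" "POb Ybar (Src Ybar n) = Src C h"
        using Yb.pullback[of z h] z harr by auto
      have "POb Y (Src Y u) = Src C h" using Y.src_par[OF u(1)] u by simp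
      \<comment> \<open>The source of the span need not be in the image of \<Theta>. Comparing
        \<open>u\<close> with \<open>\<Theta> n\<close> over the same \<open>h\<close> yields a
        vertical arrow \<open>l\<close> from such an image, and the composite of \<open>q\<close>,
        \<open>v\<close> and \<open>l\<close> is a probe.\<close>
      then obtain l where l: "l \<in> Arr Y" "Src Y l = FOb \<Theta> (Src Ybar n)" "Tgt Y l = Src Y u" "PAr Y l = Idn C (Src C h)"
        using Y.factor[of u "FAr \<Theta> n" "Idn C (Src C h)"] u n harr by auto
      show "P f h"
        unfolding P_def probe_def
      proof (intro exI conjI)
        show "PAr Y (q \<cdot> (v \<cdot> l)) = f \<cdot>\<^bsub>C\<^esub> h"
          using q v l harr by simp
      qed (use q v l n in auto)
    qed
    then show "\<exists>T. T \<in> Cov C (Src C f) \<and> (\<forall>h \<in> T. P f h)" using T by auto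
  qed
  then obtain T where T: "\<And>f. f \<in> R \<Longrightarrow> T f \<in> Cov C (Src C f)" "\<And>f h. f \<in> R \<Longrightarrow> h \<in> T f \<Longrightarrow> P f h"
    by metis
  show thesis
    by (rule that[OF cov_trans[OF U R T(1)]]) (use T(2) in \<open>auto simp: P_def\<close>)
qed

text \<open>Relative to \<open>v\<close> and \<open>v'\<close>, the arrow \<open>w\<close> from \<open>\<Theta> z\<close> to \<open>\<Theta> z'\<close> is given by the section \<open>c\<close>.\<close>

definition chart :: "'d \<Rightarrow> 'd \<Rightarrow> 't \<Rightarrow> 's \<Rightarrow> 's \<Rightarrow> 'a \<Rightarrow> bool" where
  "chart z z' w v v' c \<longleftrightarrow> v \<in> Arr Ybar \<and> Tgt Ybar v = z \<and> v' \<in> Arr Ybar \<and> Src Ybar v' = Src Ybar v \<and>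
     Tgt Ybar v' = z' \<and> c \<in> sec (POb Ybar (Src Ybar v)) \<and>
     w \<cdot> FAr \<Theta> v = FAr \<Theta> v' \<cdot> band (Src Ybar v) c"

definition theta_arrow :: "'d \<Rightarrow> 'd \<Rightarrow> 't \<Rightarrow> bool" where
  "theta_arrow z z' w \<longleftrightarrow> z \<in> Obj Ybar \<and> z' \<in> Obj Ybar \<and> w \<in> Arr Y \<and> Src Y w = FOb \<Theta> z \<and> Tgt Y w = FOb \<Theta> z'"

text \<open>Locally \<open>z\<close> is isomorphic in \<open>Ybar\<close> to the pullback of
  \<open>z'\<close> along \<open>PAr Y w\<close>. This supplies \<open>v'\<close> with
  \<open>\<Theta> v'\<close> parallel to \<open>w \<cdot> \<Theta> v\<close>, and
  \<open>band_torsor\<close> measures the difference.\<close>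

lemma local_chart:
  assumes w: "theta_arrow z z' w"
  obtains R where "R \<in> Cov C (POb Ybar z)" "\<And>h. h \<in> R \<Longrightarrow> \<exists>v v' c. PAr Ybar v = h \<and> chart z z' w v v' c"
proof -
  note w = w[unfolded theta_arrow_def]
  have pw: "Src C (PAr Y w) = POb Ybar z" "Tgt C (PAr Y w) = POb Ybar z'" using w by auto
  obtain q where q: "q \<in> Arr Ybar" "Tgt Ybar q = z'" "PAr Ybar q = PAr Y w" "POb Ybar (Src Ybar q) = POb Ybar z"
    using Yb.pullback[of z' "PAr Y w"] w pw by auto
  obtain T where T: "T \<in> Cov C (POb Ybar z)" and *: "\<And>h. h \<in> T \<Longrightarrow> \<exists>u v. u \<in> Arr Ybar \<and> Tgt Ybar u = z \<and>
      PAr Ybar u = h \<and> v \<in> Arr Ybar \<and> Src Ybar v = Src Ybar u \<and> Tgt Ybar v = Src Ybar q \<and> PAr Ybar v = h"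
    using Yb.local_span[of z "Src Ybar q"] q w by auto
  have "\<exists>v v' c. PAr Ybar v = h \<and> chart z z' w v v' c" if h: "h \<in> T" for h
  proof -
    obtain u v where u: "u \<in> Arr Ybar" "Tgt Ybar u = z" "PAr Ybar u = h"
      and v: "v \<in> Arr Ybar" "Src Ybar v = Src Ybar u" "Tgt Ybar v = Src Ybar q" "PAr Ybar v = h"
      using *[OF h] by blast
    define v' where "v' = q \<cdot>\<^bsub>Ybar\<^esub> v"
    have v': "v' \<in> Arr Ybar" "Src Ybar v' = Src Ybar u" "Tgt Ybar v' = z'" "PAr Ybar v' = PAr Y w \<cdot>\<^bsub>C\<^esub> h"
      using q v by (auto simp: v'_def)
    obtain c where "c \<in> sec (POb Y (Src Y (FAr \<Theta> v')))"
        "w \<cdot> FAr \<Theta> u = FAr \<Theta> v' \<cdot> Band Y (Src Y (FAr \<Theta> v')) c"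
      using Y.band_torsor[of "FAr \<Theta> v'" "w \<cdot> FAr \<Theta> u"] v' u w by auto
    then show ?thesis
      using u v' Yb.total.src_obj[OF u(1)] by (intro exI[of _ u] exI[of _ v'] exI[of _ c]) (auto simp: chart_def)
  qed
  with T show thesis using that by blast
qed

lemma chart_par:
  assumes c: "chart z z' w v v' c" and w: "theta_arrow z z' w"
  shows "PAr Ybar v' = PAr Y w \<cdot>\<^bsub>C\<^esub> PAr Ybar v"
proof -
  have v: "v \<in> Arr Ybar" "Tgt Ybar v = z" "v' \<in> Arr Ybar" "Src Ybar v' = Src Ybar v"
      "c \<in> sec (POb Ybar (Src Ybar v))"
    and e: "w \<cdot> FAr \<Theta> v = FAr \<Theta> v' \<cdot> band (Src Ybar v) c"
    using c by (auto simp: chart_def)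
  have "PAr Y (w \<cdot> FAr \<Theta> v) = PAr Y w \<cdot>\<^bsub>C\<^esub> PAr Ybar v"
    using v w by (simp add: theta_arrow_def)
  moreover have "PAr Y (FAr \<Theta> v' \<cdot> band (Src Ybar v) c) = PAr Ybar v'"
    using v Y.band_arr[of "FOb \<Theta> (Src Ybar v)" c] by simp
  ultimately show ?thesis
    using e by simp
qed

lemma chart_cmp:
  assumes c: "chart z z' w v v' c" and w: "theta_arrow z z' w" and n: "n \<in> Arr Ybar" "Tgt Ybar n = Src Ybar v"
  shows "chart z z' w (v \<cdot>\<^bsub>Ybar\<^esub> n) (v' \<cdot>\<^bsub>Ybar\<^esub> n) (ARes A (PAr Ybar n) c)"
proof -
  note c = c[unfolded chart_def] and w = w[unfolded theta_arrow_def]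
  have e: "w \<cdot> FAr \<Theta> v = FAr \<Theta> v' \<cdot> band (Src Ybar v) c" using c by blast
  have s: "Src Ybar v \<in> Obj Ybar" using c by auto
  have "band (Src Ybar v) c \<cdot> FAr \<Theta> n =
      FAr \<Theta> n \<cdot> band (Src Ybar n) (ARes A (PAr Ybar n) c)"
    using Y.band_slide[of "FAr \<Theta> n" "FOb \<Theta> (Src Ybar v)" "FOb \<Theta> (Src Ybar n)" c] n c s by simp
  then show ?thesis
    unfolding chart_def
    using c n w s Y.band_arr[of "FOb \<Theta> (Src Ybar v)" c]
      Y.band_arr[of "FOb \<Theta> (Src Ybar n)" "ARes A (PAr Ybar n) c"]
    by (simp add: Y.total.reassoc[OF e])
qed

text \<open>This is where the band of \<open>Ybar\<close> being the invariants is used: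
  \<open>v1\<close> and \<open>v2\<close> differ by an invariant section \<open>d\<close>, so the
  coordinates differ by \<open>d\<close>, and so do their images under
  \<open>\<phi> g\<close>.\<close>

lemma chart_unique:
  assumes c1: "chart z z' w v v1 c1" and c2: "chart z z' w v v2 c2" and w: "theta_arrow z z' w"
    and g: "g \<in> carrier G"
  shows "FAr \<Theta> v1 \<cdot> band (Src Ybar v) (\<phi> g (POb Ybar (Src Ybar v)) c1) =
         FAr \<Theta> v2 \<cdot> band (Src Ybar v) (\<phi> g (POb Ybar (Src Ybar v)) c2)"
proof -
  let ?V = "POb Ybar (Src Ybar v)" and ?z = "FOb \<Theta> (Src Ybar v)"
  note c1 = c1[unfolded chart_def] and c2 = c2[unfolded chart_def] and w = w[unfolded theta_arrow_def]
  have s: "Src Ybar v \<in> Obj Ybar" using c1 by auto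
  then have z: "?z \<in> Obj Y" "POb Y ?z = ?V" "?V \<in> Obj C" by auto
  have bnd: "Band Y ?z a \<in> Arr Y" "Src Y (Band Y ?z a) = ?z" "Tgt Y (Band Y ?z a) = ?z"
      "PAr Y (Band Y ?z a) = Idn C ?V" if "a \<in> sec ?V" for a
    using that Y.band_arr[OF z(1)] z by auto
  interpret A: comm_group "Grp A ?V" using z by simp
  have "PAr Y (FAr \<Theta> v1 \<cdot> Band Y ?z c1) = PAr Y (FAr \<Theta> v2 \<cdot> Band Y ?z c2)"
    using c1 c2 by simp
  then have "PAr Ybar v1 = PAr Ybar v2"
    using c1 c2 bnd by (simp add: z)
  then obtain d where d: "d \<in> carrier (Grp (invariants G A \<phi>) ?V)" "v2 = v1 \<cdot>\<^bsub>Ybar\<^esub> Band Ybar (Src Ybar v) d"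
    using Yb.band_torsor[of v1 v2] c1 c2 by auto
  have dA: "d \<in> sec ?V" and inv: "\<phi> g ?V d = d"
    using d g by (auto simp: invariant_iff)
  have v2: "FAr \<Theta> v2 = FAr \<Theta> v1 \<cdot> Band Y ?z d"
    using d c1 s Yb.band_arr[OF s d(1)] by (simp add: theta_band)
  have mult: "FAr \<Theta> v2 \<cdot> Band Y ?z a = FAr \<Theta> v1 \<cdot> Band Y ?z (d \<otimes>\<^bsub>Grp A ?V\<^esub> a)"
    if "a \<in> sec ?V" for a
    using that dA c1 bnd Y.band_mult[of ?z d a] z by (simp add: v2)
  have "FAr \<Theta> v1 \<cdot> Band Y ?z c1 = FAr \<Theta> v1 \<cdot> Band Y ?z (d \<otimes>\<^bsub>Grp A ?V\<^esub> c2)"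
    using mult[of c2] c1 c2 by simp
  then have "c1 = d \<otimes>\<^bsub>Grp A ?V\<^esub> c2"
    using c1 c2 dA z by (intro Y.band_cancel[of "FAr \<Theta> v1" ?z]) auto
  then have "\<phi> g ?V c1 = d \<otimes>\<^bsub>Grp A ?V\<^esub> \<phi> g ?V c2"
    using phi_mult[OF g z(3) dA, of c2] c2 inv by simp
  then show ?thesis
    using mult[of "\<phi> g ?V c2"] c2 g z by simp
qed

text \<open>An arrow into \<open>\<Theta> z\<close> factors as \<open>\<Theta> n\<close> after a vertical isomorphism, so compatibility
  of the prescribed values need only be tested on arrows coming from \<open>Ybar\<close>.\<close>

lemma glue_from_theta:
  assumes z: "z \<in> Obj Ybar" and x': "x' \<in> Obj Y"
    and f: "f \<in> Arr C" "Src C f = POb Ybar z" "Tgt C f = POb Y x'"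
    and s: "\<And>i. i \<in> I \<Longrightarrow> s i \<in> Arr Ybar \<and> Tgt Ybar (s i) = z"
    and t: "\<And>i. i \<in> I \<Longrightarrow> t i \<in> Arr Y \<and> Tgt Y (t i) = x' \<and> Src Y (t i) = FOb \<Theta> (Src Ybar (s i)) \<and>
              PAr Y (t i) = f \<cdot>\<^bsub>C\<^esub> PAr Ybar (s i)"
    and R: "R \<in> Cov C (POb Ybar z)" and cov: "\<And>h. h \<in> R \<Longrightarrow> \<exists>i \<in> I. PAr Ybar (s i) = h"
    and compat: "\<And>i j n m. \<lbrakk>i \<in> I; j \<in> I; n \<in> Arr Ybar; m \<in> Arr Ybar; Src Ybar n = Src Ybar m;
          Tgt Ybar n = Src Ybar (s i); Tgt Ybar m = Src Ybar (s j); s i \<cdot>\<^bsub>Ybar\<^esub> n = s j \<cdot>\<^bsub>Ybar\<^esub> m\<rbrakk>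
             \<Longrightarrow> t i \<cdot> FAr \<Theta> n = t j \<cdot> FAr \<Theta> m"
  shows "\<exists>!m. m \<in> Hom_over Y f (FOb \<Theta> z) x' \<and> (\<forall>i \<in> I. m \<cdot> FAr \<Theta> (s i) = t i)"
proof (rule Y.glue_from_probes[where s = "\<lambda>i. FAr \<Theta> (s i)" and t = t and R = R])
  fix i j v w
  assume ij: "i \<in> I" "j \<in> I" and v: "v \<in> Arr Y" "Tgt Y v = Src Y (FAr \<Theta> (s i))"
    and w: "w \<in> Arr Y" "Tgt Y w = Src Y (FAr \<Theta> (s j))" and vw: "Src Y v = Src Y w"
    and eq: "FAr \<Theta> (s i) \<cdot> v = FAr \<Theta> (s j) \<cdot> w"
  note si = s[OF ij(1)] s[OF ij(2)] and ti = t[OF ij(1)] t[OF ij(2)]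
  have obj: "Src Ybar (s i) \<in> Obj Ybar" "Src Ybar (s j) \<in> Obj Ybar" "Src Y v \<in> Obj Y" using si v by auto
  have tv: "Tgt Y v = FOb \<Theta> (Src Ybar (s i))" "Tgt Y w = FOb \<Theta> (Src Ybar (s j))"
    using v w si by auto
  have pv: "Tgt C (PAr Y v) = POb Ybar (Src Ybar (s i))" "Tgt C (PAr Y w) = POb Ybar (Src Ybar (s j))"
    using Y.tgt_par[OF v(1)] Y.tgt_par[OF w(1)] tv obj by simp_all
  have peq: "PAr Ybar (s i) \<cdot>\<^bsub>C\<^esub> PAr Y v = PAr Ybar (s j) \<cdot>\<^bsub>C\<^esub> PAr Y w"
    using arg_cong[OF eq, of "PAr Y"] si v w tv by simp
  obtain n where n: "n \<in> Arr Ybar" "Tgt Ybar n = Src Ybar (s i)" "PAr Ybar n = PAr Y v"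
      "POb Ybar (Src Ybar n) = POb Y (Src Y v)"
    using Yb.pullback[of "Src Ybar (s i)" "PAr Y v"] obj v pv by auto
  obtain m where m: "m \<in> Arr Ybar" "Src Ybar m = Src Ybar n" "Tgt Ybar m = Src Ybar (s j)"
      "PAr Ybar m = PAr Y w" "s j \<cdot>\<^bsub>Ybar\<^esub> m = s i \<cdot>\<^bsub>Ybar\<^esub> n"
    using Yb.factor[of "s j" "s i \<cdot>\<^bsub>Ybar\<^esub> n" "PAr Y w"] si n w pv vw peq by auto
  obtain k where k: "k \<in> Arr Y" "Src Y k = Src Y v" "Tgt Y k = FOb \<Theta> (Src Ybar n)"
      "PAr Y k = Idn C (POb Y (Src Y v))" "FAr \<Theta> n \<cdot> k = v"
    using Y.factor[of "FAr \<Theta> n" v "Idn C (POb Y (Src Y v))"] n v tv obj by auto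
  have ji: "FAr \<Theta> (s j) \<cdot> FAr \<Theta> m = FAr \<Theta> (s i) \<cdot> FAr \<Theta> n"
    using arg_cong[OF m(5), of "FAr \<Theta>"] si n m(1-4) by simp
  \<comment> \<open>The vertical arrow \<open>k\<close> was chosen to correct
    \<open>\<Theta> n\<close> to \<open>v\<close>. Cancelling \<open>\<Theta> (s j)\<close> shows
    that it also corrects \<open>\<Theta> m\<close> to \<open>w\<close>, so one composition with
    \<open>k\<close> serves both sides.\<close>
  have mk: "FAr \<Theta> m \<cdot> k = w"
  proof (rule Y.cancel[of "FAr \<Theta> (s j)"])
    show "FAr \<Theta> (s j) \<cdot> (FAr \<Theta> m \<cdot> k) = FAr \<Theta> (s j) \<cdot> w"
      using si n m k by (simp add: Y.total.reassoc[OF ji] eq)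
    show "PAr Y (FAr \<Theta> m \<cdot> k) = PAr Y w"
      using n m k w vw by (simp)
  qed (use si n m k w vw tv in auto)
  note c = compat[OF ij n(1) m(1) _ n(2) m(3)]
  have "t i \<cdot> v = (t i \<cdot> FAr \<Theta> n) \<cdot> k"
    using ti n k by simp
  also have "\<dots> = (t j \<cdot> FAr \<Theta> m) \<cdot> k"
    using c m by simp
  also have "\<dots> = t j \<cdot> w"
    using ti m k mk by simp
  finally show "t i \<cdot> v = t j \<cdot> w" .
next
  fix h assume "h \<in> R"
  then show "\<exists>i\<in>I. PAr Y (FAr \<Theta> (s i)) = h" using cov[of h] s by auto
qed (use z x' f s t R in auto)

text \<open>The effect of \<open>g\<close> on arrows between objects of the form
  \<open>\<Theta> z\<close>. The objects \<open>z\<close> and \<open>z'\<close> are arguments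
  because \<open>w\<close> only knows their images.\<close>

definition twist :: "'g \<Rightarrow> 'd \<Rightarrow> 'd \<Rightarrow> 't \<Rightarrow> 't" where
  "twist g z z' w = (THE m. m \<in> Hom_over Y (PAr Y w) (FOb \<Theta> z) (FOb \<Theta> z') \<and>
     (\<forall>v v' c. chart z z' w v v' c \<longrightarrow>
        m \<cdot> FAr \<Theta> v = FAr \<Theta> v' \<cdot> band (Src Ybar v) (\<phi> g (POb Ybar (Src Ybar v)) c)))"

lemma twist_ex1:
  assumes w: "theta_arrow z z' w" and g: "g \<in> carrier G"
  shows "\<exists>!m. m \<in> Hom_over Y (PAr Y w) (FOb \<Theta> z) (FOb \<Theta> z') \<and>
     (\<forall>v v' c. chart z z' w v v' c \<longrightarrow>
        m \<cdot> FAr \<Theta> v = FAr \<Theta> v' \<cdot> band (Src Ybar v) (\<phi> g (POb Ybar (Src Ybar v)) c))"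
proof -
  \<comment> \<open>All charts serve as indices, not one for each member of a cover. The glued arrow
    then satisfies the formula in every chart and depends on no choice.\<close>
  let ?I = "{(v, v', c). chart z z' w v v' c}"
  let ?t = "\<lambda>(v, v', c). FAr \<Theta> v' \<cdot> band (Src Ybar v) (\<phi> g (POb Ybar (Src Ybar v)) c)"
  note w' = w[unfolded theta_arrow_def]
  obtain R where R: "R \<in> Cov C (POb Ybar z)"
    "\<And>h. h \<in> R \<Longrightarrow> \<exists>v v' c. PAr Ybar v = h \<and> chart z z' w v v' c"
    using local_chart[OF w] by blast
  have "\<exists>!m. m \<in> Hom_over Y (PAr Y w) (FOb \<Theta> z) (FOb \<Theta> z') \<and>
      (\<forall>i \<in> ?I. m \<cdot> FAr \<Theta> (fst i) = ?t i)"
  proof (rule glue_from_theta[OF _ _ _ _ _ _ _ R(1)])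
    fix i assume "i \<in> ?I"
    then obtain v v' c where i: "i = (v, v', c)" and c: "chart z z' w v v' c" by auto
    note c' = c[unfolded chart_def]
    have s: "Src Ybar v \<in> Obj Ybar" using c' by auto
    have "PAr Ybar v' = PAr Y w \<cdot>\<^bsub>C\<^esub> PAr Ybar v"
      by (rule chart_par[OF c w])
    then show "?t i \<in> Arr Y \<and> Tgt Y (?t i) = FOb \<Theta> z' \<and> Src Y (?t i) = FOb \<Theta> (Src Ybar (fst i)) \<and>
              PAr Y (?t i) = PAr Y w \<cdot>\<^bsub>C\<^esub> PAr Ybar (fst i)"
      using c' w' s g Y.band_arr[of "FOb \<Theta> (Src Ybar v)" "\<phi> g (POb Ybar (Src Ybar v)) c"] by (simp add: i)
  next
    fix i j n m
    assume *: "i \<in> ?I" "j \<in> ?I" and n: "n \<in> Arr Ybar" "Tgt Ybar n = Src Ybar (fst i)"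
      and m: "m \<in> Arr Ybar" "Tgt Ybar m = Src Ybar (fst j)" and nm: "Src Ybar n = Src Ybar m"
      and eq: "fst i \<cdot>\<^bsub>Ybar\<^esub> n = fst j \<cdot>\<^bsub>Ybar\<^esub> m"
    have push: "(FAr \<Theta> v' \<cdot> band (Src Ybar v) (\<phi> g (POb Ybar (Src Ybar v)) c)) \<cdot> FAr \<Theta> n =
        FAr \<Theta> (v' \<cdot>\<^bsub>Ybar\<^esub> n) \<cdot>
          band (Src Ybar n) (\<phi> g (POb Ybar (Src Ybar n)) (ARes A (PAr Ybar n) c))"
      if c: "chart z z' w v v' c" and n: "n \<in> Arr Ybar" "Tgt Ybar n = Src Ybar v" for v v' c n
    proof -
      note c' = c[unfolded chart_def]
      have s: "Src Ybar v \<in> Obj Ybar" using c' by auto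
      show ?thesis
        using c' n s g Y.band_arr[of "FOb \<Theta> (Src Ybar v)" "\<phi> g (POb Ybar (Src Ybar v)) c"]
          Y.band_arr[of "FOb \<Theta> (Src Ybar n)" "\<phi> g (POb Ybar (Src Ybar n)) (ARes A (PAr Ybar n) c)"]
          Y.band_slide[of "FAr \<Theta> n" "FOb \<Theta> (Src Ybar v)" "FOb \<Theta> (Src Ybar n)" "\<phi> g (POb Ybar (Src Ybar v)) c"]
          phi_ares[OF g, of "PAr Ybar n" "POb Ybar (Src Ybar n)" "POb Ybar (Src Ybar v)" c]
        by simp
    qed
    obtain v1 v1' c1 v2 v2' c2 where ij: "i = (v1, v1', c1)" "j = (v2, v2', c2)"
      and c: "chart z z' w v1 v1' c1" "chart z z' w v2 v2' c2" using * by auto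
    have n1: "Tgt Ybar n = Src Ybar v1" and m1: "Tgt Ybar m = Src Ybar v2" and e: "v1 \<cdot>\<^bsub>Ybar\<^esub> n = v2 \<cdot>\<^bsub>Ybar\<^esub> m"
      using n m eq ij by auto
    have "Src Ybar (v1 \<cdot>\<^bsub>Ybar\<^esub> n) = Src Ybar n"
      using n n1 c by (simp add: chart_def)
    then show "?t i \<cdot> FAr \<Theta> n = ?t j \<cdot> FAr \<Theta> m"
      using chart_unique[OF chart_cmp[OF c(1) w n(1) n1] chart_cmp[OF c(2) w m(1) m1, folded e] w g]
        push[OF c(1) n(1) n1] push[OF c(2) m(1) m1] by (simp add: ij nm)
  next
    fix h assume "h \<in> R"
    then obtain v v' c where "PAr Ybar v = h" "chart z z' w v v' c" using R(2) by blast
    then show "\<exists>i \<in> ?I. PAr Ybar (fst i) = h" by (intro bexI[of _ "(v, v', c)"]) auto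
  qed (use w' in \<open>auto simp: chart_def\<close>)
  then show ?thesis by simp
qed

lemma
  assumes w: "theta_arrow z z' w" and g: "g \<in> carrier G"
  shows twist_arrow: "theta_arrow z z' (twist g z z' w)"
    and twist_par: "PAr Y (twist g z z' w) = PAr Y w"
    and twist_chart: "chart z z' w v v' c \<Longrightarrow> twist g z z' w \<cdot> FAr \<Theta> v =
          FAr \<Theta> v' \<cdot> band (Src Ybar v) (\<phi> g (POb Ybar (Src Ybar v)) c)"
  using theI'[OF twist_ex1[OF w g], folded twist_def] w
  by (auto simp: Hom_over_def Hom_def theta_arrow_def)

lemma twist_base:
  assumes v: "v \<in> Arr Ybar" and c: "c \<in> sec (POb Ybar (Src Ybar v))" and g: "g \<in> carrier G"
  shows "twist g (Src Ybar v) (Tgt Ybar v) (FAr \<Theta> v \<cdot> band (Src Ybar v) c) =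
     FAr \<Theta> v \<cdot> band (Src Ybar v) (\<phi> g (POb Ybar (Src Ybar v)) c)"
proof -
  let ?w = "FAr \<Theta> v \<cdot> band (Src Ybar v) c"
  have s: "Src Ybar v \<in> Obj Ybar" using v by auto
  note B = Y.band_arr[of "FOb \<Theta> (Src Ybar v)" c]
  have w: "theta_arrow (Src Ybar v) (Tgt Ybar v) ?w"
    using v c s B by (simp add: theta_arrow_def)
  have ch: "chart (Src Ybar v) (Tgt Ybar v) ?w (Idn Ybar (Src Ybar v)) v c"
    using v c s B by (simp add: chart_def)
  show ?thesis
    using twist_chart[OF w g ch] twist_arrow[OF w g] s by (simp add: theta_arrow_def)
qed

text \<open>A chart of \<open>w\<close> ends with an arrow \<open>\<Theta> v'\<close> over which
  \<open>w'\<close> need not have a chart, so a second refinement charts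
  \<open>w' \<cdot> \<Theta> v'\<close>. There the coordinate of the composite is the product of the
  two coordinates, and \<open>\<phi> g\<close> is multiplicative.\<close>

lemma twist_cmp:
  assumes w: "theta_arrow z z' w" and w': "theta_arrow z' z'' w'" and g: "g \<in> carrier G"
  shows "twist g z z'' (w' \<cdot> w) = twist g z' z'' w' \<cdot> twist g z z' w"
proof -
  have ww: "theta_arrow z z'' (w' \<cdot> w)" using w w' by (simp add: theta_arrow_def)
  note W = w[unfolded theta_arrow_def] w'[unfolded theta_arrow_def]
  note tw = twist_arrow[OF w g, unfolded theta_arrow_def] twist_arrow[OF w' g, unfolded theta_arrow_def]
    twist_arrow[OF ww g, unfolded theta_arrow_def]
  obtain R where R: "R \<in> Cov C (POb Ybar z)"
    "\<And>h. h \<in> R \<Longrightarrow> \<exists>v v' c. PAr Ybar v = h \<and> chart z z' w v v' c"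
    using local_chart[OF w] by blast
  show ?thesis
  proof (rule Y.arrow_eq_local)
    fix h assume "h \<in> R"
    then obtain v v' c where v: "PAr Ybar v = h" and ch: "chart z z' w v v' c" using R by blast
    note ch' = ch[unfolded chart_def]
    have ch0: "v \<in> Arr Ybar" "Tgt Ybar v = z" "v' \<in> Arr Ybar" "Src Ybar v' = Src Ybar v" "Tgt Ybar v' = z'"
      using ch' by auto
    let ?y = "Src Ybar v"
    have y: "?y \<in> Obj Ybar" using ch' by auto
    have w2: "theta_arrow ?y z'' (w' \<cdot> FAr \<Theta> v')"
      using W ch' y by (simp add: theta_arrow_def)
    obtain T where T: "T \<in> Cov C (POb Ybar ?y)"
      "\<And>h. h \<in> T \<Longrightarrow> \<exists>u u' e. PAr Ybar u = h \<and> chart ?y z'' (w' \<cdot> FAr \<Theta> v') u u' e"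
      using local_chart[OF w2] by blast
    have tc: "twist g z z' w \<cdot> FAr \<Theta> v = FAr \<Theta> v' \<cdot> band ?y (\<phi> g (POb Ybar ?y) c)"
      by (rule twist_chart[OF w g ch])
    have "twist g z z'' (w' \<cdot> w) \<cdot> FAr \<Theta> v = (twist g z' z'' w' \<cdot> twist g z z' w) \<cdot> FAr \<Theta> v"
    proof (rule Y.arrow_eq_local)
      fix k assume "k \<in> T"
      then obtain u u' e where u: "PAr Ybar u = k" and cu: "chart ?y z'' (w' \<cdot> FAr \<Theta> v') u u' e" using T by blast
      note cu' = cu[unfolded chart_def]
      have cu0: "u \<in> Arr Ybar" "Tgt Ybar u = Src Ybar v" "u' \<in> Arr Ybar" "Src Ybar u' = Src Ybar u"
          "Tgt Ybar u' = z''" using cu' by auto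
      let ?x = "Src Ybar u" and ?V = "POb Ybar (Src Ybar u)"
      let ?c = "ARes A (PAr Ybar u) c"
      have x: "?x \<in> Obj Ybar" "?V \<in> Obj C" using cu' by auto
      have c': "?c \<in> sec ?V" and e: "e \<in> sec ?V"
        using cu' ch' by auto
      interpret A: comm_group "Grp A ?V" using x by simp
      have bnd: "band ?x a \<in> Arr Y \<and> Src Y (band ?x a) = FOb \<Theta> ?x \<and>
          Tgt Y (band ?x a) = FOb \<Theta> ?x" if "a \<in> sec ?V" for a
        using that Y.band_arr[of "FOb \<Theta> ?x" a] x by auto
      note bnd' = bnd[OF c'] bnd[OF e] bnd[OF phi_closed[OF g x(2) c']] bnd[OF phi_closed[OF g x(2) e]]
      note mul = Y.band_mult[of "FOb \<Theta> ?x", unfolded theta_simps(2)[OF x(1)]]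
      have e1: "w \<cdot> FAr \<Theta> v = FAr \<Theta> v' \<cdot> band ?y c" using ch' by simp
      have e2: "(w' \<cdot> FAr \<Theta> v') \<cdot> FAr \<Theta> u = FAr \<Theta> u' \<cdot> band ?x e" using cu' by simp
      have sl: "band ?y a \<cdot> FAr \<Theta> u = FAr \<Theta> u \<cdot> band ?x (ARes A (PAr Ybar u) a)"
        if "a \<in> sec (POb Ybar ?y)" for a
        using Y.band_slide[of "FAr \<Theta> u" "FOb \<Theta> ?y" "FOb \<Theta> ?x" a] that cu' y by simp
      have bny: "band ?y a \<in> Arr Y" "Src Y (band ?y a) = FOb \<Theta> ?y"
          "Tgt Y (band ?y a) = FOb \<Theta> ?y" if "a \<in> sec (POb Ybar ?y)" for a
        using that Y.band_arr[of "FOb \<Theta> ?y" a] y by auto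
      have c_in: "c \<in> sec (POb Ybar ?y)" "\<phi> g (POb Ybar ?y) c \<in> sec (POb Ybar ?y)"
        using ch' g y by auto
      have "(w' \<cdot> w) \<cdot> FAr \<Theta> (v \<cdot>\<^bsub>Ybar\<^esub> u) = w' \<cdot> ((w \<cdot> FAr \<Theta> v) \<cdot> FAr \<Theta> u)"
        using W ch0 cu0 by simp
      also have "\<dots> = w' \<cdot> (FAr \<Theta> v' \<cdot> (FAr \<Theta> u \<cdot> band ?x ?c))"
        unfolding e1 using W ch0 cu0 bny[OF c_in(1)] by (simp add: sl[OF c_in(1)])
      also have "\<dots> = ((w' \<cdot> FAr \<Theta> v') \<cdot> FAr \<Theta> u) \<cdot> band ?x ?c"
        using W ch0 cu0 bnd' by simp
      also have "\<dots> = FAr \<Theta> u' \<cdot> band ?x (e \<otimes>\<^bsub>Grp A ?V\<^esub> ?c)"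
        unfolding e2 using W ch0 cu0 bnd' c' e x by (simp add: mul)
      finally have "chart z z'' (w' \<cdot> w) (v \<cdot>\<^bsub>Ybar\<^esub> u) u' (e \<otimes>\<^bsub>Grp A ?V\<^esub> ?c)"
        using ch' cu' c' e by (simp add: chart_def)
      from twist_chart[OF ww g this]
      have "twist g z z'' (w' \<cdot> w) \<cdot> FAr \<Theta> (v \<cdot>\<^bsub>Ybar\<^esub> u) =
          FAr \<Theta> u' \<cdot> band ?x (\<phi> g ?V e \<otimes>\<^bsub>Grp A ?V\<^esub> \<phi> g ?V ?c)"
        using ch' cu' c' e g x by (simp add: phi_mult)
      also have "\<dots> = (FAr \<Theta> u' \<cdot> band ?x (\<phi> g ?V e)) \<cdot> band ?x (\<phi> g ?V ?c)"
        using cu' c' e g x bnd' by (simp add: mul)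
      also have "\<dots> = (twist g ?y z'' (w' \<cdot> FAr \<Theta> v') \<cdot> FAr \<Theta> u) \<cdot> band ?x (\<phi> g ?V ?c)"
        using twist_chart[OF w2 g cu] by simp
      finally have 1: "twist g z z'' (w' \<cdot> w) \<cdot> FAr \<Theta> (v \<cdot>\<^bsub>Ybar\<^esub> u) =
         (twist g ?y z'' (w' \<cdot> FAr \<Theta> v') \<cdot> FAr \<Theta> u) \<cdot> band ?x (\<phi> g ?V ?c)" .
      have "chart z' z'' w' (v' \<cdot>\<^bsub>Ybar\<^esub> u) u' e"
        using W ch' cu' e2 by (simp add: chart_def)
      from twist_chart[OF w' g this] twist_chart[OF w2 g cu]
      have 2: "twist g ?y z'' (w' \<cdot> FAr \<Theta> v') \<cdot> FAr \<Theta> u = twist g z' z'' w' \<cdot> FAr \<Theta> (v' \<cdot>\<^bsub>Ybar\<^esub> u)"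
        using ch' cu' by simp
      have phc: "\<phi> g ?V ?c = ARes A (PAr Ybar u) (\<phi> g (POb Ybar ?y) c)"
        using phi_ares[OF g, of "PAr Ybar u" ?V "POb Ybar ?y" c] cu' ch' by simp
      have "(twist g z' z'' w' \<cdot> FAr \<Theta> (v' \<cdot>\<^bsub>Ybar\<^esub> u)) \<cdot> band ?x (\<phi> g ?V ?c) =
          twist g z' z'' w' \<cdot> (FAr \<Theta> v' \<cdot> (band ?y (\<phi> g (POb Ybar ?y) c) \<cdot> FAr \<Theta> u))"
        using sl[OF c_in(2)] phc tw ch' cu' bnd' by simp
      also have "\<dots> = twist g z' z'' w' \<cdot> ((twist g z z' w \<cdot> FAr \<Theta> v) \<cdot> FAr \<Theta> u)"
        unfolding tc using tw ch' cu' bny[OF c_in(2)] by simp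
      finally have 3: "twist g z z'' (w' \<cdot> w) \<cdot> FAr \<Theta> (v \<cdot>\<^bsub>Ybar\<^esub> u) =
          twist g z' z'' w' \<cdot> ((twist g z z' w \<cdot> FAr \<Theta> v) \<cdot> FAr \<Theta> u)"
        unfolding 1 2 .
      show "\<exists>p\<in>Arr Y. Tgt Y p = Src Y (twist g z z'' (w' \<cdot> w) \<cdot> FAr \<Theta> v) \<and> PAr Y p = k \<and>
          (twist g z z'' (w' \<cdot> w) \<cdot> FAr \<Theta> v) \<cdot> p = ((twist g z' z'' w' \<cdot> twist g z z' w) \<cdot> FAr \<Theta> v) \<cdot> p"
        using 3 u tw ch' cu' by (intro bexI[of _ "FAr \<Theta> u"]) auto
    qed (use tw ch' y T twist_par[OF w g] twist_par[OF w' g] twist_par[OF ww g] W in auto)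
    then show "\<exists>p\<in>Arr Y. Tgt Y p = Src Y (twist g z z'' (w' \<cdot> w)) \<and> PAr Y p = h \<and>
        twist g z z'' (w' \<cdot> w) \<cdot> p = (twist g z' z'' w' \<cdot> twist g z z' w) \<cdot> p"
      using v tw ch' by (intro bexI[of _ "FAr \<Theta> v"]) auto
  qed (use tw R twist_par[OF w g] twist_par[OF w' g] twist_par[OF ww g] W in auto)
qed

end

section \<open>Two-isomorphisms\<close>

lemma fctr_simps [simp]:
  "FOb (F' \<circ>\<^sub>F F) x = FOb F' (FOb F x)" "FAr (F' \<circ>\<^sub>F F) u = FAr F' (FAr F u)"
  "FOb fctr_id x = x" "FAr fctr_id u = u"
  by (simp_all add: fctr_comp_def fctr_id_def)

lemma fctr_comp_assoc: "(F'' \<circ>\<^sub>F F') \<circ>\<^sub>F F = F'' \<circ>\<^sub>F (F' \<circ>\<^sub>F F)"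
  by (simp add: fctr_comp_def comp_assoc)

lemma gerbe_morphism_comp:
  assumes "gerbe_morphism Y\<^sub>1 Y\<^sub>2 F" "gerbe_morphism Y\<^sub>2 Y\<^sub>3 F'"
  shows "gerbe_morphism Y\<^sub>1 Y\<^sub>3 (F' \<circ>\<^sub>F F)"
  using gerbe_morphism_simps[OF assms(1)] gerbe_morphism_simps[OF assms(2)]
  by (auto simp: gerbe_morphism_def Hom_over_def Hom_def)

lemma (in fibred_in_groupoids) gerbe_morphism_id: "gerbe_morphism Y Y fctr_id"
  by (auto simp: gerbe_morphism_def Hom_over_def Hom_def)

context fibred_in_groupoids
begin

text \<open>A 2-morphism is invertible because its components are vertical.\<close>

lemma two_isomorphic_iff:
  assumes F: "gerbe_morphism Y\<^sub>1 Y F" and F': "gerbe_morphism Y\<^sub>1 Y F'"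
  shows "two_isomorphic C Y\<^sub>1 Y F F' \<longleftrightarrow> (\<exists>\<eta>. two_morphism C Y\<^sub>1 Y F F' \<eta>)"
proof
  assume "\<exists>\<eta>. two_morphism C Y\<^sub>1 Y F F' \<eta>"
  then obtain \<eta> where \<eta>: "two_morphism C Y\<^sub>1 Y F F' \<eta>" by blast
  have "Defs.is_iso Y (\<eta> x)" if "x \<in> Obj Y\<^sub>1" for x
    using \<eta> that gerbe_morphism_simps[OF F]
    by (intro vertical_is_iso) (auto simp: two_morphism_def Hom_over_def Hom_def)
  with \<eta> show "two_isomorphic C Y\<^sub>1 Y F F'"
    by (auto simp: two_isomorphic_def)
qed (auto simp: two_isomorphic_def)

lemma two_morphism_simps:
  assumes "two_morphism C Y\<^sub>1 Y F F' \<eta>"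
  shows "x \<in> Obj Y\<^sub>1 \<Longrightarrow> \<eta> x \<in> Arr Y" "x \<in> Obj Y\<^sub>1 \<Longrightarrow> Src Y (\<eta> x) = FOb F x"
    "x \<in> Obj Y\<^sub>1 \<Longrightarrow> Tgt Y (\<eta> x) = FOb F' x" "x \<in> Obj Y\<^sub>1 \<Longrightarrow> PAr Y (\<eta> x) = Idn C (POb Y\<^sub>1 x)"
    "u \<in> Arr Y\<^sub>1 \<Longrightarrow> \<eta> (Tgt Y\<^sub>1 u) \<cdot>\<^bsub>Y\<^esub> FAr F u = FAr F' u \<cdot>\<^bsub>Y\<^esub> \<eta> (Src Y\<^sub>1 u)"
  using assms by (auto simp: two_morphism_def Hom_over_def Hom_def)

lemma two_morphism_inverse:
  assumes Y1: "category Y\<^sub>1" and F: "gerbe_morphism Y\<^sub>1 Y F" and F': "gerbe_morphism Y\<^sub>1 Y F'"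
    and \<eta>: "two_morphism C Y\<^sub>1 Y F F' \<eta>"
  obtains \<epsilon> where "two_morphism C Y\<^sub>1 Y F' F \<epsilon>"
    "\<And>x. x \<in> Obj Y\<^sub>1 \<Longrightarrow> \<epsilon> x \<cdot>\<^bsub>Y\<^esub> \<eta> x = Idn Y (FOb F x)"
    "\<And>x. x \<in> Obj Y\<^sub>1 \<Longrightarrow> \<eta> x \<cdot>\<^bsub>Y\<^esub> \<epsilon> x = Idn Y (FOb F' x)"
proof -
  interpret Y1: category Y\<^sub>1 by fact
  note [simp] = gerbe_morphism_simps[OF F] gerbe_morphism_simps[OF F']
  note e = two_morphism_simps[OF \<eta>]
  have "\<exists>\<epsilon>. \<forall>x\<in>Obj Y\<^sub>1. \<epsilon> x \<in> Hom_over Y (Idn C (POb Y\<^sub>1 x)) (FOb F' x) (FOb F x) \<and>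
      \<epsilon> x \<cdot>\<^bsub>Y\<^esub> \<eta> x = Idn Y (FOb F x) \<and> \<eta> x \<cdot>\<^bsub>Y\<^esub> \<epsilon> x = Idn Y (FOb F' x)"
  proof (rule bchoice, rule ballI)
    fix x assume x: "x \<in> Obj Y\<^sub>1"
    show "\<exists>l. l \<in> Hom_over Y (Idn C (POb Y\<^sub>1 x)) (FOb F' x) (FOb F x) \<and>
      l \<cdot>\<^bsub>Y\<^esub> \<eta> x = Idn Y (FOb F x) \<and> \<eta> x \<cdot>\<^bsub>Y\<^esub> l = Idn Y (FOb F' x)"
      using vertical_inverse[of "\<eta> x"] e(1-4)[OF x] x by (auto simp: Hom_over_def Hom_def)
  qed
  then obtain \<epsilon> where \<epsilon>: "\<And>x. x \<in> Obj Y\<^sub>1 \<Longrightarrow> \<epsilon> x \<in> Hom_over Y (Idn C (POb Y\<^sub>1 x)) (FOb F' x) (FOb F x)"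
    and inv: "\<And>x. x \<in> Obj Y\<^sub>1 \<Longrightarrow> \<epsilon> x \<cdot>\<^bsub>Y\<^esub> \<eta> x = Idn Y (FOb F x)"
    "\<And>x. x \<in> Obj Y\<^sub>1 \<Longrightarrow> \<eta> x \<cdot>\<^bsub>Y\<^esub> \<epsilon> x = Idn Y (FOb F' x)" by metis
  have ep: "\<epsilon> x \<in> Arr Y" "Src Y (\<epsilon> x) = FOb F' x" "Tgt Y (\<epsilon> x) = FOb F x" if "x \<in> Obj Y\<^sub>1" for x
    using \<epsilon>[OF that] by (auto simp: Hom_over_def Hom_def)
  have "\<epsilon> x \<cdot>\<^bsub>Y\<^esub> FAr F' u = FAr F u \<cdot>\<^bsub>Y\<^esub> \<epsilon> z" if u: "u \<in> Hom Y\<^sub>1 z x" for z x u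
  proof -
    have u': "u \<in> Arr Y\<^sub>1" "Src Y\<^sub>1 u = z" "Tgt Y\<^sub>1 u = x" "z \<in> Obj Y\<^sub>1" "x \<in> Obj Y\<^sub>1"
      using u by (auto simp: Hom_def)
    note 1 = ep[OF u'(4)] ep[OF u'(5)] e(1-4)[OF u'(4)] e(1-4)[OF u'(5)]
    have nat: "\<eta> x \<cdot>\<^bsub>Y\<^esub> FAr F u = FAr F' u \<cdot>\<^bsub>Y\<^esub> \<eta> z" using e(5)[OF u'(1)] u' by simp
    have "\<epsilon> x \<cdot>\<^bsub>Y\<^esub> FAr F' u = \<epsilon> x \<cdot>\<^bsub>Y\<^esub> (FAr F' u \<cdot>\<^bsub>Y\<^esub> (\<eta> z \<cdot>\<^bsub>Y\<^esub> \<epsilon> z))"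
      using u' 1 inv by simp
    also have "\<dots> = \<epsilon> x \<cdot>\<^bsub>Y\<^esub> ((FAr F' u \<cdot>\<^bsub>Y\<^esub> \<eta> z) \<cdot>\<^bsub>Y\<^esub> \<epsilon> z)"
      using u' 1 by simp
    also have "\<dots> = \<epsilon> x \<cdot>\<^bsub>Y\<^esub> (\<eta> x \<cdot>\<^bsub>Y\<^esub> (FAr F u \<cdot>\<^bsub>Y\<^esub> \<epsilon> z))"
      unfolding nat[symmetric] using u' 1 by simp
    also have "\<dots> = FAr F u \<cdot>\<^bsub>Y\<^esub> \<epsilon> z"
      using u' 1 by (simp add: total.reassoc[OF inv(1)[OF u'(5)]])
    finally show ?thesis .
  qed
  then show thesis
    using that[of \<epsilon>] \<epsilon> inv by (auto simp: two_morphism_def)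
qed

lemma two_isomorphic_sym:
  assumes "category Y\<^sub>1" "gerbe_morphism Y\<^sub>1 Y F" "gerbe_morphism Y\<^sub>1 Y F'" "two_isomorphic C Y\<^sub>1 Y F F'"
  shows "two_isomorphic C Y\<^sub>1 Y F' F"
  using assms two_morphism_inverse two_isomorphic_iff by metis

lemma two_morphism_vcomp:
  assumes Y1: "category Y\<^sub>1"
    and F: "gerbe_morphism Y\<^sub>1 Y F" "gerbe_morphism Y\<^sub>1 Y F'" "gerbe_morphism Y\<^sub>1 Y F''"
    and \<eta>: "two_morphism C Y\<^sub>1 Y F F' \<eta>" and \<epsilon>: "two_morphism C Y\<^sub>1 Y F' F'' \<epsilon>"
    and obj: "\<And>x. x \<in> Obj Y\<^sub>1 \<Longrightarrow> POb Y\<^sub>1 x \<in> Obj C"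
  shows "two_morphism C Y\<^sub>1 Y F F'' (vcomp Y \<epsilon> \<eta>)"
proof -
  interpret Y1: category Y\<^sub>1 by fact
  note e = two_morphism_simps[OF \<eta>] two_morphism_simps[OF \<epsilon>]
  note m = gerbe_morphism_simps[OF F(1)] gerbe_morphism_simps[OF F(2)] gerbe_morphism_simps[OF F(3)]
  have nat: "(\<epsilon> (Tgt Y\<^sub>1 u) \<cdot>\<^bsub>Y\<^esub> \<eta> (Tgt Y\<^sub>1 u)) \<cdot>\<^bsub>Y\<^esub> FAr F u = FAr F'' u \<cdot>\<^bsub>Y\<^esub> (\<epsilon> (Src Y\<^sub>1 u) \<cdot>\<^bsub>Y\<^esub> \<eta> (Src Y\<^sub>1 u))"
    if u: "u \<in> Arr Y\<^sub>1" for u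
  proof -
    have "(\<epsilon> (Tgt Y\<^sub>1 u) \<cdot>\<^bsub>Y\<^esub> \<eta> (Tgt Y\<^sub>1 u)) \<cdot>\<^bsub>Y\<^esub> FAr F u = \<epsilon> (Tgt Y\<^sub>1 u) \<cdot>\<^bsub>Y\<^esub> (FAr F' u \<cdot>\<^bsub>Y\<^esub> \<eta> (Src Y\<^sub>1 u))"
      using u e(1-4,6-9) m e(5)[OF u] by simp
    also have "\<dots> = FAr F'' u \<cdot>\<^bsub>Y\<^esub> (\<epsilon> (Src Y\<^sub>1 u) \<cdot>\<^bsub>Y\<^esub> \<eta> (Src Y\<^sub>1 u))"
      using u e(1-4,6-9) m by (simp add: total.reassoc[OF e(10)[OF u]])
    finally show ?thesis .
  qed
  show ?thesis
    using e(1-4,6-9) m nat obj by (auto simp: two_morphism_def vcomp_def Hom_over_def Hom_def)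
qed

lemma two_isomorphic_trans:
  assumes Y1: "fibred_in_groupoids C Y\<^sub>1"
    and F: "gerbe_morphism Y\<^sub>1 Y F" "gerbe_morphism Y\<^sub>1 Y F'" "gerbe_morphism Y\<^sub>1 Y F''"
    and iso: "two_isomorphic C Y\<^sub>1 Y F F'" "two_isomorphic C Y\<^sub>1 Y F' F''"
  shows "two_isomorphic C Y\<^sub>1 Y F F''"
proof -
  interpret Y1: fibred_in_groupoids C Y\<^sub>1 by fact
  show ?thesis
    using iso two_morphism_vcomp[OF Y1.total.category_axioms F] Y1.proj_obj
    unfolding two_isomorphic_iff[OF F(1,2)] two_isomorphic_iff[OF F(2,3)] two_isomorphic_iff[OF F(1,3)]
    by blast
qed

lemma two_morphism_whisker_left:
  assumes F: "gerbe_morphism Y\<^sub>1 Y\<^sub>2 F" "gerbe_morphism Y\<^sub>1 Y\<^sub>2 F'" and H: "gerbe_morphism Y\<^sub>2 Y H"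
    and Y: "category Y\<^sub>1" "fibred_in_groupoids C Y\<^sub>2" and \<eta>: "two_morphism C Y\<^sub>1 Y\<^sub>2 F F' \<eta>"
  shows "two_morphism C Y\<^sub>1 Y (H \<circ>\<^sub>F F) (H \<circ>\<^sub>F F') (whisker_left H \<eta>)"
proof -
  interpret Y1: category Y\<^sub>1 by fact
  interpret Y2: fibred_in_groupoids C Y\<^sub>2 by fact
  note e = Y2.two_morphism_simps[OF \<eta>]
  note m = gerbe_morphism_simps[OF F(1)] gerbe_morphism_simps[OF F(2)] gerbe_morphism_simps[OF H]
  have "FAr H (\<eta> (Tgt Y\<^sub>1 u)) \<cdot>\<^bsub>Y\<^esub> FAr H (FAr F u) = FAr H (FAr F' u) \<cdot>\<^bsub>Y\<^esub> FAr H (\<eta> (Src Y\<^sub>1 u))"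
    if u: "u \<in> Arr Y\<^sub>1" for u
    using arg_cong[OF e(5)[OF u], of "FAr H"] u e(1-4) m by simp
  then show ?thesis
    using e(1-4) m by (auto simp: two_morphism_def whisker_left_def Hom_over_def Hom_def)
qed

lemma two_isomorphic_whisker:
  assumes F: "gerbe_morphism Y\<^sub>1 Y\<^sub>2 F" "gerbe_morphism Y\<^sub>1 Y\<^sub>2 F'" and H: "gerbe_morphism Y\<^sub>2 Y H"
    and Y: "category Y\<^sub>1" "fibred_in_groupoids C Y\<^sub>2" and iso: "two_isomorphic C Y\<^sub>1 Y\<^sub>2 F F'"
  shows "two_isomorphic C Y\<^sub>1 Y (H \<circ>\<^sub>F F) (H \<circ>\<^sub>F F')"
  using iso two_morphism_whisker_left[OF F H Y]
  unfolding two_isomorphic_iff[OF gerbe_morphism_comp[OF F(1) H] gerbe_morphism_comp[OF F(2) H]]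
  by (auto simp: two_isomorphic_def)

lemma two_morphism_whisker_right:
  assumes "gerbe_morphism Y\<^sub>1 Y\<^sub>2 H" and "two_morphism C Y\<^sub>2 Y F F' \<eta>"
  shows "two_morphism C Y\<^sub>1 Y (F \<circ>\<^sub>F H) (F' \<circ>\<^sub>F H) (whisker_right \<eta> H)"
proof -
  note m = gerbe_morphism_simps[OF assms(1)] and e = two_morphism_simps[OF assms(2)]
  have "\<eta> (FOb H (Tgt Y\<^sub>1 u)) \<cdot>\<^bsub>Y\<^esub> FAr F (FAr H u) = FAr F' (FAr H u) \<cdot>\<^bsub>Y\<^esub> \<eta> (FOb H (Src Y\<^sub>1 u))"
    if "u \<in> Arr Y\<^sub>1" for u
    using e(5)[of "FAr H u"] m that by simp
  then show ?thesis
    using m e(1-4) by (auto simp: two_morphism_def whisker_right_def Hom_over_def Hom_def)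
qed

end

section \<open>Lifting the action to a gerbe induced from the invariants\<close>

context induced_gerbe
begin

text \<open>Relative to \<open>v\<close> itself the coordinate is the unit. That arrows from
  \<open>Ybar\<close> stay fixed is what will make the composite of \<open>F\<^sub>g\<close> with
  \<Theta> isomorphic to \<Theta>.\<close>

lemma twist_theta:
  assumes v: "v \<in> Arr Ybar" and g: "g \<in> carrier G"
  shows "twist g (Src Ybar v) (Tgt Ybar v) (FAr \<Theta> v) = FAr \<Theta> v"
proof -
  let ?V = "POb Ybar (Src Ybar v)" and ?z = "FOb \<Theta> (Src Ybar v)"
  have s: "Src Ybar v \<in> Obj Ybar" "?V \<in> Obj C" using v by auto
  interpret A: comm_group "Grp A ?V" using s by simp
  have one: "Band Y ?z \<one>\<^bsub>Grp A ?V\<^esub> = Idn Y ?z"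
    using Y.band_one[of ?z] s by simp
  have "\<phi> g ?V \<one>\<^bsub>Grp A ?V\<^esub> = \<one>\<^bsub>Grp A ?V\<^esub>"
    using hom_one[OF phi_hom[OF g s(2)]] s by simp
  then show ?thesis
    using twist_base[OF v A.one_closed g] one v by simp
qed

lemma twist_idn:
  "\<lbrakk>z \<in> Obj Ybar; g \<in> carrier G\<rbrakk> \<Longrightarrow> twist g z z (Idn Y (FOb \<Theta> z)) = Idn Y (FOb \<Theta> z)"
  using twist_theta[of "Idn Ybar z" g] by simp

text \<open>A \<open>g\<close>-semilinear isomorphism from \<open>x\<close> to \<open>x'\<close> is encoded by its effect \<open>\<sigma> z p\<close> on the
  arrows \<open>p\<close> from \<open>\<Theta> z\<close> to \<open>x\<close>.\<close>

definition semilinear :: "'g \<Rightarrow> 'e \<Rightarrow> 'e \<Rightarrow> ('d \<Rightarrow> 't \<Rightarrow> 't) \<Rightarrow> bool" where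
  "semilinear g x x' \<sigma> \<longleftrightarrow> x \<in> Obj Y \<and> x' \<in> Obj Y \<and> POb Y x' = POb Y x \<and>
     (\<forall>z p. probe z p x \<longrightarrow> probe z (\<sigma> z p) x' \<and> PAr Y (\<sigma> z p) = PAr Y p) \<and>
     (\<forall>z p y w. probe z p x \<and> theta_arrow y z w \<longrightarrow> \<sigma> y (p \<cdot> w) = \<sigma> z p \<cdot> twist g y z w)"

lemma probe_cmp: "\<lbrakk>probe z p x; theta_arrow y z w\<rbrakk> \<Longrightarrow> probe y (p \<cdot> w) x"
  by (auto simp: probe_def theta_arrow_def)

lemma theta_arrow_probe: "theta_arrow y z w \<longleftrightarrow> z \<in> Obj Ybar \<and> probe y w (FOb \<Theta> z)"
  by (auto simp: probe_def theta_arrow_def)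

text \<open>Multiplicativity of \<open>twist\<close> read as semilinearity. Through it
  \<open>glue_semilinear\<close> also yields arrows out of \<open>\<Theta> z\<close> whose values
  are prescribed on twisted probes.\<close>

lemma semilinear_twist:
  assumes z: "z \<in> Obj Ybar" and g: "g \<in> carrier G"
  shows "semilinear g (FOb \<Theta> z) (FOb \<Theta> z) (\<lambda>y p. twist g y z p)"
  unfolding semilinear_def
proof (intro conjI allI impI)
  fix y p assume "probe y p (FOb \<Theta> z)"
  then have p: "theta_arrow y z p" using z by (simp add: theta_arrow_probe)
  show "probe y (twist g y z p) (FOb \<Theta> z)" "PAr Y (twist g y z p) = PAr Y p"
    using twist_arrow[OF p g] twist_par[OF p g] by (simp_all add: theta_arrow_probe)
next
  fix y p y' w assume "probe y p (FOb \<Theta> z) \<and> theta_arrow y' y w"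
  then show "twist g y' z (p \<cdot> w) = twist g y z p \<cdot> twist g y' y w"
    using twist_cmp[of y' y w z p g] z g by (simp add: theta_arrow_probe)
qed (use z in auto)

text \<open>The arrows \<open>\<sigma> z p\<close> are probes of \<open>x'\<close> with the same
  projections as the \<open>p\<close>, so they cover \<open>x'\<close>.\<close>

lemma semilinear_eq:
  assumes s: "semilinear g x x' \<sigma>" and m: "m \<in> Arr Y" "m' \<in> Arr Y" "Src Y m = x'" "Src Y m' = x'"
      "Tgt Y m = Tgt Y m'" "PAr Y m = PAr Y m'"
    and eq: "\<And>z p. probe z p x \<Longrightarrow> m \<cdot> \<sigma> z p = m' \<cdot> \<sigma> z p"
  shows "m = m'"
proof -
  note s = s[unfolded semilinear_def]
  obtain R where R: "R \<in> Cov C (POb Y x)" "\<And>h. h \<in> R \<Longrightarrow> \<exists>z p. probe z p x \<and> PAr Y p = h"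
    using local_probe s by blast
  show ?thesis
  proof (rule Y.arrow_eq_local)
    fix h assume "h \<in> R"
    then obtain z p where p: "probe z p x" "PAr Y p = h" using R by blast
    then have "probe z (\<sigma> z p) x'" "PAr Y (\<sigma> z p) = h" using s by auto
    then show "\<exists>p \<in> Arr Y. Tgt Y p = Src Y m \<and> PAr Y p = h \<and> m \<cdot> p = m' \<cdot> p"
      using m eq[OF p(1)] by (intro bexI[of _ "\<sigma> z p"]) (auto simp: probe_def)
  qed (use m s R in auto)
qed

text \<open>The point is that compatibility is asked only for relations among the probes
  \<open>p i\<close> of \<open>x\<close>, not among their images in \<open>x'\<close>: semilinearity
  identifies the latter with twists of the former.\<close>

lemma glue_semilinear:
  assumes sl: "semilinear g x x' \<sigma>" and g: "g \<in> carrier G" and x2: "x2 \<in> Obj Y"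
    and f: "f \<in> Arr C" "Src C f = POb Y x" "Tgt C f = POb Y x2"
    and p: "\<And>i. i \<in> I \<Longrightarrow> probe (z i) (p i) x"
    and t: "\<And>i. i \<in> I \<Longrightarrow> t i \<in> Arr Y \<and> Tgt Y (t i) = x2 \<and> Src Y (t i) = FOb \<Theta> (z i) \<and>
              PAr Y (t i) = f \<cdot>\<^bsub>C\<^esub> PAr Y (p i)"
    and R: "R \<in> Cov C (POb Y x)" and cov: "\<And>h. h \<in> R \<Longrightarrow> \<exists>i \<in> I. PAr Y (p i) = h"
    and compat: "\<And>i j y w w'. \<lbrakk>i \<in> I; j \<in> I; theta_arrow y (z i) w; theta_arrow y (z j) w';
          p i \<cdot> w = p j \<cdot> w'\<rbrakk>
             \<Longrightarrow> t i \<cdot> twist g y (z i) w = t j \<cdot> twist g y (z j) w'"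
  shows "\<exists>!m. m \<in> Hom_over Y f x' x2 \<and> (\<forall>i \<in> I. m \<cdot> \<sigma> (z i) (p i) = t i)"
proof (rule Y.glue_from_probes[where s = "\<lambda>i. \<sigma> (z i) (p i)" and t = t and R = R])
  note s = sl[unfolded semilinear_def]
  have sig: "probe (z i) (\<sigma> (z i) (p i)) x' \<and> PAr Y (\<sigma> (z i) (p i)) = PAr Y (p i)" if "i \<in> I" for i
    using s p[OF that] by auto
  show "x' \<in> Obj Y" "Src C f = POb Y x'" "R \<in> Cov C (POb Y x')" using s f R by auto
  show "\<sigma> (z i) (p i) \<in> Arr Y \<and> Tgt Y (\<sigma> (z i) (p i)) = x'" if "i \<in> I" for i
    using sig[OF that] by (auto simp: probe_def)
  show "t i \<in> Arr Y \<and> Tgt Y (t i) = x2 \<and> Src Y (t i) = Src Y (\<sigma> (z i) (p i)) \<and>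
              PAr Y (t i) = f \<cdot>\<^bsub>C\<^esub> PAr Y (\<sigma> (z i) (p i))" if "i \<in> I" for i
    using sig[OF that] t[OF that] by (auto simp: probe_def)
  show "\<exists>i \<in> I. PAr Y (\<sigma> (z i) (p i)) = h" if "h \<in> R" for h
    using cov[OF that] sig by auto
  fix i j v w
  assume ij: "i \<in> I" "j \<in> I" and v: "v \<in> Arr Y" "Tgt Y v = Src Y (\<sigma> (z i) (p i))"
    and w: "w \<in> Arr Y" "Tgt Y w = Src Y (\<sigma> (z j) (p j))" and vw: "Src Y v = Src Y w"
    and eq: "\<sigma> (z i) (p i) \<cdot> v = \<sigma> (z j) (p j) \<cdot> w"
  note pi = p[OF ij(1), unfolded probe_def] p[OF ij(2), unfolded probe_def]
  note si = sig[OF ij(1), unfolded probe_def] sig[OF ij(2), unfolded probe_def]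
  note ti = t[OF ij(1)] t[OF ij(2)]
  have tv: "Tgt Y v = FOb \<Theta> (z i)" "Tgt Y w = FOb \<Theta> (z j)" using v w si by auto
  have pv: "Tgt C (PAr Y v) = POb Ybar (z i)" "Tgt C (PAr Y w) = POb Ybar (z j)"
    using Y.tgt_par[OF v(1)] Y.tgt_par[OF w(1)] tv pi by auto
  have obj: "Src Y v \<in> Obj Y" using v by auto
  have peq: "PAr Y (p i) \<cdot>\<^bsub>C\<^esub> PAr Y v = PAr Y (p j) \<cdot>\<^bsub>C\<^esub> PAr Y w"
    using arg_cong[OF eq, of "PAr Y"] si v w by simp
  obtain n where n: "n \<in> Arr Ybar" "Tgt Ybar n = z i" "PAr Ybar n = PAr Y v"
      "POb Ybar (Src Ybar n) = POb Y (Src Y v)"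
    using Yb.pullback[of "z i" "PAr Y v"] pi v pv by auto
  let ?y = "Src Ybar n"
  obtain k where k: "k \<in> Arr Y" "Src Y k = Src Y v" "Tgt Y k = FOb \<Theta> ?y"
      "PAr Y k = Idn C (POb Y (Src Y v))" "FAr \<Theta> n \<cdot> k = v"
    using Y.factor[of "FAr \<Theta> n" v "Idn C (POb Y (Src Y v))"] n v tv obj pi by auto
  have n': "theta_arrow ?y (z i) (FAr \<Theta> n)"
    using n pi by (auto simp: theta_arrow_def)
  have twn: "twist g ?y (z i) (FAr \<Theta> n) = FAr \<Theta> n"
    using twist_theta[OF n(1) g] n by simp
  \<comment> \<open>The relation in \<open>x'\<close> is carried back to \<open>x\<close>:
    \<open>q\<close> solves \<open>p j \<cdot> q = p i \<cdot> \<Theta> n\<close> there. By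
    semilinearity its twist, corrected by the vertical arrow \<open>k\<close>, is
    \<open>w\<close>.\<close>
  obtain q where q: "q \<in> Arr Y" "Src Y q = FOb \<Theta> ?y" "Tgt Y q = FOb \<Theta> (z j)" "PAr Y q = PAr Y w"
      "p j \<cdot> q = p i \<cdot> FAr \<Theta> n"
    using Y.factor[of "p j" "p i \<cdot> FAr \<Theta> n" "PAr Y w"] pi n w pv vw peq by auto
  have q': "theta_arrow ?y (z j) q" using q n' pi by (auto simp: theta_arrow_def)
  note twq = twist_arrow[OF q' g, unfolded theta_arrow_def]
  have sq: "\<sigma> (z j) (p j) \<cdot> twist g ?y (z j) q = \<sigma> (z i) (p i) \<cdot> FAr \<Theta> n"
    using s p[OF ij(1)] p[OF ij(2)] n' q' q(5) twn by metis
  have qk: "twist g ?y (z j) q \<cdot> k = w"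
  proof (rule Y.cancel[of "\<sigma> (z j) (p j)"])
    show "\<sigma> (z j) (p j) \<cdot> (twist g ?y (z j) q \<cdot> k) = \<sigma> (z j) (p j) \<cdot> w"
      using si twq k n by (simp add: Y.total.reassoc[OF sq] eq)
    show "PAr Y (twist g ?y (z j) q \<cdot> k) = PAr Y w"
      using twq k w q vw twist_par[OF q' g] by simp
  qed (use si twq k w vw in auto)
  have "t i \<cdot> v = (t i \<cdot> twist g ?y (z i) (FAr \<Theta> n)) \<cdot> k"
    unfolding twn using ti n k by simp
  also have "\<dots> = (t j \<cdot> twist g ?y (z j) q) \<cdot> k"
    using compat[OF ij n' q'] q by simp
  also have "\<dots> = t j \<cdot> w"
    using ti twq k qk by simp
  finally show "t i \<cdot> v = t j \<cdot> w" .
qed (use x2 f in auto)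

text \<open>The prescribed values are compatible since \<open>\<sigma>2\<close> turns composition
  with an arrow into composition with its twist. This yields the functors on arrows and, for
  identities \<open>u\<close>, the comparison of two lifts.\<close>

lemma semilinear_compare:
  assumes s1: "semilinear g x1 x1' \<sigma>1" and s2: "semilinear g x2 x2' \<sigma>2" and g: "g \<in> carrier G"
    and u: "u \<in> Arr Y" "Src Y u = x1" "Tgt Y u = x2"
  obtains m where "m \<in> Arr Y" "Src Y m = x1'" "Tgt Y m = x2'" "PAr Y m = PAr Y u"
    "\<And>z p. probe z p x1 \<Longrightarrow> m \<cdot> \<sigma>1 z p = \<sigma>2 z (u \<cdot> p)"
proof -
  note S1 = s1[unfolded semilinear_def] and S2 = s2[unfolded semilinear_def]
  obtain R where R: "R \<in> Cov C (POb Y x1)" "\<And>h. h \<in> R \<Longrightarrow> \<exists>z p. probe z p x1 \<and> PAr Y p = h"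
    using local_probe S1 by blast
  have up: "probe z (u \<cdot> p) x2" if "probe z p x1" for z p
    using that u by (auto simp: probe_def)
  have "\<exists>!m. m \<in> Hom_over Y (PAr Y u) x1' x2' \<and>
      (\<forall>i \<in> {(z, p). probe z p x1}. m \<cdot> \<sigma>1 (fst i) (snd i) = \<sigma>2 (fst i) (u \<cdot> snd i))"
  proof (rule glue_semilinear[OF s1 g, where R = R])
    fix i assume "i \<in> {(z, p). probe z p x1}"
    then have i: "probe (fst i) (snd i) x1" by auto
    note 1 = up[OF i]
    have "probe (fst i) (\<sigma>2 (fst i) (u \<cdot> snd i)) x2'" "PAr Y (\<sigma>2 (fst i) (u \<cdot> snd i)) = PAr Y (u \<cdot> snd i)"
      using S2 1 by auto
    then show "\<sigma>2 (fst i) (u \<cdot> snd i) \<in> Arr Y \<and> Tgt Y (\<sigma>2 (fst i) (u \<cdot> snd i)) = x2' \<and>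
        Src Y (\<sigma>2 (fst i) (u \<cdot> snd i)) = FOb \<Theta> (fst i) \<and>
        PAr Y (\<sigma>2 (fst i) (u \<cdot> snd i)) = PAr Y u \<cdot>\<^bsub>C\<^esub> PAr Y (snd i)"
      using i u by (auto simp: probe_def)
  next
    fix i j y w w'
    assume "i \<in> {(z, p). probe z p x1}" "j \<in> {(z, p). probe z p x1}"
    then have i: "probe (fst i) (snd i) x1" and j: "probe (fst j) (snd j) x1" by auto
    assume w: "theta_arrow y (fst i) w" "theta_arrow y (fst j) w'" and eq: "snd i \<cdot> w = snd j \<cdot> w'"
    have "\<sigma>2 (fst i) (u \<cdot> snd i) \<cdot> twist g y (fst i) w = \<sigma>2 y ((u \<cdot> snd i) \<cdot> w)"
      using S2 up[OF i] w by simp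
    also have "\<dots> = \<sigma>2 y ((u \<cdot> snd j) \<cdot> w')"
      using i j w u eq by (simp add: probe_def theta_arrow_def)
    also have "\<dots> = \<sigma>2 (fst j) (u \<cdot> snd j) \<cdot> twist g y (fst j) w'"
      using S2 up[OF j] w by simp
    finally show "\<sigma>2 (fst i) (u \<cdot> snd i) \<cdot> twist g y (fst i) w =
        \<sigma>2 (fst j) (u \<cdot> snd j) \<cdot> twist g y (fst j) w'" .
  next
    fix h assume "h \<in> R"
    then show "\<exists>i\<in>{(z, p). probe z p x1}. PAr Y (snd i) = h" using R(2) by fastforce
  qed (use S1 S2 R u in auto)
  then obtain m where m: "m \<in> Hom_over Y (PAr Y u) x1' x2'"
      "\<forall>i \<in> {(z, p). probe z p x1}. m \<cdot> \<sigma>1 (fst i) (snd i) = \<sigma>2 (fst i) (u \<cdot> snd i)"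
    by (elim ex1E conjE)
  show thesis
  proof (rule that)
    show "m \<cdot> \<sigma>1 z p = \<sigma>2 z (u \<cdot> p)" if "probe z p x1" for z p
      using m(2)[rule_format, of "(z, p)"] that by simp
  qed (use m(1) in \<open>auto simp: Hom_over_def Hom_def\<close>)
qed

text \<open>The glued twisted datum comes with arrows \<open>a h\<close>, which give
  \<open>\<sigma>\<close> only on the chosen probes \<open>P h\<close>. An arbitrary probe factors
  locally as \<open>P h \<cdot> u\<close>, where the value must be \<open>a h\<close> composed with
  the twist of \<open>u\<close>; these values are shown to be consistent and then glued.\<close>

lemma semilinear_exists:
  assumes x: "x \<in> Obj Y" and g: "g \<in> carrier G"
  obtains x' \<sigma> where "semilinear g x x' \<sigma>"
proof -
  let ?U = "POb Y x"
  have U: "?U \<in> Obj C" using x by simp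
  obtain R where R: "R \<in> Cov C ?U" "\<And>h. h \<in> R \<Longrightarrow> \<exists>z p. probe z p x \<and> PAr Y p = h"
    using local_probe[OF x] by blast
  let ?S = "generated_sieve C R"
  have "\<exists>zp. \<forall>h\<in>?S. probe (fst (zp h)) (snd (zp h)) x \<and> PAr Y (snd (zp h)) = h"
  proof (rule bchoice, rule ballI)
    fix h assume "h \<in> ?S"
    then obtain r k where r: "r \<in> R" and k: "k \<in> Arr C" "Tgt C k = Src C r" "h = r \<cdot>\<^bsub>C\<^esub> k"
      by (auto simp: generated_sieve_def)
    obtain z p where p: "probe z p x" "PAr Y p = r" using R(2)[OF r] by blast
    note p' = p(1)[unfolded probe_def]
    have "Src C r = POb Ybar z" using Y.src_par[of p] p' p(2) by auto
    then obtain n where n: "n \<in> Arr Ybar" "Tgt Ybar n = z" "PAr Ybar n = k"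
      using Yb.pullback[of z k] p' k by auto
    then show "\<exists>zp. probe (fst zp) (snd zp) x \<and> PAr Y (snd zp) = h"
      using p p' k by (intro exI[of _ "(Src Ybar n, p \<cdot> FAr \<Theta> n)"]) (auto simp: probe_def)
  qed
  then obtain zp where zp: "\<And>h. h \<in> ?S \<Longrightarrow> probe (fst (zp h)) (snd (zp h)) x \<and> PAr Y (snd (zp h)) = h"
    by blast
  define Z where "Z h = fst (zp h)" for h
  define P where "P h = snd (zp h)" for h
  have P: "probe (Z h) (P h) x" "PAr Y (P h) = h" if "h \<in> ?S" for h
    using zp[OF that] by (auto simp: Z_def P_def)
  have P': "P h \<in> Arr Y \<and> Tgt Y (P h) = x \<and> PAr Y (P h) = h" "Src Y (P h) = FOb \<Theta> (Z h)" "Z h \<in> Obj Ybar"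
      "POb Ybar (Z h) = Src C h" if "h \<in> ?S" for h
    using P[OF that] Y.src_par[of "P h"] by (auto simp: probe_def)
  obtain d0 where dd0: "descent_datum C Y ?S (\<lambda>h. Src Y (P h)) d0"
    and d0: "\<And>h k. \<lbrakk>h \<in> ?S; k \<in> Arr C; Tgt C k = Src C h\<rbrakk> \<Longrightarrow>
       d0 h k \<in> Arr Y \<and> Src Y (d0 h k) = Src Y (P (h \<cdot>\<^bsub>C\<^esub> k)) \<and> Tgt Y (d0 h k) = Src Y (P h) \<and>
       PAr Y (d0 h k) = k \<and> P h \<cdot> d0 h k = P (h \<cdot>\<^bsub>C\<^esub> k)"
    using Y.restriction_datum[OF U R(1) x refl P'(1)] by metis
  have ta: "theta_arrow (Z (h \<cdot>\<^bsub>C\<^esub> k)) (Z h) (d0 h k)" "PAr Y (d0 h k) = k"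
      "P h \<cdot> d0 h k = P (h \<cdot>\<^bsub>C\<^esub> k)"
    if "h \<in> ?S" "k \<in> Arr C" "Tgt C k = Src C h" for h k
    using d0[OF that] P'(2,3)[OF sieve_cmp[OF U R(1) that]] P'(2,3)[OF that(1)] by (auto simp: theta_arrow_def)
  define D where "D h = FOb \<Theta> (Z h)" for h
  define d where "d h k = twist g (Z (h \<cdot>\<^bsub>C\<^esub> k)) (Z h) (d0 h k)" for h k
  have dd: "descent_datum C Y ?S D d"
    unfolding descent_datum_def
  proof (intro conjI ballI impI)
    fix h assume h: "h \<in> ?S"
    note harr = sieve_arr[OF U R(1) h]
    show "D h \<in> Obj Y" "POb Y (D h) = Src C h" using P'[OF h] by (auto simp: D_def)
    have hi: "h \<cdot>\<^bsub>C\<^esub> Idn C (Src C h) = h" using harr by simp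
    have "d0 h (Idn C (Src C h)) = Idn Y (FOb \<Theta> (Z h))"
      using dd0 h P'(2)[OF h] by (auto simp: descent_datum_def)
    then show "d h (Idn C (Src C h)) = Idn Y (D h)"
      using twist_idn[OF P'(3)[OF h] g] by (simp add: d_def D_def hi)
    fix k assume k: "k \<in> Arr C"
    show "d h k \<in> Hom_over Y k (D (h \<cdot>\<^bsub>C\<^esub> k)) (D h)" if "Tgt C k = Src C h"
      using twist_arrow[OF ta(1)[OF h k that] g] twist_par[OF ta(1)[OF h k that] g] ta(2)[OF h k that]
      by (auto simp: d_def D_def theta_arrow_def Hom_over_def Hom_def)
    fix l assume l: "l \<in> Arr C" and kl: "Tgt C k = Src C h \<and> Tgt C l = Src C k"
    have hk: "h \<cdot>\<^bsub>C\<^esub> k \<in> ?S" "Src C (h \<cdot>\<^bsub>C\<^esub> k) = Src C k" using sieve_cmp[OF U R(1) h] k kl harr by auto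
    have as: "(h \<cdot>\<^bsub>C\<^esub> k) \<cdot>\<^bsub>C\<^esub> l = h \<cdot>\<^bsub>C\<^esub> (k \<cdot>\<^bsub>C\<^esub> l)" using harr k l kl by simp
    have "d0 h (k \<cdot>\<^bsub>C\<^esub> l) = d0 h k \<cdot> d0 (h \<cdot>\<^bsub>C\<^esub> k) l"
      using dd0 h k l kl by (auto simp: descent_datum_def)
    moreover have "theta_arrow (Z (h \<cdot>\<^bsub>C\<^esub> (k \<cdot>\<^bsub>C\<^esub> l))) (Z (h \<cdot>\<^bsub>C\<^esub> k)) (d0 (h \<cdot>\<^bsub>C\<^esub> k) l)"
      using ta(1)[OF hk(1) l] hk kl as by simp
    ultimately show "d h (k \<cdot>\<^bsub>C\<^esub> l) = d h k \<cdot> d (h \<cdot>\<^bsub>C\<^esub> k) l"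
      using twist_cmp[OF _ ta(1)[OF h k] g, of "Z (h \<cdot>\<^bsub>C\<^esub> (k \<cdot>\<^bsub>C\<^esub> l))" "d0 (h \<cdot>\<^bsub>C\<^esub> k) l"] kl as
      by (simp add: d_def)
  qed
  obtain x' a where gl: "glues C Y ?U ?S D d x' a"
    using Y.effective[OF U R(1) dd] by blast
  have x': "x' \<in> Obj Y" "POb Y x' = ?U" using gl by (auto simp: glues_def)
  have a: "a h \<in> Arr Y" "Src Y (a h) = FOb \<Theta> (Z h)" "Tgt Y (a h) = x'" "PAr Y (a h) = h"
    if "h \<in> ?S" for h
    using gl that by (auto simp: glues_def D_def Hom_over_def Hom_def)
  have ad: "a h \<cdot> d h k = a (h \<cdot>\<^bsub>C\<^esub> k)" if "h \<in> ?S" "k \<in> Arr C" "Tgt C k = Src C h" for h k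
    using gl that by (auto simp: glues_def)
  \<comment> \<open>Writing \<open>u\<close> as a transition arrow composed with the vertical
    \<open>w\<close>, the transition arrow is absorbed into \<open>a H\<close>. The resulting form
    depends on \<open>h\<close> and \<open>u\<close> only through
    \<open>P h \<cdot> u\<close>.\<close>
  have normal: "a h \<cdot> twist g y (Z h) u = a H \<cdot> twist g y (Z H) w"
    if h: "h \<in> ?S" and u: "theta_arrow y (Z h) u" and H: "H = h \<cdot>\<^bsub>C\<^esub> PAr Y u"
      and w: "theta_arrow y (Z H) w" "PAr Y w = Idn C (POb Ybar y)" "P H \<cdot> w = P h \<cdot> u"
    for h y u H w
  proof -
    let ?k = "PAr Y u"
    note u' = u[unfolded theta_arrow_def] and w' = w(1)[unfolded theta_arrow_def]
    have k: "?k \<in> Arr C" "Tgt C ?k = Src C h" "Src C ?k = POb Ybar y"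
      using u' P'(4)[OF h] by auto
    note t = ta[OF h k(1,2), folded H]
    note t' = t(1)[unfolded theta_arrow_def]
    have "u = d0 h ?k \<cdot> w"
    proof (rule Y.cancel[of "P h"])
      show "P h \<cdot> u = P h \<cdot> (d0 h ?k \<cdot> w)"
        using t' w' P'(1,2)[OF h] w(3) by (simp add: Y.total.reassoc[OF t(3)])
      show "PAr Y u = PAr Y (d0 h ?k \<cdot> w)"
        using t' w' w(2) t(2) k by simp
    qed (use u' w' t' P'(1,2)[OF h] in auto)
    then have "twist g y (Z h) u = d h ?k \<cdot> twist g y (Z H) w"
      using twist_cmp[OF w(1) t(1) g] by (simp add: d_def H)
    then show ?thesis
      using twist_arrow[OF w(1) g, unfolded theta_arrow_def] twist_arrow[OF t(1) g, unfolded theta_arrow_def]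
        a[OF h] ad[OF h k(1,2)]
      by (simp add: Y.total.reassoc[OF ad[OF h k(1,2), unfolded d_def]] d_def H)
  qed
  have lift: "\<exists>w. theta_arrow y (Z h) w \<and> PAr Y w = Idn C (POb Ybar y) \<and> P h \<cdot> w = q"
    if q: "probe y q x" and h: "PAr Y q = h" "h \<in> ?S" for q y h
    using Y.factor[of "P h" q "Idn C (POb Ybar y)"] q h P'[OF h(2)] Y.src_par[of q] sieve_arr[OF U R(1) h(2)]
    by (simp add: probe_def theta_arrow_def) metis
  have consistent: "a h1 \<cdot> twist g y (Z h1) u1 = a h2 \<cdot> twist g y (Z h2) u2"
    if h: "h1 \<in> ?S" "h2 \<in> ?S" and u: "theta_arrow y (Z h1) u1" "theta_arrow y (Z h2) u2"
      and eq: "P h1 \<cdot> u1 = P h2 \<cdot> u2" for h1 h2 y u1 u2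
  proof -
    let ?H = "h1 \<cdot>\<^bsub>C\<^esub> PAr Y u1"
    note u' = u[unfolded theta_arrow_def]
    have 1: "PAr Y (P h1 \<cdot> u1) = ?H" using u' P'(1,2)[OF h(1)] by simp
    have 2: "PAr Y (P h2 \<cdot> u2) = h2 \<cdot>\<^bsub>C\<^esub> PAr Y u2" using u' P'(1,2)[OF h(2)] by simp
    have H: "?H \<in> ?S" using sieve_cmp[OF U R(1) h(1), of "PAr Y u1"] u' P'(4)[OF h(1)] by simp
    obtain w where w: "theta_arrow y (Z ?H) w" "PAr Y w = Idn C (POb Ybar y)" "P ?H \<cdot> w = P h1 \<cdot> u1"
      using lift[OF probe_cmp[OF P(1)[OF h(1)] u(1)] 1 H] by blast
    show ?thesis
      using normal[OF h(1) u(1) refl w] normal[OF h(2) u(2) _ w(1,2)] w(3) eq 1 2 by simp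
  qed
  \<comment> \<open>An index records an arrow \<open>q\<close> into \<open>\<Theta> z\<close> along
    which \<open>p\<close> factors through a chosen probe. The value on the twist of
    \<open>q\<close> is then forced to be \<open>t\<close>.\<close>
  define I where "I z p = {(h, y, q, u). h \<in> ?S \<and> theta_arrow y z q \<and> theta_arrow y (Z h) u \<and>
      p \<cdot> q = P h \<cdot> u}" for z p
  define t where "t i = (case i of (h, y, q, u) \<Rightarrow> a h \<cdot> twist g y (Z h) u)" for i :: "'m \<times> 'd \<times> 't \<times> 't"
  have ex: "\<exists>!m. m \<in> Hom_over Y (PAr Y p) (FOb \<Theta> z) x' \<and>
      (\<forall>i \<in> I z p. m \<cdot> twist g (fst (snd i)) z (fst (snd (snd i))) = t i)" if p: "probe z p x" for z p
  proof -
    note p' = p[unfolded probe_def]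
    have z: "z \<in> Obj Ybar" using p' by simp
    have pz: "PAr Y p \<in> Hom C (POb Ybar z) ?U" using p' by (auto simp: Hom_def)
    obtain T where T: "T \<in> Cov C (POb Ybar z)"
      "\<forall>h \<in> T. \<exists>r \<in> R. \<exists>l \<in> Hom C (Src C h) (Src C r). PAr Y p \<cdot>\<^bsub>C\<^esub> h = r \<cdot>\<^bsub>C\<^esub> l"
      using cov_stable[OF R(1) pz] by blast
    show ?thesis
    proof (rule glue_semilinear[OF semilinear_twist[OF z g] g, where R = T])
      fix i assume i: "i \<in> I z p"
      obtain h y q u where i': "i = (h, y, q, u)" by (cases i)
      have h: "h \<in> ?S" and q: "theta_arrow y z q" and u: "theta_arrow y (Z h) u" and e: "p \<cdot> q = P h \<cdot> u"
        using i by (auto simp: I_def i')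
      show "probe (fst (snd i)) (fst (snd (snd i))) (FOb \<Theta> z)"
        using q by (simp add: i' theta_arrow_probe)
      have "PAr Y p \<cdot>\<^bsub>C\<^esub> PAr Y q = h \<cdot>\<^bsub>C\<^esub> PAr Y u"
        using arg_cong[OF e, of "PAr Y"] p' q u P'(1,2)[OF h] by (simp add: theta_arrow_def)
      then show "t i \<in> Arr Y \<and> Tgt Y (t i) = x' \<and> Src Y (t i) = FOb \<Theta> (fst (snd i)) \<and>
          PAr Y (t i) = PAr Y p \<cdot>\<^bsub>C\<^esub> PAr Y (fst (snd (snd i)))"
        using twist_arrow[OF u g] twist_par[OF u g] a[OF h] by (simp add: i' t_def theta_arrow_def)
    next
      fix k assume k: "k \<in> T"
      then obtain r l where r: "r \<in> R" "l \<in> Arr C" "Src C l = Src C k" "Tgt C l = Src C r" "PAr Y p \<cdot>\<^bsub>C\<^esub> k = r \<cdot>\<^bsub>C\<^esub> l"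
        using T by (auto simp: Hom_def)
      have karr: "k \<in> Arr C" "Tgt C k = POb Ybar z" using cov_arr[OF _ T(1) k] z by auto
      have S: "r \<cdot>\<^bsub>C\<^esub> l \<in> ?S" using r by (auto simp: generated_sieve_def)
      obtain n where n: "n \<in> Arr Ybar" "Tgt Ybar n = z" "PAr Ybar n = k"
        using Yb.pullback[OF z karr] by blast
      have q: "theta_arrow (Src Ybar n) z (FAr \<Theta> n)" using n z by (auto simp: theta_arrow_def)
      obtain w where "theta_arrow (Src Ybar n) (Z (r \<cdot>\<^bsub>C\<^esub> l)) w" "P (r \<cdot>\<^bsub>C\<^esub> l) \<cdot> w = p \<cdot> FAr \<Theta> n"
        using lift[OF probe_cmp[OF p q] _ S] p' n r by auto
      then show "\<exists>i\<in>I z p. PAr Y (fst (snd (snd i))) = k"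
        using q S n by (intro bexI[of _ "(r \<cdot>\<^bsub>C\<^esub> l, Src Ybar n, FAr \<Theta> n, w)"]) (auto simp: I_def)
    next
      fix i j y w w' assume i: "i \<in> I z p" and j: "j \<in> I z p"
      assume w: "theta_arrow y (fst (snd i)) w" "theta_arrow y (fst (snd j)) w'"
        and eq: "fst (snd (snd i)) \<cdot> w = fst (snd (snd j)) \<cdot> w'"
      obtain h1 y1 q1 u1 where i': "i = (h1, y1, q1, u1)" by (cases i)
      obtain h2 y2 q2 u2 where j': "j = (h2, y2, q2, u2)" by (cases j)
      have h: "h1 \<in> ?S" "h2 \<in> ?S" and q: "theta_arrow y1 z q1" "theta_arrow y2 z q2"
        and u: "theta_arrow y1 (Z h1) u1" "theta_arrow y2 (Z h2) u2"
        and e: "p \<cdot> q1 = P h1 \<cdot> u1" "p \<cdot> q2 = P h2 \<cdot> u2"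
        using i j by (auto simp: I_def i' j')
      have w1: "theta_arrow y y1 w" "theta_arrow y y2 w'" using w by (auto simp: i' j')
      have uw: "theta_arrow y (Z h1) (u1 \<cdot> w)" "theta_arrow y (Z h2) (u2 \<cdot> w')"
        using w1 u by (auto simp: theta_arrow_def)
      note TA = w1[unfolded theta_arrow_def] u[unfolded theta_arrow_def] q[unfolded theta_arrow_def]
      have "P h1 \<cdot> (u1 \<cdot> w) = p \<cdot> (q1 \<cdot> w)"
        using TA p' P'(1,2)[OF h(1)] by (simp add: Y.total.reassoc[OF e(1)])
      also have "\<dots> = p \<cdot> (q2 \<cdot> w')"
        using eq by (simp add: i' j')
      also have "\<dots> = P h2 \<cdot> (u2 \<cdot> w')"
        using TA p' P'(1,2)[OF h(2)] by (simp add: Y.total.reassoc[OF e(2)])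
      finally have "a h1 \<cdot> twist g y (Z h1) (u1 \<cdot> w) = a h2 \<cdot> twist g y (Z h2) (u2 \<cdot> w')"
        using consistent[OF h uw] by blast
      then show "t i \<cdot> twist g y (fst (snd i)) w = t j \<cdot> twist g y (fst (snd j)) w'"
        using twist_cmp[OF w1(1) u(1) g] twist_cmp[OF w1(2) u(2) g] a[OF h(1)] a[OF h(2)]
          twist_arrow[OF w1(1) g] twist_arrow[OF w1(2) g] twist_arrow[OF u(1) g] twist_arrow[OF u(2) g]
        by (simp add: i' j' t_def theta_arrow_def)
    qed (use z x' pz T in \<open>auto simp: Hom_def\<close>)
  qed
  define \<sigma> where "\<sigma> z p = (THE m. m \<in> Hom_over Y (PAr Y p) (FOb \<Theta> z) x' \<and>
      (\<forall>i \<in> I z p. m \<cdot> twist g (fst (snd i)) z (fst (snd (snd i))) = t i))" for z p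
  note \<sigma> = theI'[OF ex, folded \<sigma>_def]
  have "semilinear g x x' \<sigma>"
    unfolding semilinear_def
  proof (intro conjI allI impI)
    fix z p assume p: "probe z p x"
    show "probe z (\<sigma> z p) x'" "PAr Y (\<sigma> z p) = PAr Y p"
      using \<sigma>[OF p] p by (auto simp: probe_def Hom_over_def Hom_def)
  next
    fix z p y w assume "probe z p x \<and> theta_arrow y z w"
    then have p: "probe z p x" and w: "theta_arrow y z w" by auto
    note pw = probe_cmp[OF p w] and tw = twist_arrow[OF w g]
    have s: "\<sigma> z p \<in> Arr Y" "Src Y (\<sigma> z p) = FOb \<Theta> z" "Tgt Y (\<sigma> z p) = x'" "PAr Y (\<sigma> z p) = PAr Y p"
      and si: "\<And>i. i \<in> I z p \<Longrightarrow> \<sigma> z p \<cdot> twist g (fst (snd i)) z (fst (snd (snd i))) = t i"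
      using \<sigma>[OF p] by (auto simp: Hom_over_def Hom_def)
    \<comment> \<open>Semilinearity follows from uniqueness of the gluing: an index
      \<open>(h, v, q, u)\<close> for \<open>p \<cdot> w\<close> becomes the index
      \<open>(h, v, w \<cdot> q, u)\<close> for \<open>p\<close>.\<close>
    have "\<sigma> z p \<cdot> twist g y z w \<in> Hom_over Y (PAr Y (p \<cdot> w)) (FOb \<Theta> y) x' \<and>
      (\<forall>i \<in> I y (p \<cdot> w). (\<sigma> z p \<cdot> twist g y z w) \<cdot> twist g (fst (snd i)) y (fst (snd (snd i))) = t i)"
    proof (intro conjI ballI)
      show "\<sigma> z p \<cdot> twist g y z w \<in> Hom_over Y (PAr Y (p \<cdot> w)) (FOb \<Theta> y) x'"
        using s tw twist_par[OF w g] p w by (simp add: Hom_over_def Hom_def theta_arrow_def probe_def)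
      fix i assume i: "i \<in> I y (p \<cdot> w)"
      obtain h v q u where i': "i = (h, v, q, u)" by (cases i)
      have q: "theta_arrow v y q" and u: "h \<in> ?S" "theta_arrow v (Z h) u" "(p \<cdot> w) \<cdot> q = P h \<cdot> u"
        using i by (auto simp: I_def i')
      have wq: "theta_arrow v z (w \<cdot> q)" using w q by (auto simp: theta_arrow_def)
      have "p \<cdot> (w \<cdot> q) = (p \<cdot> w) \<cdot> q"
        using p w q by (simp add: theta_arrow_def probe_def)
      then have "(h, v, w \<cdot> q, u) \<in> I z p"
        using u wq by (simp add: I_def)
      from si[OF this] show "(\<sigma> z p \<cdot> twist g y z w) \<cdot> twist g (fst (snd i)) y (fst (snd (snd i))) = t i"
        using twist_cmp[OF q w g] s tw twist_arrow[OF q g] by (simp add: i' t_def theta_arrow_def)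
    qed
    then show "\<sigma> y (p \<cdot> w) = \<sigma> z p \<cdot> twist g y z w"
      using ex[OF pw] \<sigma>[OF pw] by blast
  qed (use x x' in auto)
  then show thesis by (rule that)
qed

text \<open>The last clause is naturality in \<open>x\<close> of the semilinear isomorphisms.
  Carrying \<open>\<sigma>\<close> along lets two such functors be compared probe by probe.\<close>

definition lifting :: "'g \<Rightarrow> ('e, 't, 'e, 't) fctr \<Rightarrow> ('e \<Rightarrow> 'd \<Rightarrow> 't \<Rightarrow> 't) \<Rightarrow> bool" where
  "lifting g F \<sigma> \<longleftrightarrow> gerbe_morphism Y Y F \<and> (\<forall>x \<in> Obj Y. semilinear g x (FOb F x) (\<sigma> x)) \<and>
     (\<forall>u z p. u \<in> Arr Y \<and> probe z p (Src Y u) \<longrightarrow>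
        FAr F u \<cdot> \<sigma> (Src Y u) z p = \<sigma> (Tgt Y u) z (u \<cdot> p))"

text \<open>The objects are mere choices, but the arrow assigned to \<open>u\<close> is pinned down
  by its effect on probes. Both functor laws are therefore instances of
  \<open>semilinear_eq\<close>.\<close>

lemma lifting_exists:
  assumes g: "g \<in> carrier G"
  obtains F \<sigma> where "lifting g F \<sigma>"
proof -
  have "\<forall>x \<in> Obj Y. \<exists>os. semilinear g x (fst os) (snd os)"
    using semilinear_exists[OF _ g] by (metis fst_conv snd_conv)
  then obtain os where os: "\<And>x. x \<in> Obj Y \<Longrightarrow> semilinear g x (fst (os x)) (snd (os x))"
    by metis
  define F where "F x = fst (os x)" for x
  define \<sigma> where "\<sigma> x = snd (os x)" for x
  have sl: "semilinear g x (F x) (\<sigma> x)" if "x \<in> Obj Y" for x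
    using os[OF that] by (simp add: F_def \<sigma>_def)
  have "\<exists>m. \<forall>u\<in>Arr Y. m u \<in> Arr Y \<and> Src Y (m u) = F (Src Y u) \<and> Tgt Y (m u) = F (Tgt Y u) \<and> PAr Y (m u) = PAr Y u \<and>
      (\<forall>z p. probe z p (Src Y u) \<longrightarrow> m u \<cdot> \<sigma> (Src Y u) z p = \<sigma> (Tgt Y u) z (u \<cdot> p))"
  proof (rule bchoice, rule ballI)
    fix u assume u: "u \<in> Arr Y"
    then show "\<exists>m. m \<in> Arr Y \<and> Src Y m = F (Src Y u) \<and> Tgt Y m = F (Tgt Y u) \<and> PAr Y m = PAr Y u \<and>
        (\<forall>z p. probe z p (Src Y u) \<longrightarrow> m \<cdot> \<sigma> (Src Y u) z p = \<sigma> (Tgt Y u) z (u \<cdot> p))"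
      using semilinear_compare[OF sl sl g u refl refl] by (metis Y.total.src_obj Y.total.tgt_obj)
  qed
  then obtain m where m: "\<And>u. u \<in> Arr Y \<Longrightarrow> m u \<in> Arr Y \<and> Src Y (m u) = F (Src Y u) \<and> Tgt Y (m u) = F (Tgt Y u) \<and>
        PAr Y (m u) = PAr Y u"
    and ms: "\<And>u z p. \<lbrakk>u \<in> Arr Y; probe z p (Src Y u)\<rbrakk> \<Longrightarrow> m u \<cdot> \<sigma> (Src Y u) z p = \<sigma> (Tgt Y u) z (u \<cdot> p)"
    by blast
  have F: "F x \<in> Obj Y" "POb Y (F x) = POb Y x" if "x \<in> Obj Y" for x
    using sl[OF that] by (auto simp: semilinear_def)
  have sp: "probe z (\<sigma> x z p) (F x)" if "x \<in> Obj Y" "probe z p x" for x z p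
    using sl[OF that(1)] that(2) by (auto simp: semilinear_def)
  have id: "m (Idn Y x) = Idn Y (F x)" if x: "x \<in> Obj Y" for x
  proof (rule semilinear_eq[OF sl[OF x]])
    fix z p assume p: "probe z p x"
    show "m (Idn Y x) \<cdot> \<sigma> x z p = Idn Y (F x) \<cdot> \<sigma> x z p"
      using ms[of "Idn Y x" z p] p sp[OF x p] x by (simp add: probe_def)
  qed (use m[of "Idn Y x"] F[OF x] x in auto)
  have cmp: "m (u \<cdot> v) = m u \<cdot> m v" if u: "u \<in> Arr Y" and v: "v \<in> Arr Y" "Tgt Y v = Src Y u" for u v
  proof (rule semilinear_eq[OF sl])
    show "Src Y v \<in> Obj Y" using v by simp
    fix z p assume p: "probe z p (Src Y v)"
    have vp: "probe z (v \<cdot> p) (Src Y u)" using p v by (auto simp: probe_def)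
    have "m (u \<cdot> v) \<cdot> \<sigma> (Src Y v) z p = \<sigma> (Tgt Y u) z (u \<cdot> (v \<cdot> p))"
      using ms[of "u \<cdot> v" z p] p u v by (simp add: probe_def)
    also have "\<dots> = m u \<cdot> (m v \<cdot> \<sigma> (Src Y v) z p)"
      using ms[OF u vp] ms[OF v(1) p] v by simp
    also have "\<dots> = (m u \<cdot> m v) \<cdot> \<sigma> (Src Y v) z p"
      using m[OF u] m[OF v(1)] v sp[OF _ p] by (simp add: probe_def)
    finally show "m (u \<cdot> v) \<cdot> \<sigma> (Src Y v) z p = (m u \<cdot> m v) \<cdot> \<sigma> (Src Y v) z p" .
  qed (use m[of "u \<cdot> v"] m[OF u] m[OF v(1)] u v in auto)
  have "lifting g \<lparr> FOb = F, FAr = m \<rparr> \<sigma>"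
    unfolding lifting_def gerbe_morphism_def
    using F m id cmp sl ms by (auto simp: Hom_over_def Hom_def)
  then show thesis by (rule that)
qed

text \<open>Sliding a section past a probe turns it into an automorphism of
  \<open>\<Theta> z\<close>, whose twist is known from \<open>twist_base\<close>; this gives
  equivariance. The 2-isomorphism comes from the value of \<open>\<sigma>\<close> at the identity
  probe.\<close>

lemma lifting_equivariant:
  assumes L: "lifting g F \<sigma>" and g: "g \<in> carrier G"
  shows "gerbe_equivariant A (\<phi> g) Y Y F" "two_isomorphic C Ybar Y (F \<circ>\<^sub>F \<Theta>) \<Theta>"
proof -
  have F: "gerbe_morphism Y Y F" and sl: "\<And>x. x \<in> Obj Y \<Longrightarrow> semilinear g x (FOb F x) (\<sigma> x)"
    and ms: "\<And>u z p. \<lbrakk>u \<in> Arr Y; probe z p (Src Y u)\<rbrakk> \<Longrightarrow>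
        FAr F u \<cdot> \<sigma> (Src Y u) z p = \<sigma> (Tgt Y u) z (u \<cdot> p)"
    using L by (auto simp: lifting_def)
  note [simp] = gerbe_morphism_simps[OF F]
  have sp: "probe z (\<sigma> x z p) (FOb F x)" "PAr Y (\<sigma> x z p) = PAr Y p" if "x \<in> Obj Y" "probe z p x" for x z p
    using sl[OF that(1)] that(2) by (auto simp: semilinear_def)
  have tw: "\<sigma> x y (p \<cdot> w) = \<sigma> x z p \<cdot> twist g y z w"
    if "x \<in> Obj Y" "probe z p x" "theta_arrow y z w" for x y z p w
    using sl[OF that(1)] that(2,3) by (auto simp: semilinear_def)
  have "FAr F (Band Y x a) = Band Y (FOb F x) (\<phi> g (POb Y x) a)"
    if x: "x \<in> Obj Y" and a: "a \<in> sec (POb Y x)" for x a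
  proof (rule semilinear_eq[OF sl[OF x]])
    have pa: "\<phi> g (POb Y x) a \<in> sec (POb Y x)" using g x a by simp
    note B = Y.band_arr[OF x a]
    have B': "Band Y (FOb F x) (\<phi> g (POb Y x) a) \<in> Arr Y" "Src Y (Band Y (FOb F x) (\<phi> g (POb Y x) a)) = FOb F x"
        "Tgt Y (Band Y (FOb F x) (\<phi> g (POb Y x) a)) = FOb F x"
        "PAr Y (Band Y (FOb F x) (\<phi> g (POb Y x) a)) = Idn C (POb Y x)"
      using Y.band_arr[of "FOb F x" "\<phi> g (POb Y x) a"] x pa by auto
    show "FAr F (Band Y x a) \<in> Arr Y" "Src Y (FAr F (Band Y x a)) = FOb F x"
      "PAr Y (FAr F (Band Y x a)) = PAr Y (Band Y (FOb F x) (\<phi> g (POb Y x) a))"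
      "Tgt Y (FAr F (Band Y x a)) = Tgt Y (Band Y (FOb F x) (\<phi> g (POb Y x) a))"
      "Band Y (FOb F x) (\<phi> g (POb Y x) a) \<in> Arr Y" "Src Y (Band Y (FOb F x) (\<phi> g (POb Y x) a)) = FOb F x"
      using B B' by simp_all
    fix z p assume p: "probe z p x"
    note p' = p[unfolded probe_def]
    let ?c = "ARes A (PAr Y p) a"
    have z: "POb Y (FOb \<Theta> z) = POb Ybar z" "FOb \<Theta> z \<in> Obj Y" "POb Ybar z \<in> Obj C" using p' by auto
    have srcp: "Src C (PAr Y p) = POb Ybar z" "Tgt C (PAr Y p) = POb Y x" using p' by auto
    have c: "?c \<in> sec (POb Ybar z)" using a srcp p' by simp
    have Bc: "theta_arrow z z (band z ?c)"
      using Y.band_arr[of "FOb \<Theta> z" ?c] c z p' by (simp add: theta_arrow_def)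
    have tB: "twist g z z (band z ?c) = band z (\<phi> g (POb Ybar z) ?c)"
      using twist_base[of "Idn Ybar z" ?c g] g p' c z Y.band_arr[of "FOb \<Theta> z" ?c]
        Y.band_arr[of "FOb \<Theta> z" "\<phi> g (POb Ybar z) ?c"] by simp
    have "FAr F (Band Y x a) \<cdot> \<sigma> x z p = \<sigma> x z (Band Y x a \<cdot> p)"
      using ms[of "Band Y x a" z p] B p by simp
    also have "\<dots> = \<sigma> x z (p \<cdot> band z ?c)"
      using Y.band_slide[of p x "FOb \<Theta> z" a] p' a by simp
    also have "\<dots> = \<sigma> x z p \<cdot> band z (ARes A (PAr Y p) (\<phi> g (POb Y x) a))"
      using tw[OF x p Bc] tB phi_ares[OF g _ srcp a] p' by simp
    also have "\<dots> = Band Y (FOb F x) (\<phi> g (POb Y x) a) \<cdot> \<sigma> x z p"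
      using Y.band_slide[of "\<sigma> x z p" "FOb F x" "FOb \<Theta> z" "\<phi> g (POb Y x) a"] sp[OF x p] x pa
      by (simp add: probe_def)
    finally show "FAr F (Band Y x a) \<cdot> \<sigma> x z p = Band Y (FOb F x) (\<phi> g (POb Y x) a) \<cdot> \<sigma> x z p" .
  qed
  then show "gerbe_equivariant A (\<phi> g) Y Y F"
    using F by (simp add: gerbe_equivariant_def)
  have FT: "gerbe_morphism Ybar Y (F \<circ>\<^sub>F \<Theta>)"
    by (rule gerbe_morphism_comp[OF theta_morphism F])
  define \<eta> where "\<eta> z = \<sigma> (FOb \<Theta> z) z (Idn Y (FOb \<Theta> z))" for z
  have pid: "probe z (Idn Y (FOb \<Theta> z)) (FOb \<Theta> z)" if "z \<in> Obj Ybar" for z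
    using that by (simp add: probe_def)
  have "two_morphism C Ybar Y \<Theta> (F \<circ>\<^sub>F \<Theta>) \<eta>"
    unfolding two_morphism_def
  proof (intro conjI ballI allI)
    fix z assume z: "z \<in> Obj Ybar"
    show "\<eta> z \<in> Hom_over Y (Idn C (POb Ybar z)) (FOb \<Theta> z) (FOb (F \<circ>\<^sub>F \<Theta>) z)"
      using sp[OF _ pid[OF z]] z by (simp add: \<eta>_def probe_def Hom_over_def Hom_def)
  next
    fix y z u assume "u \<in> Hom Ybar y z"
    then have u: "u \<in> Arr Ybar" "Src Ybar u = y" "Tgt Ybar u = z" by (auto simp: Hom_def)
    then have yz: "y \<in> Obj Ybar" "z \<in> Obj Ybar" by auto
    have ta: "theta_arrow y z (FAr \<Theta> u)" using u yz by (simp add: theta_arrow_def)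
    have "FAr F (FAr \<Theta> u) \<cdot> \<eta> y = \<sigma> (FOb \<Theta> z) y (FAr \<Theta> u)"
      using ms[of "FAr \<Theta> u" y "Idn Y (FOb \<Theta> y)"] u pid[OF yz(1)] by (simp add: \<eta>_def)
    also have "\<dots> = \<eta> z \<cdot> twist g y z (FAr \<Theta> u)"
      using tw[OF _ pid[OF yz(2)] ta] yz u by (simp add: \<eta>_def)
    finally show "\<eta> z \<cdot> FAr \<Theta> u = FAr (F \<circ>\<^sub>F \<Theta>) u \<cdot> \<eta> y"
      using twist_theta[OF u(1) g] u by simp
  qed
  then show "two_isomorphic C Ybar Y (F \<circ>\<^sub>F \<Theta>) \<Theta>"
    using Y.two_isomorphic_sym[OF Yb.total.category_axioms theta_morphism FT]
      Y.two_isomorphic_iff[OF theta_morphism FT] by blast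
qed

text \<open>The converse of \<open>lifting_equivariant\<close>, needed for uniqueness: a 2-morphism
  \<open>\<gamma>\<close> from \<Theta> to the composite of \<open>F\<close> with \<Theta> converts
  the effect of \<open>F\<close> on probes into a semilinear map, with
  \<open>FAr F p \<cdot> \<gamma> z\<close> as the value at \<open>p\<close>.\<close>

lemma equivariant_lifting:
  assumes eq: "gerbe_equivariant A (\<phi> g) Y Y F" and iso: "two_isomorphic C Ybar Y (F \<circ>\<^sub>F \<Theta>) \<Theta>"
    and g: "g \<in> carrier G"
  obtains \<sigma> where "lifting g F \<sigma>"
proof -
  have F: "gerbe_morphism Y Y F" and band: "\<And>x a. \<lbrakk>x \<in> Obj Y; a \<in> sec (POb Y x)\<rbrakk> \<Longrightarrow>
      FAr F (Band Y x a) = Band Y (FOb F x) (\<phi> g (POb Y x) a)"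
    using eq by (auto simp: gerbe_equivariant_def)
  note [simp] = gerbe_morphism_simps[OF F]
  have FT: "gerbe_morphism Ybar Y (F \<circ>\<^sub>F \<Theta>)"
    by (rule gerbe_morphism_comp[OF theta_morphism F])
  obtain \<gamma> where \<gamma>: "two_morphism C Ybar Y \<Theta> (F \<circ>\<^sub>F \<Theta>) \<gamma>"
    using Y.two_isomorphic_sym[OF Yb.total.category_axioms FT theta_morphism iso]
    by (auto simp: two_isomorphic_def)
  note e = Y.two_morphism_simps[OF \<gamma>, simplified]
  \<comment> \<open>Up to \<open>\<gamma>\<close>, the functor acts on arrows between objects
    \<open>\<Theta> z\<close> as \<open>twist g\<close>: in a chart, naturality treats the part from
    \<open>Ybar\<close>, and equivariance applies \<open>\<phi> g\<close> to the coordinate.\<close>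
  have nat: "FAr F w \<cdot> \<gamma> y = \<gamma> z \<cdot> twist g y z w" if w: "theta_arrow y z w" for y z w
  proof -
    note w' = w[unfolded theta_arrow_def] and tw = twist_arrow[OF w g, unfolded theta_arrow_def]
    note tp = twist_par[OF w g]
    have yz: "y \<in> Obj Ybar" "z \<in> Obj Ybar" using w' by auto
    have pw: "Src C (PAr Y w) = POb Ybar y" "Tgt C (PAr Y w) = POb Ybar z" using w' by auto
    obtain R where R: "R \<in> Cov C (POb Ybar y)" "\<And>h. h \<in> R \<Longrightarrow> \<exists>v v' c. PAr Ybar v = h \<and> chart y z w v v' c"
      using local_chart[OF w] by blast
    show ?thesis
    proof (rule Y.arrow_eq_local)
      fix h assume "h \<in> R"
      then obtain v v' c where v: "PAr Ybar v = h" and ch: "chart y z w v v' c" using R(2) by blast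
      have ch0: "v \<in> Arr Ybar" "Tgt Ybar v = y" "v' \<in> Arr Ybar" "Src Ybar v' = Src Ybar v" "Tgt Ybar v' = z"
        and c: "c \<in> sec (POb Ybar (Src Ybar v))"
        and ceq: "w \<cdot> FAr \<Theta> v = FAr \<Theta> v' \<cdot> band (Src Ybar v) c"
        using ch by (auto simp: chart_def)
      let ?s = "Src Ybar v" and ?V = "POb Ybar (Src Ybar v)"
      let ?T = "FOb \<Theta> ?s"
      have s: "?s \<in> Obj Ybar" "?V \<in> Obj C" using ch0 by auto
      have pc: "\<phi> g ?V c \<in> sec ?V" using c g s by simp
      have B: "Band Y ?T a \<in> Arr Y" "Src Y (Band Y ?T a) = ?T" "Tgt Y (Band Y ?T a) = ?T"
        if "a \<in> sec ?V" for a
        using Y.band_arr[of ?T a] that s by auto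
      have BF: "Band Y (FOb F ?T) a \<in> Arr Y" "Src Y (Band Y (FOb F ?T) a) = FOb F ?T" "Tgt Y (Band Y (FOb F ?T) a) = FOb F ?T"
        if "a \<in> sec ?V" for a
        using Y.band_arr[of "FOb F ?T" a] that s by auto
      have nv: "\<gamma> y \<cdot> FAr \<Theta> v = FAr F (FAr \<Theta> v) \<cdot> \<gamma> ?s" "\<gamma> z \<cdot> FAr \<Theta> v' = FAr F (FAr \<Theta> v') \<cdot> \<gamma> ?s"
        using e(5)[OF ch0(1)] e(5)[OF ch0(3)] ch0 by simp_all
      have Bg: "Band Y (FOb F ?T) (\<phi> g ?V c) \<cdot> \<gamma> ?s = \<gamma> ?s \<cdot> Band Y ?T (\<phi> g ?V c)"
        using Y.band_slide[of "\<gamma> ?s" "FOb F ?T" ?T "\<phi> g ?V c"] e(1-4)[OF s(1)] s pc by simp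
      have Fw: "FAr F w \<cdot> FAr F (FAr \<Theta> v) = FAr F (FAr \<Theta> v') \<cdot> Band Y (FOb F ?T) (\<phi> g ?V c)"
        using arg_cong[OF ceq, of "FAr F"] w' ch0 B[OF c] band[of ?T c] s c by simp
      have "(FAr F w \<cdot> \<gamma> y) \<cdot> FAr \<Theta> v = FAr F w \<cdot> (FAr F (FAr \<Theta> v) \<cdot> \<gamma> ?s)"
        using w' yz e(1-4)[OF yz(1)] ch0 nv(1) by simp
      also have "\<dots> = FAr F (FAr \<Theta> v') \<cdot> (Band Y (FOb F ?T) (\<phi> g ?V c) \<cdot> \<gamma> ?s)"
        using w' ch0 e(1-4)[OF s(1)] BF[OF pc] by (simp add: Y.total.reassoc[OF Fw])
      also have "\<dots> = (\<gamma> z \<cdot> FAr \<Theta> v') \<cdot> Band Y ?T (\<phi> g ?V c)"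
        unfolding Bg nv using ch0 e(1-4)[OF s(1)] B[OF pc] by simp
      also have "\<dots> = \<gamma> z \<cdot> (twist g y z w \<cdot> FAr \<Theta> v)"
        unfolding twist_chart[OF w g ch] using ch0 e(1-4)[OF yz(2)] B[OF pc] by simp
      also have "\<dots> = (\<gamma> z \<cdot> twist g y z w) \<cdot> FAr \<Theta> v"
        using ch0 e(1-4)[OF yz(2)] tw by simp
      finally show "\<exists>p\<in>Arr Y. Tgt Y p = Src Y (FAr F w \<cdot> \<gamma> y) \<and> PAr Y p = h \<and>
          (FAr F w \<cdot> \<gamma> y) \<cdot> p = (\<gamma> z \<cdot> twist g y z w) \<cdot> p"
        using v ch0 e(1-4)[OF yz(1)] w' by (intro bexI[of _ "FAr \<Theta> v"]) auto
    qed (use w' yz e(1-4)[OF yz(1)] e(1-4)[OF yz(2)] tw tp R pw in auto)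
  qed
  have "lifting g F (\<lambda>x z p. FAr F p \<cdot> \<gamma> z)"
    unfolding lifting_def semilinear_def
  proof (intro conjI ballI allI impI)
    fix x z p assume x: "x \<in> Obj Y" and p: "probe z p x"
    have z: "z \<in> Obj Ybar" "p \<in> Arr Y" "Src C (PAr Y p) = POb Ybar z" using p by (auto simp: probe_def)
    show "probe z (FAr F p \<cdot> \<gamma> z) (FOb F x)" "PAr Y (FAr F p \<cdot> \<gamma> z) = PAr Y p"
      using p e(1-4)[OF z(1)] z by (auto simp: probe_def)
  next
    fix x z p y w assume x: "x \<in> Obj Y" and "probe z p x \<and> theta_arrow y z w"
    then have p: "probe z p x" and w: "theta_arrow y z w" by auto
    have yz: "y \<in> Obj Ybar" "z \<in> Obj Ybar" using w by (auto simp: theta_arrow_def)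
    show "FAr F (p \<cdot> w) \<cdot> \<gamma> y = (FAr F p \<cdot> \<gamma> z) \<cdot> twist g y z w"
      using p w nat[OF w] e(1-4)[OF yz(1)] e(1-4)[OF yz(2)] twist_arrow[OF w g]
      by (simp add: probe_def theta_arrow_def)
  next
    fix u z p assume *: "u \<in> Arr Y \<and> probe z p (Src Y u)"
    then have z: "z \<in> Obj Ybar" by (auto simp: probe_def)
    show "FAr F u \<cdot> (FAr F p \<cdot> \<gamma> z) = FAr F (u \<cdot> p) \<cdot> \<gamma> z"
      using * e(1-4)[OF z] by (simp add: probe_def)
  qed (use F in auto)
  then show thesis by (rule that)
qed

text \<open>The components are the comparisons along identity arrows. Naturality holds because both
  sides have the same effect on probes.\<close>

lemma liftings_two_isomorphic:
  assumes L1: "lifting g F1 \<sigma>1" and L2: "lifting g F2 \<sigma>2" and g: "g \<in> carrier G"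
  shows "two_isomorphic C Y Y F1 F2"
proof -
  have F: "gerbe_morphism Y Y F1" "gerbe_morphism Y Y F2"
    and sl: "\<And>x. x \<in> Obj Y \<Longrightarrow> semilinear g x (FOb F1 x) (\<sigma>1 x)" "\<And>x. x \<in> Obj Y \<Longrightarrow> semilinear g x (FOb F2 x) (\<sigma>2 x)"
    and ms: "\<And>u z p. \<lbrakk>u \<in> Arr Y; probe z p (Src Y u)\<rbrakk> \<Longrightarrow>
        FAr F1 u \<cdot> \<sigma>1 (Src Y u) z p = \<sigma>1 (Tgt Y u) z (u \<cdot> p)"
      "\<And>u z p. \<lbrakk>u \<in> Arr Y; probe z p (Src Y u)\<rbrakk> \<Longrightarrow>
        FAr F2 u \<cdot> \<sigma>2 (Src Y u) z p = \<sigma>2 (Tgt Y u) z (u \<cdot> p)"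
    using L1 L2 by (auto simp: lifting_def)
  note [simp] = gerbe_morphism_simps[OF F(1)] gerbe_morphism_simps[OF F(2)]
  have sp: "probe z (\<sigma>1 x z p) (FOb F1 x)" if "x \<in> Obj Y" "probe z p x" for x z p
    using sl(1)[OF that(1)] that(2) by (auto simp: semilinear_def)
  have "\<exists>\<eta>. \<forall>x\<in>Obj Y. \<eta> x \<in> Arr Y \<and> Src Y (\<eta> x) = FOb F1 x \<and> Tgt Y (\<eta> x) = FOb F2 x \<and>
      PAr Y (\<eta> x) = Idn C (POb Y x) \<and> (\<forall>z p. probe z p x \<longrightarrow> \<eta> x \<cdot> \<sigma>1 x z p = \<sigma>2 x z p)"
  proof (rule bchoice, rule ballI)
    fix x assume x: "x \<in> Obj Y"
    obtain m where m: "m \<in> Arr Y" "Src Y m = FOb F1 x" "Tgt Y m = FOb F2 x" "PAr Y m = PAr Y (Idn Y x)"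
        "\<And>z p. probe z p x \<Longrightarrow> m \<cdot> \<sigma>1 x z p = \<sigma>2 x z (Idn Y x \<cdot> p)"
      using semilinear_compare[OF sl(1)[OF x] sl(2)[OF x] g, of "Idn Y x"] x by auto
    have "m \<cdot> \<sigma>1 x z p = \<sigma>2 x z p" if "probe z p x" for z p
      using m(5)[OF that] that by (simp add: probe_def)
    with m x show "\<exists>m. m \<in> Arr Y \<and> Src Y m = FOb F1 x \<and> Tgt Y m = FOb F2 x \<and>
      PAr Y m = Idn C (POb Y x) \<and> (\<forall>z p. probe z p x \<longrightarrow> m \<cdot> \<sigma>1 x z p = \<sigma>2 x z p)"
      by (intro exI[of _ m]) auto
  qed
  then obtain \<eta> where \<eta>: "\<And>x. x \<in> Obj Y \<Longrightarrow> \<eta> x \<in> Arr Y \<and> Src Y (\<eta> x) = FOb F1 x \<and> Tgt Y (\<eta> x) = FOb F2 x \<and>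
      PAr Y (\<eta> x) = Idn C (POb Y x)"
    and \<eta>s: "\<And>x z p. \<lbrakk>x \<in> Obj Y; probe z p x\<rbrakk> \<Longrightarrow> \<eta> x \<cdot> \<sigma>1 x z p = \<sigma>2 x z p" by blast
  have nat: "\<eta> (Tgt Y u) \<cdot> FAr F1 u = FAr F2 u \<cdot> \<eta> (Src Y u)" if u: "u \<in> Arr Y" for u
  proof (rule semilinear_eq[OF sl(1)])
    show s: "Src Y u \<in> Obj Y" using u by simp
    have t: "Tgt Y u \<in> Obj Y" using u by simp
    note h = \<eta>[OF s] \<eta>[OF t]
    fix z p assume p: "probe z p (Src Y u)"
    have up: "probe z (u \<cdot> p) (Tgt Y u)" using p u by (auto simp: probe_def)
    have "(\<eta> (Tgt Y u) \<cdot> FAr F1 u) \<cdot> \<sigma>1 (Src Y u) z p = \<eta> (Tgt Y u) \<cdot> (FAr F1 u \<cdot> \<sigma>1 (Src Y u) z p)"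
      using h u sp[OF s p] by (simp add: probe_def)
    also have "\<dots> = \<sigma>2 (Tgt Y u) z (u \<cdot> p)"
      unfolding ms(1)[OF u p] by (rule \<eta>s[OF t up])
    also have "\<dots> = FAr F2 u \<cdot> (\<eta> (Src Y u) \<cdot> \<sigma>1 (Src Y u) z p)"
      using ms(2)[OF u p] \<eta>s[OF s p] by simp
    also have "\<dots> = (FAr F2 u \<cdot> \<eta> (Src Y u)) \<cdot> \<sigma>1 (Src Y u) z p"
      using h u sp[OF s p] by (simp add: probe_def)
    finally show "(\<eta> (Tgt Y u) \<cdot> FAr F1 u) \<cdot> \<sigma>1 (Src Y u) z p = (FAr F2 u \<cdot> \<eta> (Src Y u)) \<cdot> \<sigma>1 (Src Y u) z p" .
  qed (use u \<eta>[of "Src Y u"] \<eta>[of "Tgt Y u"] in auto)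
  have "two_morphism C Y Y F1 F2 \<eta>"
    unfolding two_morphism_def using \<eta> nat by (auto simp: Hom_over_def Hom_def)
  then show ?thesis
    using Y.two_isomorphic_iff F by blast
qed

section \<open>Uniqueness and the group law of the functors on the gerbe\<close>

definition compatible :: "'g \<Rightarrow> ('e, 't, 'e, 't) fctr \<Rightarrow> bool" where
  "compatible g F \<longleftrightarrow> gerbe_equivariant A (\<phi> g) Y Y F \<and> two_isomorphic C Ybar Y (F \<circ>\<^sub>F \<Theta>) \<Theta>"

lemma compatible_unique:
  assumes "compatible g F" "compatible g F'" "g \<in> carrier G"
  shows "two_isomorphic C Y Y F F'"
  using assms equivariant_lifting liftings_two_isomorphic unfolding compatible_def by metis

lemma compatible_morphism: "compatible g F \<Longrightarrow> gerbe_morphism Y Y F"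
  by (simp add: compatible_def gerbe_equivariant_def)

lemma compatible_comp:
  assumes F: "compatible g F" "g \<in> carrier G" and F': "compatible h F'" "h \<in> carrier G"
  shows "compatible (g \<otimes>\<^bsub>G\<^esub> h) (F \<circ>\<^sub>F F')"
proof -
  note m = compatible_morphism[OF F(1)] compatible_morphism[OF F'(1)]
  note mT = gerbe_morphism_comp[OF theta_morphism m(2)] gerbe_morphism_comp[OF theta_morphism m(1)]
  note mc = gerbe_morphism_comp[OF m(2) m(1)]
  note [simp] = gerbe_morphism_simps[OF m(2)]
  have "two_isomorphic C Ybar Y (F \<circ>\<^sub>F (F' \<circ>\<^sub>F \<Theta>)) (F \<circ>\<^sub>F \<Theta>)"
    using F' Y.two_isomorphic_whisker[OF mT(1) theta_morphism m(1) Yb.total.category_axioms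
        Y.fibred_in_groupoids_axioms]
    by (simp add: compatible_def)
  then have "two_isomorphic C Ybar Y ((F \<circ>\<^sub>F F') \<circ>\<^sub>F \<Theta>) \<Theta>"
    using F Y.two_isomorphic_trans[OF Yb.fibred_in_groupoids_axioms _ mT(2) theta_morphism, of "(F \<circ>\<^sub>F F') \<circ>\<^sub>F \<Theta>"]
      gerbe_morphism_comp[OF mT(1) m(1)]
    by (simp add: compatible_def fctr_comp_assoc)
  moreover have "gerbe_equivariant A (\<phi> (g \<otimes>\<^bsub>G\<^esub> h)) Y Y (F \<circ>\<^sub>F F')"
    using F F' mc by (simp add: compatible_def gerbe_equivariant_def phi_cmp)
  ultimately show ?thesis by (simp add: compatible_def)
qed

lemma compatible_id: "compatible \<one>\<^bsub>G\<^esub> fctr_id"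
proof -
  have "fctr_id \<circ>\<^sub>F \<Theta> = \<Theta>"
    by (simp add: fctr_comp_def fctr_id_def comp_def)
  moreover have "two_morphism C Ybar Y \<Theta> \<Theta> (\<lambda>z. Idn Y (FOb \<Theta> z))"
    by (auto simp: two_morphism_def Hom_over_def Hom_def)
  ultimately show ?thesis
    using Y.gerbe_morphism_id Y.two_isomorphic_iff[OF theta_morphism theta_morphism]
    by (auto simp: compatible_def gerbe_equivariant_def)
qed

text \<open>Conditions on each \<open>g\<close> separately suffice. Composites are compatible with
  the product and \<open>fctr_id\<close> with the unit, so \<open>compatible_unique\<close> supplies
  both the group law and the quasi-inverses.\<close>

lemma compatible_gerbe_lift_iff:
  "compatible_gerbe_lift C G A \<phi> Ybar Y \<Theta> F \<longleftrightarrow> (\<forall>g \<in> carrier G. compatible g (F g))"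
proof
  assume F: "\<forall>g \<in> carrier G. compatible g (F g)"
  have two: "two_isomorphic C Y Y (F g \<circ>\<^sub>F F h) (F (g \<otimes>\<^bsub>G\<^esub> h))" "two_isomorphic C Y Y (F (g \<otimes>\<^bsub>G\<^esub> h)) (F g \<circ>\<^sub>F F h)"
    if "g \<in> carrier G" "h \<in> carrier G" for g h
    using compatible_unique[of "g \<otimes>\<^bsub>G\<^esub> h"] compatible_comp[of g "F g" h "F h"] F that by auto
  have one: "two_isomorphic C Y Y (F g \<circ>\<^sub>F F h) fctr_id"
    if "g \<in> carrier G" "h \<in> carrier G" "g \<otimes>\<^bsub>G\<^esub> h = \<one>\<^bsub>G\<^esub>" for g h
    using compatible_unique[OF _ compatible_id] compatible_comp[of g "F g" h "F h"] F that by auto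
  have "gerbe_automorphism C Y (F g)" if g: "g \<in> carrier G" for g
    unfolding gerbe_automorphism_def
    using F g one[of g "inv\<^bsub>G\<^esub> g"] one[of "inv\<^bsub>G\<^esub> g" g] compatible_morphism
    by (auto intro!: exI[of _ "F (inv\<^bsub>G\<^esub> g)"])
  moreover have "gerbe_equivariant A (\<lambda>U a. a) Y Y (F \<one>\<^bsub>G\<^esub>)"
    using F by (auto simp: compatible_def gerbe_equivariant_def)
  ultimately show "compatible_gerbe_lift C G A \<phi> Ybar Y \<Theta> F"
    using F two by (auto simp: compatible_gerbe_lift_def gerbe_lift_def gerbe_action_def compatible_def
        gerbe_equivariant_def)
qed (auto simp: compatible_gerbe_lift_def gerbe_lift_def compatible_def)

lemma compatible_gerbe_lift_unique:
  assumes "compatible_gerbe_lift C G A \<phi> Ybar Y \<Theta> F" "compatible_gerbe_lift C G A \<phi> Ybar Y \<Theta> F'" "g \<in> carrier G"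
  shows "two_isomorphic C Y Y (F g) (F' g)"
  using assms compatible_unique[of g "F g" "F' g"] by (simp add: compatible_gerbe_lift_iff)

lemma compatible_gerbe_lift_exists: "\<exists>F. compatible_gerbe_lift C G A \<phi> Ybar Y \<Theta> F"
proof -
  have "\<forall>g \<in> carrier G. \<exists>F. compatible g F"
    using lifting_exists lifting_equivariant unfolding compatible_def by metis
  then show ?thesis
    unfolding compatible_gerbe_lift_iff by metis
qed

end

section \<open>The obstruction class of a compatible lift\<close>

context induced_gerbe
begin

text \<open>Naturality along a probe expresses the restriction of \<open>\<eta> x\<close> through
  the component at \<open>\<Theta> z\<close>, and probes cover \<open>x\<close>.\<close>

lemma two_morphism_eqI:
  assumes F: "gerbe_morphism Y Y F" "gerbe_morphism Y Y F'"
    and \<eta>: "two_morphism C Y Y F F' \<eta>" "two_morphism C Y Y F F' \<eta>'"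
    and eq: "\<And>z. z \<in> Obj Ybar \<Longrightarrow> \<eta> (FOb \<Theta> z) = \<eta>' (FOb \<Theta> z)"
    and x: "x \<in> Obj Y"
  shows "\<eta> x = \<eta>' x"
proof -
  note m = gerbe_morphism_simps[OF F(1)] gerbe_morphism_simps[OF F(2)]
  note e = Y.two_morphism_simps[OF \<eta>(1)] and e' = Y.two_morphism_simps[OF \<eta>(2)]
  obtain R where R: "R \<in> Cov C (POb Y x)" "\<And>h. h \<in> R \<Longrightarrow> \<exists>z p. probe z p x \<and> PAr Y p = h"
    using local_probe[OF x] by blast
  show ?thesis
  proof (rule Y.arrow_eq_local)
    fix h assume "h \<in> R"
    then obtain z p where p: "probe z p x" "PAr Y p = h" using R(2) by blast
    note p' = p(1)[unfolded probe_def]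
    have "\<eta> x \<cdot> FAr F p = \<eta>' x \<cdot> FAr F p"
      using e(5)[of p] e'(5)[of p] p' eq[of z] by simp
    then show "\<exists>p \<in> Arr Y. Tgt Y p = Src Y (\<eta> x) \<and> PAr Y p = h \<and> \<eta> x \<cdot> p = \<eta>' x \<cdot> p"
      using p' p(2) e(1-4)[OF x] m by (intro bexI[of _ "FAr F p"]) auto
  qed (use x R m e(1-4)[OF x] e'(1-4)[OF x] in auto)
qed

lemma section_two_aut_morphism:
  assumes X: "final_object C X" and F: "gerbe_morphism Y Y F" and a: "a \<in> sec X"
  shows "two_morphism C Y Y F F (section_two_aut C X A Y F a)"
proof -
  note m = gerbe_morphism_simps[OF F]
  have b: "ARes A (to_final C X (POb Y x)) a \<in> sec (POb Y x)" if "x \<in> Obj Y" for x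
    using to_final_arr[OF X, of "POb Y x"] that a by simp
  have arr: "Band Y (FOb F x) (ARes A (to_final C X (POb Y x)) a) \<in> Hom_over Y (Idn C (POb Y x)) (FOb F x) (FOb F x)"
    if "x \<in> Obj Y" for x
    using Y.band_arr[of "FOb F x"] b[OF that] m(1,2) that by (simp add: Hom_over_def Hom_def)
  have nat: "Band Y (FOb F (Tgt Y u)) (ARes A (to_final C X (POb Y (Tgt Y u))) a) \<cdot> FAr F u =
      FAr F u \<cdot> Band Y (FOb F (Src Y u)) (ARes A (to_final C X (POb Y (Src Y u))) a)"
    if u: "u \<in> Arr Y" for u
  proof -
    have t: "Tgt Y u \<in> Obj Y" using u by simp
    note fin = to_final_arr[OF X Y.proj_obj[OF t]]
    have "to_final C X (POb Y (Src Y u)) = to_final C X (POb Y (Tgt Y u)) \<cdot>\<^bsub>C\<^esub> PAr Y u"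
      using to_final_unique[OF X, of "to_final C X (POb Y (Tgt Y u)) \<cdot>\<^bsub>C\<^esub> PAr Y u"] fin u by simp
    then have "ARes A (PAr Y u) (ARes A (to_final C X (POb Y (Tgt Y u))) a) = ARes A (to_final C X (POb Y (Src Y u))) a"
      using ares_cmp[of "to_final C X (POb Y (Tgt Y u))" "PAr Y u" a] fin u a by simp
    then show ?thesis
      using Y.band_slide[of "FAr F u" "FOb F (Tgt Y u)" "FOb F (Src Y u)" "ARes A (to_final C X (POb Y (Tgt Y u))) a"]
        b[OF t] u m by simp
  qed
  show ?thesis
    unfolding two_morphism_def
    using arr nat m(2) by (auto simp: section_two_aut_def Hom_def)
qed

lemma section_determined:
  assumes X: "final_object C X" and a: "a \<in> sec X" "b \<in> sec X"
    and eq: "\<And>z. z \<in> Obj Ybar \<Longrightarrow>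
      ARes A (to_final C X (POb Ybar z)) a = ARes A (to_final C X (POb Ybar z)) b"
  shows "a = b"
proof -
  have XC: "X \<in> Obj C" using X by (simp add: final_object_def)
  obtain R where R: "R \<in> Cov C X" "\<forall>h \<in> R. \<exists>z \<in> Obj Ybar. POb Ybar z = Src C h"
    using Yb.locally_nonempty[OF XC] by blast
  show ?thesis
  proof (rule ares_separated[OF XC R(1) a])
    fix h assume h: "h \<in> R"
    then obtain z where "z \<in> Obj Ybar" "POb Ybar z = Src C h" using R by blast
    then show "ARes A h a = ARes A h b"
      using eq[of z] to_final_unique[OF X, of h] cov_arr[OF XC R(1) h] by simp
  qed
qed

text \<open>Each component is a section \<open>c z\<close> over the base of \<open>z\<close>.
  Naturality makes these compatible with restriction, hence dependent on the base object alone, and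
  they glue to a section over \<open>X\<close>.\<close>

lemma theta_automorphism_section:
  assumes X: "final_object C X" and d: "two_morphism C Ybar Y \<Theta> \<Theta> \<delta>"
  obtains b where "b \<in> sec X"
    "\<And>z. z \<in> Obj Ybar \<Longrightarrow> \<delta> z = band z (ARes A (to_final C X (POb Ybar z)) b)"
proof -
  have XC: "X \<in> Obj C" using X by (simp add: final_object_def)
  note e = Y.two_morphism_simps[OF d]
  have "\<exists>c. \<forall>z\<in>Obj Ybar. c z \<in> sec (POb Ybar z) \<and> \<delta> z = band z (c z)"
  proof (rule bchoice, rule ballI)
    fix z assume z: "z \<in> Obj Ybar"
    then show "\<exists>c. c \<in> sec (POb Ybar z) \<and> \<delta> z = band z c"
      using Y.band_surj[of "\<delta> z" "FOb \<Theta> z"] e(1-4)[OF z] by (metis theta_simps(2))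
  qed
  then obtain c where c: "\<And>z. z \<in> Obj Ybar \<Longrightarrow> c z \<in> sec (POb Ybar z)"
    "\<And>z. z \<in> Obj Ybar \<Longrightarrow> \<delta> z = band z (c z)" by blast
  have restrict: "ARes A (PAr Ybar n) (c (Tgt Ybar n)) = c (Src Ybar n)" if n: "n \<in> Arr Ybar" for n
  proof (rule Y.band_cancel[of "FAr \<Theta> n" "FOb \<Theta> (Src Ybar n)"])
    have o: "Src Ybar n \<in> Obj Ybar" "Tgt Ybar n \<in> Obj Ybar" using n by auto
    show "FAr \<Theta> n \<cdot> band (Src Ybar n) (ARes A (PAr Ybar n) (c (Tgt Ybar n))) =
        FAr \<Theta> n \<cdot> band (Src Ybar n) (c (Src Ybar n))"
      using e(5)[OF n] c(2)[OF o(1)] c(2)[OF o(2)] n c(1)[OF o(2)] o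
        Y.band_slide[of "FAr \<Theta> n" "FOb \<Theta> (Tgt Ybar n)" "FOb \<Theta> (Src Ybar n)" "c (Tgt Ybar n)"] by simp
    show "ARes A (PAr Ybar n) (c (Tgt Ybar n)) \<in> sec (POb Y (FOb \<Theta> (Src Ybar n)))"
      "c (Src Ybar n) \<in> sec (POb Y (FOb \<Theta> (Src Ybar n)))"
      using c(1)[OF o(1)] c(1)[OF o(2)] n o by simp_all
  qed (use n in auto)
  \<comment> \<open>Locally \<open>z\<close> and \<open>z'\<close> receive arrows over the same base
    arrow from a common source, and both sections restrict to the value of \<open>c\<close>
    there.\<close>
  have base_only: "c z = c z'" if z: "z \<in> Obj Ybar" "z' \<in> Obj Ybar" "POb Ybar z' = POb Ybar z" for z z'
  proof -
    have U: "POb Ybar z \<in> Obj C" using z by simp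
    obtain T where T: "T \<in> Cov C (POb Ybar z)" and *: "\<And>h. h \<in> T \<Longrightarrow> \<exists>u v. u \<in> Arr Ybar \<and> Tgt Ybar u = z \<and>
        PAr Ybar u = h \<and> v \<in> Arr Ybar \<and> Src Ybar v = Src Ybar u \<and> Tgt Ybar v = z' \<and> PAr Ybar v = h"
      using Yb.local_span[OF z] by blast
    show ?thesis
    proof (rule ares_separated[OF U T])
      fix h assume "h \<in> T"
      then obtain u v where u: "u \<in> Arr Ybar" "Tgt Ybar u = z" "PAr Ybar u = h"
        and v: "v \<in> Arr Ybar" "Src Ybar v = Src Ybar u" "Tgt Ybar v = z'" "PAr Ybar v = h"
        using * by blast
      show "ARes A h (c z) = ARes A h (c z')"
        using restrict[OF u(1)] restrict[OF v(1)] u v by simp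
    qed (use c(1)[OF z(1)] c(1)[OF z(2)] z(3) in auto)
  qed
  obtain R where R: "R \<in> Cov C X" "\<forall>h \<in> R. \<exists>z \<in> Obj Ybar. POb Ybar z = Src C h"
    using Yb.locally_nonempty[OF XC] by blast
  then obtain Z where Z: "\<And>h. h \<in> R \<Longrightarrow> Z h \<in> Obj Ybar" "\<And>h. h \<in> R \<Longrightarrow> POb Ybar (Z h) = Src C h" by metis
  have Rarr: "h \<in> Arr C" "Tgt C h = X" if "h \<in> R" for h using cov_arr[OF XC R(1) that] by auto
  have pull: "\<exists>y \<in> Obj Ybar. POb Ybar y = Src C p \<and> ARes A p (c z) = c y"
    if z: "z \<in> Obj Ybar" and p: "p \<in> Arr C" "Tgt C p = POb Ybar z" for z p
  proof -
    obtain n where n: "n \<in> Arr Ybar" "Tgt Ybar n = z" "PAr Ybar n = p" "POb Ybar (Src Ybar n) = Src C p"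
      using Yb.pullback[OF z p] by blast
    then show ?thesis
      using restrict[OF n(1)] by (intro bexI[of _ "Src Ybar n"]) auto
  qed
  \<comment> \<open>Restrictions are again values of \<open>c\<close>, so by
    \<open>base_only\<close> they depend only on the source of \<open>p\<close>.\<close>
  have match: "ARes A p (c z) = ARes A p' (c z')"
    if "z \<in> Obj Ybar" "p \<in> Arr C" "Tgt C p = POb Ybar z" "z' \<in> Obj Ybar" "p' \<in> Arr C" "Tgt C p' = POb Ybar z'"
      "Src C p = Src C p'" for z p z' p'
    using pull[OF that(1-3)] pull[OF that(4-6)] base_only that(7) by metis
  have "\<exists>!b. b \<in> Sec (underlying A) X \<and> (\<forall>h \<in> R. Res (underlying A) h b = c (Z h))"
  proof (rule sheaf.glue[OF sheaf_A XC R(1)])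
    fix h assume "h \<in> R"
    then show "c (Z h) \<in> Sec (underlying A) (Src C h)" using c(1) Z by (metis presheaf.simps(1) underlying_def)
  next
    fix h h' W p p'
    assume "h \<in> R" "h' \<in> R" "p \<in> Hom C W (Src C h)" "p' \<in> Hom C W (Src C h')"
    then show "Res (underlying A) p (c (Z h)) = Res (underlying A) p' (c (Z h'))"
      using match[of "Z h" p "Z h'" p'] Z by (simp add: underlying_def Hom_def)
  qed
  then obtain b where b: "b \<in> sec X" "\<And>h. h \<in> R \<Longrightarrow> ARes A h b = c (Z h)"
    by (auto simp: underlying_def)
  \<comment> \<open>The chosen objects \<open>Z h\<close> say nothing directly about an arbitrary
    \<open>z\<close>; the arrow from its base to \<open>X\<close> factors through the cover only
    after refinement.\<close>
  have "ARes A (to_final C X (POb Ybar z)) b = c z" if z: "z \<in> Obj Ybar" for z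
  proof -
    let ?V = "POb Ybar z"
    have V: "?V \<in> Obj C" using z by simp
    note fin = to_final_arr[OF X V]
    obtain T where T: "T \<in> Cov C ?V"
      "\<forall>k \<in> T. \<exists>h \<in> R. \<exists>l \<in> Hom C (Src C k) (Src C h). to_final C X ?V \<cdot>\<^bsub>C\<^esub> k = h \<cdot>\<^bsub>C\<^esub> l"
      using cov_stable[OF R(1), of "to_final C X ?V" ?V] fin by (auto simp: Hom_def)
    show ?thesis
    proof (rule ares_separated[OF V T(1)])
      fix k assume k: "k \<in> T"
      have karr: "k \<in> Arr C" "Tgt C k = ?V" using cov_arr[OF V T(1) k] by auto
      obtain h l where h: "h \<in> R" and l: "l \<in> Arr C" "Src C l = Src C k" "Tgt C l = Src C h"
        and eq: "to_final C X ?V \<cdot>\<^bsub>C\<^esub> k = h \<cdot>\<^bsub>C\<^esub> l" using T k by (auto simp: Hom_def)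
      have "ARes A k (ARes A (to_final C X ?V) b) = ARes A l (ARes A h b)"
        using ares_cmp[of "to_final C X ?V" k b] ares_cmp[of h l b] fin karr l Rarr[OF h] b(1) eq by simp
      also have "\<dots> = ARes A k (c z)"
        using match[of "Z h" l z k] b(2)[OF h] Z[OF h] l z karr by simp
      finally show "ARes A k (ARes A (to_final C X ?V) b) = ARes A k (c z)" .
    qed (use fin b c z in auto)
  qed
  then show thesis
    using that[OF b(1)] c(2) by simp
qed

lemma compatible_obstruction:
  assumes X: "final_object C X" and L: "compatible_gerbe_lift C G A \<phi> Ybar Y \<Theta> F"
    and al: "connecting_morphisms C G Y F \<alpha>"
  obtains b where "b \<in> carrier (cochains G (Grp A X) 2)"
    "gerbe_cochain C X G A Y F \<alpha> = coboundary G (Grp A X) (\<lambda>g. \<phi> g X) 2 b"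
proof -
  have XC: "X \<in> Obj C" using X by (simp add: final_object_def)
  interpret M: group_module G "Grp A X" "\<lambda>g. \<phi> g X"
    by (rule sections_module[OF XC])
  note fin = to_final_arr[OF X]
  have cF: "compatible g (F g)" if "g \<in> carrier G" for g
    using L that by (simp add: compatible_gerbe_lift_iff)
  have Fm: "gerbe_morphism Y Y (F g)" if "g \<in> carrier G" for g
    using compatible_morphism[OF cF[OF that]] .
  note m = gerbe_morphism_simps[OF Fm]
  have FT: "gerbe_morphism Ybar Y (F g \<circ>\<^sub>F \<Theta>)" if "g \<in> carrier G" for g
    by (rule gerbe_morphism_comp[OF theta_morphism Fm[OF that]])
  have Fband: "FAr (F g) (Band Y x a) = Band Y (FOb (F g) x) (\<phi> g (POb Y x) a)"
    if "g \<in> carrier G" "x \<in> Obj Y" "a \<in> sec (POb Y x)" for g x a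
    using cF[OF that(1)] that by (simp add: compatible_def gerbe_equivariant_def)
  have am: "two_morphism C Y Y (F (g \<otimes>\<^bsub>G\<^esub> h)) (F g \<circ>\<^sub>F F h) (\<alpha> g h)"
    if "g \<in> carrier G" "h \<in> carrier G" for g h
    using al that by (simp add: connecting_morphisms_def)
  note ae = Y.two_morphism_simps[OF am, simplified]
  have "\<forall>g \<in> carrier G. \<exists>\<eta>. two_morphism C Ybar Y (F g \<circ>\<^sub>F \<Theta>) \<Theta> \<eta>"
    using cF by (auto simp: compatible_def two_isomorphic_def)
  then obtain \<eta> where \<eta>: "\<And>g. g \<in> carrier G \<Longrightarrow> two_morphism C Ybar Y (F g \<circ>\<^sub>F \<Theta>) \<Theta> (\<eta> g)"
    by metis
  note ee = Y.two_morphism_simps[OF \<eta>, simplified]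
  define B where "B z a = band z (ARes A (to_final C X (POb Ybar z)) a)" for z a
  have "\<exists>b. \<forall>g\<in>carrier G. \<forall>h\<in>carrier G. b g h \<in> sec X \<and>
     (\<forall>z \<in> Obj Ybar. \<eta> g z \<cdot> (FAr (F g) (\<eta> h z) \<cdot> \<alpha> g h (FOb \<Theta> z)) = B z (b g h) \<cdot> \<eta> (g \<otimes>\<^bsub>G\<^esub> h) z)"
  proof (rule bchoice, rule ballI, rule bchoice, rule ballI)
    fix g h assume g: "g \<in> carrier G" and h: "h \<in> carrier G"
    then have gh: "g \<otimes>\<^bsub>G\<^esub> h \<in> carrier G" by simp
    note Fgh = gerbe_morphism_comp[OF Fm[OF h] Fm[OF g]]
    have 1: "two_morphism C Ybar Y (F (g \<otimes>\<^bsub>G\<^esub> h) \<circ>\<^sub>F \<Theta>) (F g \<circ>\<^sub>F (F h \<circ>\<^sub>F \<Theta>)) (whisker_right (\<alpha> g h) \<Theta>)"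
      using Y.two_morphism_whisker_right[OF theta_morphism am[OF g h]] by (simp add: fctr_comp_assoc)
    have 2: "two_morphism C Ybar Y (F g \<circ>\<^sub>F (F h \<circ>\<^sub>F \<Theta>)) (F g \<circ>\<^sub>F \<Theta>) (whisker_left (F g) (\<eta> h))"
      by (rule Y.two_morphism_whisker_left[OF FT[OF h] theta_morphism Fm[OF g]
            Yb.total.category_axioms Y.fibred_in_groupoids_axioms \<eta>[OF h]])
    obtain \<epsilon> where \<epsilon>: "two_morphism C Ybar Y \<Theta> (F (g \<otimes>\<^bsub>G\<^esub> h) \<circ>\<^sub>F \<Theta>) \<epsilon>"
      and inv: "\<And>z. z \<in> Obj Ybar \<Longrightarrow> \<epsilon> z \<cdot> \<eta> (g \<otimes>\<^bsub>G\<^esub> h) z = Idn Y (FOb (F (g \<otimes>\<^bsub>G\<^esub> h) \<circ>\<^sub>F \<Theta>) z)"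
      using Y.two_morphism_inverse[OF Yb.total.category_axioms FT[OF gh] theta_morphism \<eta>[OF gh]] by metis
    note V = Y.two_morphism_vcomp[OF Yb.total.category_axioms _ _ _ _ _ Yb.proj_obj]
    note FgFhT = gerbe_morphism_comp[OF FT[OF h] Fm[OF g]]
    let ?\<delta> = "vcomp Y (vcomp Y (\<eta> g) (vcomp Y (whisker_left (F g) (\<eta> h)) (whisker_right (\<alpha> g h) \<Theta>))) \<epsilon>"
    have "two_morphism C Ybar Y \<Theta> \<Theta> ?\<delta>"
      by (rule V[OF theta_morphism FT[OF gh] theta_morphism \<epsilon>
            V[OF FT[OF gh] FT[OF g] theta_morphism V[OF FT[OF gh] FgFhT FT[OF g] 1 2] \<eta>[OF g]]])
    then obtain b where b: "b \<in> sec X" "\<And>z. z \<in> Obj Ybar \<Longrightarrow> ?\<delta> z = B z b"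
      using theta_automorphism_section[OF X] unfolding B_def by metis
    have "\<eta> g z \<cdot> (FAr (F g) (\<eta> h z) \<cdot> \<alpha> g h (FOb \<Theta> z)) = B z b \<cdot> \<eta> (g \<otimes>\<^bsub>G\<^esub> h) z"
      if z: "z \<in> Obj Ybar" for z
      unfolding b(2)[OF z, symmetric]
      using inv[OF z] z ae(1-4)[OF g h, of "FOb \<Theta> z"] ee(1-4)[OF g z] ee(1-4)[OF h z] ee(1-4)[OF gh z] m[OF g]
        Y.two_morphism_simps(1-4)[OF \<epsilon> z]
      by (simp add: vcomp_def whisker_left_def whisker_right_def)
    with b(1) show "\<exists>b. b \<in> sec X \<and>
        (\<forall>z \<in> Obj Ybar. \<eta> g z \<cdot> (FAr (F g) (\<eta> h z) \<cdot> \<alpha> g h (FOb \<Theta> z)) = B z b \<cdot> \<eta> (g \<otimes>\<^bsub>G\<^esub> h) z)"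
      by blast
  qed
  then obtain b where b: "\<And>g h. \<lbrakk>g \<in> carrier G; h \<in> carrier G\<rbrakk> \<Longrightarrow> b g h \<in> sec X"
    and rel: "\<And>g h z. \<lbrakk>g \<in> carrier G; h \<in> carrier G; z \<in> Obj Ybar\<rbrakk> \<Longrightarrow>
       \<eta> g z \<cdot> (FAr (F g) (\<eta> h z) \<cdot> \<alpha> g h (FOb \<Theta> z)) = B z (b g h) \<cdot> \<eta> (g \<otimes>\<^bsub>G\<^esub> h) z"
    by blast
  define c where "c = (\<lambda>l \<in> tuples G 2. b (l ! 0) (l ! 1))"
  have c: "c \<in> carrier (cochains G (Grp A X) 2)"
  proof -
    have "l ! 0 \<in> carrier G" "l ! 1 \<in> carrier G" if "l \<in> tuples G 2" for l
      using that nth_mem[of 0 l] nth_mem[of 1 l] by (auto simp: tuples_def)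
    then show ?thesis
      using b by (auto simp: c_def cochains_def)
  qed
  have c2: "c [g, h] = b g h" if "g \<in> carrier G" "h \<in> carrier G" for g h
    using that by (simp add: c_def tuples_def)
  have rcl: "ARes A (to_final C X U) a \<in> sec U" if "a \<in> sec X" "U \<in> Obj C" for a U
    using fin[OF that(2)] that by simp
  have Barr: "B z a \<in> Arr Y" "Src Y (B z a) = FOb \<Theta> z" "Tgt Y (B z a) = FOb \<Theta> z"
      "PAr Y (B z a) = Idn C (POb Ybar z)" if "z \<in> Obj Ybar" "a \<in> sec X" for z a
    using Y.band_arr[of "FOb \<Theta> z"] rcl[OF that(2), of "POb Ybar z"] that by (simp_all add: B_def)
  have Bmult: "B z (a \<otimes>\<^bsub>Grp A X\<^esub> a') = B z a \<cdot> B z a'"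
    if "z \<in> Obj Ybar" "a \<in> sec X" "a' \<in> sec X" for z a a'
    using ares_mult[of "to_final C X (POb Ybar z)" a a'] fin[of "POb Ybar z"] that
      Y.band_mult[of "FOb \<Theta> z"] rcl[of _ "POb Ybar z"] by (simp add: B_def)
  \<comment> \<open>For the definite description in the cochain: the components at the objects
    \<open>\<Theta> z\<close> already detect a section over \<open>X\<close>, because bands act
    freely and \<open>Ybar\<close> has objects over a cover of \<open>X\<close>.\<close>
  have unique: "a = a'"
    if a: "a \<in> sec X" "a' \<in> sec X" and g: "g \<in> carrier G"
      and eq: "\<And>z. z \<in> Obj Ybar \<Longrightarrow> \<exists>u. u \<in> Arr Y \<and> Src Y u = FOb (F g) (FOb \<Theta> z) \<and>
         u \<cdot> section_two_aut C X A Y (F g) a (FOb \<Theta> z) = u \<cdot> section_two_aut C X A Y (F g) a' (FOb \<Theta> z)"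
    for a a' g
  proof (rule section_determined[OF X a])
    fix z assume z: "z \<in> Obj Ybar"
    obtain u where u: "u \<in> Arr Y" "Src Y u = FOb (F g) (FOb \<Theta> z)"
      "u \<cdot> section_two_aut C X A Y (F g) a (FOb \<Theta> z) = u \<cdot> section_two_aut C X A Y (F g) a' (FOb \<Theta> z)"
      using eq[OF z] by blast
    show "ARes A (to_final C X (POb Ybar z)) a = ARes A (to_final C X (POb Ybar z)) a'"
      by (rule Y.band_cancel[of u "FOb (F g) (FOb \<Theta> z)"])
        (use u z m[OF g] rcl[OF a(1)] rcl[OF a(2)] in \<open>simp_all add: section_two_aut_def\<close>)
  qed
  have cochain: "(THE a. a \<in> sec X \<and>
          (\<forall>x \<in> Obj Y.
             vcomp Y (whisker_right (\<alpha> g1 g2) (F g3))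
               (vcomp Y (\<alpha> (g1 \<otimes>\<^bsub>G\<^esub> g2) g3)
                 (section_two_aut C X A Y (F (g1 \<otimes>\<^bsub>G\<^esub> g2 \<otimes>\<^bsub>G\<^esub> g3)) a)) x =
             vcomp Y (whisker_left (F g1) (\<alpha> g2 g3)) (\<alpha> g1 (g2 \<otimes>\<^bsub>G\<^esub> g3)) x)) =
      coboundary G (Grp A X) (\<lambda>g. \<phi> g X) 2 c [g1, g2, g3]"
    (is "(THE a. ?P a) = ?a")
    if g: "g1 \<in> carrier G" "g2 \<in> carrier G" "g3 \<in> carrier G" for g1 g2 g3
  proof -
    have gg: "g1 \<otimes>\<^bsub>G\<^esub> g2 \<in> carrier G" "g2 \<otimes>\<^bsub>G\<^esub> g3 \<in> carrier G" "g1 \<otimes>\<^bsub>G\<^esub> g2 \<otimes>\<^bsub>G\<^esub> g3 \<in> carrier G"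
      using g by auto
    have as: "g1 \<otimes>\<^bsub>G\<^esub> (g2 \<otimes>\<^bsub>G\<^esub> g3) = g1 \<otimes>\<^bsub>G\<^esub> g2 \<otimes>\<^bsub>G\<^esub> g3" using g by (simp add: G.m_assoc)
    let ?g12 = "g1 \<otimes>\<^bsub>G\<^esub> g2" and ?g23 = "g2 \<otimes>\<^bsub>G\<^esub> g3" and ?g123 = "g1 \<otimes>\<^bsub>G\<^esub> g2 \<otimes>\<^bsub>G\<^esub> g3"
    let ?F = "F ?g123" and ?T = "F g1 \<circ>\<^sub>F (F g2 \<circ>\<^sub>F F g3)"
    let ?left = "\<lambda>a. vcomp Y (whisker_right (\<alpha> g1 g2) (F g3)) (vcomp Y (\<alpha> ?g12 g3) (section_two_aut C X A Y ?F a))"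
    let ?right = "vcomp Y (whisker_left (F g1) (\<alpha> g2 g3)) (\<alpha> g1 ?g23)"
    have a: "?a \<in> sec X"
      using M.cochain_closed[OF M.coboundary_closed[OF c], of "[g1, g2, g3]"] g by (simp add: tuples_def)
    note V = Y.two_morphism_vcomp[OF Y.total.category_axioms _ _ _ _ _ Y.proj_obj]
    note F23 = gerbe_morphism_comp[OF Fm[OF g(3)] Fm[OF g(2)]]
    note F1_23 = gerbe_morphism_comp[OF F23 Fm[OF g(1)]]
    note F12_3 = gerbe_morphism_comp[OF Fm[OF g(3)] Fm[OF gg(1)]]
    note F1_p23 = gerbe_morphism_comp[OF Fm[OF gg(2)] Fm[OF g(1)]]
    have left: "two_morphism C Y Y ?F ?T (?left a)" if "a \<in> sec X" for a
      using V[OF Fm[OF gg(3)] F12_3 F1_23 V[OF Fm[OF gg(3)] Fm[OF gg(3)] F12_3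
          section_two_aut_morphism[OF X Fm[OF gg(3)] that] am[OF gg(1) g(3)]]]
        Y.two_morphism_whisker_right[OF Fm[OF g(3)] am[OF g(1,2)]] by (simp add: fctr_comp_assoc)
    have right: "two_morphism C Y Y ?F ?T ?right"
      using V[OF Fm[OF gg(3)] F1_p23 F1_23 _ Y.two_morphism_whisker_left[OF Fm[OF gg(2)] F23 Fm[OF g(1)]
          Y.total.category_axioms Y.fibred_in_groupoids_axioms am[OF g(2,3)]]] am[OF g(1) gg(2)] by (simp add: as)
    have key: "?left ?a (FOb \<Theta> z) = ?right (FOb \<Theta> z)" if z: "z \<in> Obj Ybar" for z
    proof -
      let ?t = "FOb \<Theta> z" and ?V = "POb Ybar z"
      have t: "?t \<in> Obj Y" "POb Y ?t = ?V" "?V \<in> Obj C" using z by auto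
      note E = ee(1-4)[OF g(1) z] ee(1-4)[OF g(2) z] ee(1-4)[OF g(3) z] ee(1-4)[OF gg(1) z]
        ee(1-4)[OF gg(2) z] ee(1-4)[OF gg(3) z]
      note Fs = m(1-6)[OF g(1)] m(1-6)[OF g(2)] m(1-6)[OF g(3)] m(1-6)[OF gg(1)] m(1-6)[OF gg(2)] m(1-6)[OF gg(3)]
      note cmp = m(8)[OF g(1)] m(8)[OF g(2)]
      have A12: "\<alpha> g1 g2 x \<in> Arr Y" "Src Y (\<alpha> g1 g2 x) = FOb (F ?g12) x"
          "Tgt Y (\<alpha> g1 g2 x) = FOb (F g1) (FOb (F g2) x)" if "x \<in> Obj Y" for x
        using ae(1-3)[OF g(1,2) that] .
      have A23: "\<alpha> g2 g3 ?t \<in> Arr Y" "Src Y (\<alpha> g2 g3 ?t) = FOb (F ?g23) ?t"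
          "Tgt Y (\<alpha> g2 g3 ?t) = FOb (F g2) (FOb (F g3) ?t)"
        using ae(1-3)[OF g(2,3) t(1)] .
      have A12_3: "\<alpha> ?g12 g3 ?t \<in> Arr Y" "Src Y (\<alpha> ?g12 g3 ?t) = FOb ?F ?t"
          "Tgt Y (\<alpha> ?g12 g3 ?t) = FOb (F ?g12) (FOb (F g3) ?t)"
        using ae(1-3)[OF gg(1) g(3) t(1)] .
      have A1_23: "\<alpha> g1 ?g23 ?t \<in> Arr Y" "Src Y (\<alpha> g1 ?g23 ?t) = FOb ?F ?t"
          "Tgt Y (\<alpha> g1 ?g23 ?t) = FOb (F g1) (FOb (F ?g23) ?t)"
        using ae(1-3)[OF g(1) gg(2) t(1)] as by simp_all
      have bcl: "b g1 g2 \<in> sec X" "b g2 g3 \<in> sec X"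
          "b ?g12 g3 \<in> sec X" "b g1 ?g23 \<in> sec X"
          "\<phi> g1 X (b g2 g3) \<in> sec X"
        using b g gg XC by auto
      note Bs = Barr[OF z bcl(1)] Barr[OF z bcl(2)] Barr[OF z bcl(3)] Barr[OF z bcl(4)] Barr[OF z bcl(5)] Barr[OF z a]
      let ?S = "section_two_aut C X A Y ?F ?a ?t"
      have S: "?S \<in> Arr Y" "Src Y ?S = FOb ?F ?t" "Tgt Y ?S = FOb ?F ?t"
        using Y.two_morphism_simps(1-3)[OF section_two_aut_morphism[OF X Fm[OF gg(3)] a] t(1)] .
      have Sb: "\<eta> ?g123 z \<cdot> ?S = B z ?a \<cdot> \<eta> ?g123 z"
        unfolding section_two_aut_def B_def
        using Y.band_vertical[of "\<eta> ?g123 z" "FOb ?F ?t" ?t "ARes A (to_final C X ?V) ?a"]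
          ee(1-4)[OF gg(3) z] m(1,2)[OF gg(3)] t rcl[OF a t(3)] by simp
      have rel': "\<eta> g z \<cdot> (FAr (F g) (\<eta> h z) \<cdot> (\<alpha> g h ?t \<cdot> w)) = B z (b g h) \<cdot> (\<eta> (g \<otimes>\<^bsub>G\<^esub> h) z \<cdot> w)"
        if gh: "g \<in> carrier G" "h \<in> carrier G" and w: "w \<in> Arr Y" "Tgt Y w = FOb (F (g \<otimes>\<^bsub>G\<^esub> h)) ?t" for g h w
      proof -
        have gh': "g \<otimes>\<^bsub>G\<^esub> h \<in> carrier G" using gh by simp
        have "\<eta> g z \<cdot> (FAr (F g) (\<eta> h z) \<cdot> (\<alpha> g h ?t \<cdot> w)) =
            (\<eta> g z \<cdot> (FAr (F g) (\<eta> h z) \<cdot> \<alpha> g h ?t)) \<cdot> w"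
          using w ae(1-3)[OF gh t(1)] ee(1-3)[OF gh(1) z] ee(1-3)[OF gh(2) z] m(3-5)[OF gh(1)] by simp
        also have "\<dots> = B z (b g h) \<cdot> (\<eta> (g \<otimes>\<^bsub>G\<^esub> h) z \<cdot> w)"
          unfolding rel[OF gh z] using w ee(1-3)[OF gh' z] Barr[OF z b[OF gh]] by simp
        finally show ?thesis .
      qed
      \<comment> \<open>\<open>?E\<close> compares the triple composite at \<open>\<Theta> z\<close>
        with \<open>\<Theta> z\<close>. After composition with it each pasting becomes a section
        followed by \<open>\<eta> ?g123 z\<close>: on the left the product of
        \<open>b g1 g2\<close>, \<open>b ?g12 g3\<close> and \<open>?a\<close>, on the right that of
        \<open>b g1 ?g23\<close> and the translate of \<open>b g2 g3\<close> by \<open>g1\<close>.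
        They agree by the formula for \<open>?a\<close>.\<close>
      let ?E = "\<eta> g1 z \<cdot> (FAr (F g1) (\<eta> g2 z) \<cdot> FAr (F g1) (FAr (F g2) (\<eta> g3 z)))"
      \<comment> \<open>Naturality of \<open>\<alpha> g1 g2\<close> at the arrow
        \<open>\<eta> g3 z\<close> separates the two triples of factors to which \<open>rel'\<close>
        applies.\<close>
      have nat: "FAr (F g1) (FAr (F g2) (\<eta> g3 z)) \<cdot> \<alpha> g1 g2 (FOb (F g3) ?t) =
          \<alpha> g1 g2 ?t \<cdot> FAr (F ?g12) (\<eta> g3 z)"
        using ae(5)[OF g(1,2), of "\<eta> g3 z"] ee(1-3)[OF g(3) z] by simp
      have "?E \<cdot> ?left ?a ?t = \<eta> g1 z \<cdot> (FAr (F g1) (\<eta> g2 z) \<cdot> (\<alpha> g1 g2 ?t \<cdot>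
          (FAr (F ?g12) (\<eta> g3 z) \<cdot> (\<alpha> ?g12 g3 ?t \<cdot> ?S))))"
        using E Fs A12 A12_3 S t by (simp add: vcomp_def whisker_right_def Y.total.reassoc[OF nat])
      also have "\<dots> = B z (b g1 g2) \<cdot> (\<eta> ?g12 z \<cdot>
          (FAr (F ?g12) (\<eta> g3 z) \<cdot> (\<alpha> ?g12 g3 ?t \<cdot> ?S)))"
        using E Fs A12_3 S t by (intro rel' g) simp_all
      also have "\<dots> = B z (b g1 g2) \<cdot> (B z (b ?g12 g3) \<cdot> (\<eta> ?g123 z \<cdot> ?S))"
        using rel'[OF gg(1) g(3) S(1,3)] by simp
      also have "\<dots> = B z (b g1 g2 \<otimes>\<^bsub>Grp A X\<^esub> (b ?g12 g3 \<otimes>\<^bsub>Grp A X\<^esub> ?a)) \<cdot> \<eta> ?g123 z"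
        unfolding Sb using E Bs z bcl a by (simp add: Bmult)
      finally have 1: "?E \<cdot> ?left ?a ?t =
          B z (b g1 g2 \<otimes>\<^bsub>Grp A X\<^esub> (b ?g12 g3 \<otimes>\<^bsub>Grp A X\<^esub> ?a)) \<cdot> \<eta> ?g123 z" .
      have B23: "FAr (F g1) (B z (b g2 g3)) \<in> Arr Y" "Src Y (FAr (F g1) (B z (b g2 g3))) = FOb (F g1) ?t"
          "Tgt Y (FAr (F g1) (B z (b g2 g3))) = FOb (F g1) ?t"
        using Bs Fs by simp_all
      \<comment> \<open>Here the action on coefficients enters: equivariance of \<open>F g1\<close>
        accounts for the term with \<open>\<phi> g1\<close> in the coboundary.\<close>
      have slide: "\<eta> g1 z \<cdot> FAr (F g1) (B z (b g2 g3)) = B z (\<phi> g1 X (b g2 g3)) \<cdot> \<eta> g1 z"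
      proof -
        have "FAr (F g1) (B z (b g2 g3)) = Band Y (FOb (F g1) ?t) (ARes A (to_final C X ?V) (\<phi> g1 X (b g2 g3)))"
          using Fband[OF g(1) t(1), of "ARes A (to_final C X ?V) (b g2 g3)"] rcl[OF bcl(2) t(3)] t
            phi_ares[OF g(1) fin(1)[OF t(3)] fin(2)[OF t(3)] fin(3)[OF t(3)] bcl(2)] by (simp add: B_def)
        then show ?thesis
          using Y.band_vertical[of "\<eta> g1 z" "FOb (F g1) ?t" ?t "ARes A (to_final C X ?V) (\<phi> g1 X (b g2 g3))"]
            ee(1-4)[OF g(1) z] m(1,2)[OF g(1)] t rcl[OF bcl(5) t(3)] by (simp add: B_def)
      qed
      have rel23: "FAr (F g1) (\<eta> g2 z) \<cdot> (FAr (F g1) (FAr (F g2) (\<eta> g3 z)) \<cdot> (FAr (F g1) (\<alpha> g2 g3 ?t) \<cdot> w)) =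
          FAr (F g1) (B z (b g2 g3)) \<cdot> (FAr (F g1) (\<eta> ?g23 z) \<cdot> w)"
        if w: "w \<in> Arr Y" "Tgt Y w = FOb (F g1) (FOb (F ?g23) ?t)" for w
      proof -
        have "FAr (F g1) (\<eta> g2 z) \<cdot> (FAr (F g1) (FAr (F g2) (\<eta> g3 z)) \<cdot> (FAr (F g1) (\<alpha> g2 g3 ?t) \<cdot> w)) =
            FAr (F g1) (\<eta> g2 z \<cdot> (FAr (F g2) (\<eta> g3 z) \<cdot> \<alpha> g2 g3 ?t)) \<cdot> w"
          using w E Fs A23 cmp by simp
        also have "\<dots> = FAr (F g1) (B z (b g2 g3)) \<cdot> (FAr (F g1) (\<eta> ?g23 z) \<cdot> w)"
          unfolding rel[OF g(2,3) z] using w E Fs Bs cmp by simp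
        finally show ?thesis .
      qed
      have "?E \<cdot> ?right ?t = \<eta> g1 z \<cdot> (FAr (F g1) (\<eta> g2 z) \<cdot> (FAr (F g1) (FAr (F g2) (\<eta> g3 z)) \<cdot>
          (FAr (F g1) (\<alpha> g2 g3 ?t) \<cdot> \<alpha> g1 ?g23 ?t)))"
        using E Fs A23 A1_23 by (simp add: vcomp_def whisker_left_def)
      also have "\<dots> = B z (\<phi> g1 X (b g2 g3)) \<cdot> (\<eta> g1 z \<cdot> (FAr (F g1) (\<eta> ?g23 z) \<cdot> \<alpha> g1 ?g23 ?t))"
        using E Fs A1_23 B23 Bs by (simp add: rel23 Y.total.reassoc[OF slide])
      also have "\<dots> = B z (\<phi> g1 X (b g2 g3) \<otimes>\<^bsub>Grp A X\<^esub> b g1 ?g23) \<cdot> \<eta> ?g123 z"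
        unfolding rel[OF g(1) gg(2) z] as using E Bs z bcl by (simp add: Bmult)
      also have "\<phi> g1 X (b g2 g3) \<otimes>\<^bsub>Grp A X\<^esub> b g1 ?g23 =
          b g1 g2 \<otimes>\<^bsub>Grp A X\<^esub> (b ?g12 g3 \<otimes>\<^bsub>Grp A X\<^esub> ?a)"
      proof -
        let ?p = "\<phi> g1 X (b g2 g3) \<otimes>\<^bsub>Grp A X\<^esub> b g1 ?g23"
        let ?n = "b ?g12 g3 \<otimes>\<^bsub>Grp A X\<^esub> b g1 g2"
        have "?a = ?p \<otimes>\<^bsub>Grp A X\<^esub> inv\<^bsub>Grp A X\<^esub> ?n"
          using M.coboundary_2[OF c g] c2 g gg by simp
        then show ?thesis
          using M.M.mult_quotient[of "b g1 g2" "b ?g12 g3" ?p] bcl by simp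
      qed
      finally have 2: "?E \<cdot> ?left ?a ?t = ?E \<cdot> ?right ?t" unfolding 1 by simp
      show ?thesis
      proof (rule Y.vertical_monic[OF 2])
        show "PAr Y ?E = Idn C (POb Y (Src Y ?E))"
          using E Fs t by simp
        show "?left ?a ?t \<in> Arr Y" "?right ?t \<in> Arr Y" "Tgt Y (?left ?a ?t) = Src Y ?E" "Tgt Y (?right ?t) = Src Y ?E"
          using Y.two_morphism_simps(1-3)[OF left[OF a] t(1)] Y.two_morphism_simps(1-3)[OF right t(1)] E Fs by simp_all
      qed (use E Fs in simp)
    qed
    show ?thesis
    proof (rule the_equality)
      \<comment> \<open>The equation was checked at the objects \<open>\<Theta> z\<close>; as both
        sides are 2-morphisms, it extends to every object of \<open>Y\<close>.\<close>
      show "?P ?a"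
        using a two_morphism_eqI[OF Fm[OF gg(3)] F1_23 left[OF a] right key] by blast
      fix a' assume a': "?P a'"
      show "a' = ?a"
      proof (rule unique[OF _ a gg(3)])
        fix z assume z: "z \<in> Obj Ybar"
        let ?t = "FOb \<Theta> z"
        let ?u = "\<alpha> g1 g2 (FOb (F g3) ?t) \<cdot> \<alpha> ?g12 g3 ?t"
        have t: "?t \<in> Obj Y" "FOb (F g3) ?t \<in> Obj Y" using z m(1)[OF g(3)] by auto
        note S = Y.two_morphism_simps(1-3)[OF section_two_aut_morphism[OF X Fm[OF gg(3)]] t(1)]
        have "?left a' ?t = ?left ?a ?t"
          using a' key[OF z] t by simp
        then show "\<exists>u. u \<in> Arr Y \<and> Src Y u = FOb ?F ?t \<and>
            u \<cdot> section_two_aut C X A Y ?F a' ?t = u \<cdot> section_two_aut C X A Y ?F ?a ?t"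
          using ae(1-3)[OF g(1,2) t(2)] ae(1-3)[OF gg(1) g(3) t(1)] S[OF a] S[of a'] a'
          by (intro exI[of _ ?u]) (simp add: vcomp_def whisker_right_def)
      qed (use a' in simp)
    qed
  qed
  have "gerbe_cochain C X G A Y F \<alpha> = coboundary G (Grp A X) (\<lambda>g. \<phi> g X) 2 c"
  proof
    fix l
    show "gerbe_cochain C X G A Y F \<alpha> l = coboundary G (Grp A X) (\<lambda>g. \<phi> g X) 2 c l"
    proof (cases "l \<in> tuples G 3")
      case True
      then obtain g1 g2 g3 where l: "l = [g1, g2, g3]" and g: "g1 \<in> carrier G" "g2 \<in> carrier G" "g3 \<in> carrier G"
        by (auto simp: tuples_def eval_nat_numeral length_Suc_conv)
      show ?thesis
        using True cochain[OF g] by (simp add: l gerbe_cochain_def)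
    qed (simp add: gerbe_cochain_def coboundary_def)
  qed
  then show thesis using that c by blast
qed

lemma compatible_obstruction_zero:
  assumes "final_object C X" and "compatible_gerbe_lift C G A \<phi> Ybar Y \<Theta> F"
  shows "gerbe_obstruction_zero C X G A \<phi> Y F"
  unfolding gerbe_obstruction_zero_def
  using compatible_obstruction[OF assms] zero_class_coboundary_2 assms(1)
  by (metis final_object_def)

end

theorem proposition4p34:
  fixes C :: "('o, 'm) site" and X :: 'o
    and G :: "'g monoid"
    and A :: "('o, 'm, 'a) absheaf"
    and \<phi> :: "'g \<Rightarrow> 'o \<Rightarrow> 'a \<Rightarrow> 'a"
  assumes "site C" and "final_object C X"
    and "group G" and "finite (carrier G)"
    and "abelian_sheaf C A" and "sheaf_action C G A \<phi>"
  shows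
    "(\<forall>y :: ('o, 'm, 'a, 'y) torsor.
       torsor C A y \<and> torsor_induced_from_invariants TYPE('z) C G A \<phi> y \<longrightarrow>
       (\<exists>lam. torsor_lift C G A \<phi> y lam \<and> torsor_obstruction_zero C X G A \<phi> y lam)) \<and>
     (\<forall>Y :: ('e, 't, 'o, 'm, 'a) gerbe.
       banded_gerbe C A Y \<and> gerbe_induced_from_invariants TYPE('d) TYPE('s) C G A \<phi> Y \<longrightarrow>
       (\<exists>F. gerbe_lift C G A \<phi> Y F \<and> gerbe_obstruction_zero C X G A \<phi> Y F)) \<and>
     (\<forall>(ybar :: ('o, 'm, 'a, 'z) torsor) (y :: ('o, 'm, 'a, 'y) torsor) f.
       torsor C (invariants G A \<phi>) ybar \<and> torsor C A y \<and>
       torsor_equivariant C (invariants G A \<phi>) incl ybar y f \<longrightarrow>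
       (\<exists>lam. compatible_torsor_lift C G A \<phi> ybar y f lam) \<and>
       (\<forall>lam lam'. compatible_torsor_lift C G A \<phi> ybar y f lam \<and>
                    compatible_torsor_lift C G A \<phi> ybar y f lam' \<longrightarrow>
          (\<forall>g \<in> carrier G. \<forall>U \<in> Obj C. \<forall>x \<in> Sec y U. lam g U x = lam' g U x)) \<and>
       (\<forall>lam. compatible_torsor_lift C G A \<phi> ybar y f lam \<longrightarrow>
          torsor_cochain C X G A y lam = \<one>\<^bsub>cochains G (Grp A X) 2\<^esub>)) \<and>
     (\<forall>(Ybar :: ('d, 's, 'o, 'm, 'a) gerbe) (Y :: ('e, 't, 'o, 'm, 'a) gerbe) \<Theta>.
       banded_gerbe C (invariants G A \<phi>) Ybar \<and> banded_gerbe C A Y \<and>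
       gerbe_equivariant (invariants G A \<phi>) incl Ybar Y \<Theta> \<longrightarrow>
       (\<exists>F. compatible_gerbe_lift C G A \<phi> Ybar Y \<Theta> F) \<and>
       (\<forall>F F'. compatible_gerbe_lift C G A \<phi> Ybar Y \<Theta> F \<and>
                compatible_gerbe_lift C G A \<phi> Ybar Y \<Theta> F' \<longrightarrow>
          (\<forall>g \<in> carrier G. two_isomorphic C Y Y (F g) (F' g))) \<and>
       (\<forall>F. compatible_gerbe_lift C G A \<phi> Ybar Y \<Theta> F \<longrightarrow>
          gerbe_obstruction_zero C X G A \<phi> Y F))"
proof -
  interpret S: equivariant_sheaf C G A \<phi>
    using assms by (simp add: equivariant_sheaf_def equivariant_sheaf_axioms_def)
  have X: "X \<in> Obj C" using assms(2) by (simp add: final_object_def)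
  have T: "induced_torsor C G A \<phi> ybar y f"
    if "torsor C (invariants G A \<phi>) ybar" "torsor C A y" "torsor_equivariant C (invariants G A \<phi>) incl ybar y f"
    for ybar :: "('o, 'm, 'a, 'z) torsor" and y :: "('o, 'm, 'a, 'y) torsor" and f
    using that S.equivariant_sheaf_axioms by (simp add: induced_torsor_def induced_torsor_axioms_def)
  have Y: "induced_gerbe C G A \<phi> Ybar Y \<Theta>"
    if "banded_gerbe C (invariants G A \<phi>) Ybar" "banded_gerbe C A Y"
      "gerbe_equivariant (invariants G A \<phi>) incl Ybar Y \<Theta>"
    for Ybar :: "('d, 's, 'o, 'm, 'a) gerbe" and Y :: "('e, 't, 'o, 'm, 'a) gerbe" and \<Theta>
    using that S.equivariant_sheaf_axioms S.site_axioms
    by (simp add: induced_gerbe_def induced_gerbe_axioms_def gerbe_on_site_def stack_on_site_def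
        banded_gerbe_def abelian_gerbe_def)
  note a = induced_torsor.compatible_torsor_lift_lift[OF T]
    induced_torsor.torsor_cochain_trivial[OF T assms(2)]
    induced_torsor.compatible_torsor_lift_unique[OF T]
  note b = induced_gerbe.compatible_gerbe_lift_exists[OF Y]
    induced_gerbe.compatible_obstruction_zero[OF Y assms(2)]
    induced_gerbe.compatible_gerbe_lift_unique[OF Y]
  have torsor_zero: "zero_class X G A \<phi> 2 \<one>\<^bsub>cochains G (Grp A X) 2\<^esub>"
    using S.zero_class_one[OF X, of 1] by (simp add: eval_nat_numeral)
  show ?thesis
  proof (intro conjI allI impI ballI, goal_cases)
    case (1 y)
    then obtain ybar :: "('o, 'm, 'a, 'z) torsor" and f
      where y: "torsor C (invariants G A \<phi>) ybar" "torsor C A y"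
        "torsor_equivariant C (invariants G A \<phi>) incl ybar y f"
      by (auto simp: torsor_induced_from_invariants_def)
    obtain lam where "compatible_torsor_lift C G A \<phi> ybar y f lam" using a(1)[OF y] by blast
    then show ?case
      using a(2)[OF y] torsor_zero by (auto simp: compatible_torsor_lift_def torsor_obstruction_zero_def)
  next
    case (2 Y)
    then obtain Ybar :: "('d, 's, 'o, 'm, 'a) gerbe" and \<Theta>
      where Y: "banded_gerbe C (invariants G A \<phi>) Ybar" "banded_gerbe C A Y"
        "gerbe_equivariant (invariants G A \<phi>) incl Ybar Y \<Theta>"
      by (auto simp: gerbe_induced_from_invariants_def)
    obtain F where "compatible_gerbe_lift C G A \<phi> Ybar Y \<Theta> F" using b(1)[OF Y] by blast
    then show ?case
      using b(2)[OF Y] by (auto simp: compatible_gerbe_lift_def)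
  next
    case (3 ybar y f)
    then show ?case using a(1) by blast
  next
    case (4 ybar y f lam lam' g U x)
    then show ?case using a(3)[of ybar y f lam lam' g U x] by simp
  next
    case (5 ybar y f lam)
    then show ?case using a(2)[of ybar y f lam] by simp
  next
    case (6 Ybar Y \<Theta>)
    then show ?case using b(1)[of Ybar Y \<Theta>] by simp
  next
    case (7 Ybar Y \<Theta> F F' g)
    then show ?case using b(3)[of Ybar Y \<Theta> F F' g] by simp
  next
    case (8 Ybar Y \<Theta> F)
    then show ?case using b(2)[of Ybar Y \<Theta> F] by simp
  qed
qed

end
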